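(* If $Z=(X,Y)\in\Omega_{fn}$, then $Z$ is locally $\Sigma$-equivalent near the origin to $Z_{fn}=(X_{fn},Y_{fn})\in\Omega_{fn}$, where $$X_{fn}(x,y)=(-y,\ x),\qquad Y_{fn}(x,y)=(2\beta x+y,\ x+2\beta y)$$ and $$\beta=\begin{cases}\mathrm{sign}(\lambda_1^-+\lambda_2^-)&\text{when }\lambda_1^-,\lambda_2^-\in\mathbb R,\\ \mathrm{sign}(\lambda_1^++\lambda_2^+)&\text{when }\lambda_1^+,\lambda_2^+\in\mathbb R.\end{cases}$$
   Context: Let $\mathcal U\subset\mathbb R^2$ be a bounded open set containing the origin $O$, and let $\mathfrak X$ be the set of $\mathcal C^1$ vector fields on $\mathcal U$. Put $\Sigma^+=\{(x,y)\in\mathcal U:y>0\}$, $\Sigma^-=\{(x,y)\in\mathcal U:y<0\}$, $\Sigma=\{(x,y)\in\mathcal U:y=0\}$ (the switching line). $\Omega$ is the set of piecewise smooth vector fields $Z=(X,Y)$, with $X=(X_1,X_2)$, $Y=(Y_1,Y_2)\in\mathfrak X$, given by $Z=X$ on $\Sigma^+$ and $Z=Y$ on $\Sigma^-$. On $\Sigma$, $Z$ is defined to be $Z_\Sigma$ by the Filippov convention. If $X\equiv Y$ on $\Sigma$, then $Z_\Sigma=X=Y$. Otherwise: on the crossing set $\Sigma^c=\{p\in\Sigma:X_2(p)Y_2(p)>0\}$, $Z_\Sigma=X$ if $X_2>0$ and $Z_\Sigma=Y$ if $X_2<0$ (orbits cross $\Sigma$ there); on the sliding set $\Sigma^s=\{p\in\Sigma:X_2(p)Y_2(p)\le0\}$,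 $Z_\Sigma=\left(\frac{Y_2X_1-X_2Y_1}{Y_2-X_2},0\right)$ if $X_2\ne Y_2$, and $Z_\Sigma=(0,0)$ if $X_2=Y_2=0$. Orbits of $Z$ are obtained by concatenating orbits of $X$ in $\Sigma^+$, $Y$ in $\Sigma^-$ and $Z_\Sigma$ in $\Sigma$. $\Omega_0\subset\Omega$ is the set of $Z=(X,Y)$ with $X(0,0)=Y(0,0)=(0,0)$, $\det A^+\det A^-\neq0$ and $X_{2x}(0,0)\,Y_{2x}(0,0)>0$, where $A^+$ (resp. $A^-$) is the Jacobian matrix of $X$ (resp. $Y$) at $O$ and the subscript $x$ denotes the partial derivative in $x$. Let $\lambda_1^\pm,\lambda_2^\pm$ be the eigenvalues of $A^\pm$. Then $\Omega_1=\{Z\in\Omega_0:\lambda_1^+\ne\lambda_2^+,\ \lambda_1^-\ne\lambda_2^-,\ \ell\ne0\}$, where $\ell=\frac{\mathrm{Re}\lambda_1^+}{|\mathrm{Im}\lambda_1^+|}+\frac{\mathrm{Re}\lambda_1^-}{|\mathrm{Im}\lambda_1^-|}$ if $\mathrm{Im}\lambda_1^+\,\mathrm{Im}\lambda_1^-\ne0$, and $\ell=1$ if $\mathrm{Im}\lambda_1^+\,\mathrm{Im}\lambda_1^-=0$. Further, $\Omega_{fn}$ is the set of $Z\in\Omega_1$ such that either $\lambda_1^+,\lambda_2^+\in\mathbb C\setminus\mathbb R$, $\lambda_1^-,\lambda_2^-\in\mathbb R$, $\lambda_1^-\lambda_2^->0$, or $\lambda_1^-,\lambda_2^-\in\mathbb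 C\setminus\mathbb R$, $\lambda_1^+,\lambda_2^+\in\mathbb R$, $\lambda_1^+\lambda_2^+>0$. $Z_1,Z_2\in\Omega_0$ are locally $\Sigma$-equivalent near the origin if there exist neighborhoods $U,V$ of the origin and a homeomorphism $H:U\to V$ that maps the orbits of $Z_1$ in $U$ onto the orbits of $Z_2$ in $V$, preserving the direction of time, and sends $\Sigma\cap U$ to $\Sigma\cap V$. *)

theory Defs
  imports "HOL-Analysis.Analysis"
begin

text \<open>
  The bounded open set on which everything lives is a parameter \<open>D\<close>. Vector fields are total
  functions on \<open>real^2\<close> of which only the values on \<open>D\<close> matter, and a piecewise smooth vector
  field \<open>Z\<close> is the pair \<open>(X, Y)\<close>.
\<close>

type_synonym vfield = "real^2 \<Rightarrow> real^2"

definition C1_fields :: "(real^2) set \<Rightarrow> vfield set" where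
  "C1_fields D = {X. (\<forall>p\<in>D. X differentiable (at p)) \<and> continuous_on D (\<lambda>p. jacobian X (at p))}"

definition upper_part :: "(real^2) set \<Rightarrow> (real^2) set" where
  "upper_part D = {p \<in> D. p $ 2 > 0}"

definition lower_part :: "(real^2) set \<Rightarrow> (real^2) set" where
  "lower_part D = {p \<in> D. p $ 2 < 0}"

definition switching_line :: "(real^2) set \<Rightarrow> (real^2) set" where
  "switching_line D = {p \<in> D. p $ 2 = 0}"

definition Omega :: "(real^2) set \<Rightarrow> (vfield \<times> vfield) set" where
  "Omega D = C1_fields D \<times> C1_fields D"

definition crossing_set :: "(real^2) set \<Rightarrow> vfield \<times> vfield \<Rightarrow> (real^2) set" where
  "crossing_set D Z = {p \<in> switching_line D. fst Z p $ 2 * snd Z p $ 2 > 0}"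

text \<open>
  Filippov convention, meant for \<open>p \<in> switching_line D\<close>. The last two branches are reached only on
  the sliding set, where equality of the two second components means that both vanish.
\<close>

definition filippov_field :: "(real^2) set \<Rightarrow> vfield \<times> vfield \<Rightarrow> vfield" where
  "filippov_field D Z p =
     (let X = fst Z; Y = snd Z in
      if \<forall>q\<in>switching_line D. X q = Y q then X p
      else if p \<in> crossing_set D Z then (if X p $ 2 > 0 then X p else Y p)
      else if X p $ 2 \<noteq> Y p $ 2
        then vector [(Y p $ 2 * X p $ 1 - X p $ 2 * Y p $ 1) / (Y p $ 2 - X p $ 2), 0]
      else 0)"

definition solution_arc :: "vfield \<Rightarrow> (real^2) set \<Rightarrow> real set \<Rightarrow> (real \<Rightarrow> real^2) \<Rightarrow> bool" where
  "solution_arc F R J g \<longleftrightarrow>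
     (\<forall>t\<in>J. g t \<in> R \<and> (g has_vector_derivative F (g t)) (at t))"

text \<open>
  A trajectory of \<open>Z\<close> in \<open>U \<subseteq> D\<close>, with interval of definition \<open>I\<close>: a continuous concatenation of
  solution arcs of \<open>X\<close> in the upper part, of \<open>Y\<close> in the lower part and of the Filippov field in the
  switching line. The junctions occur at the times in \<open>S\<close>, which do not accumulate inside \<open>I\<close> (they
  may accumulate at an end point that does not belong to \<open>I\<close>, e.g. for a spiralling orbit). Passing
  through a crossing point is a junction of an arc of \<open>X\<close> and an arc of \<open>Y\<close>.
\<close>

definition trajectory_in ::
  "(real^2) set \<Rightarrow> vfield \<times> vfield \<Rightarrow> (real^2) set \<Rightarrow> real set \<Rightarrow> (real \<Rightarrow> real^2) \<Rightarrow> bool" where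
  "trajectory_in D Z U I g \<longleftrightarrow>
     is_interval I \<and> I \<noteq> {} \<and> continuous_on I g \<and> g ` I \<subseteq> U \<and>
     (\<exists>S. (\<forall>a b. {a..b} \<subseteq> I \<longrightarrow> finite (S \<inter> {a..b})) \<and>
          (\<forall>a b. {a<..<b} \<subseteq> I \<and> {a<..<b} \<inter> S = {} \<longrightarrow>
             solution_arc (fst Z) (upper_part D) {a<..<b} g \<or>
             solution_arc (snd Z) (lower_part D) {a<..<b} g \<or>
             solution_arc (filippov_field D Z) (switching_line D) {a<..<b} g))"

text \<open>
  An orbit of \<open>Z\<close> in \<open>U\<close> together with its direction of time is represented by a trajectory in \<open>U\<close>
  that cannot be extended inside \<open>U\<close>, up to increasing changes of time.
\<close>

definition orbit_in ::
  "(real^2) set \<Rightarrow> vfield \<times> vfield \<Rightarrow> (real^2) set \<Rightarrow> real set \<Rightarrow> (real \<Rightarrow> real^2) \<Rightarrow> bool" where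
  "orbit_in D Z U I g \<longleftrightarrow>
     trajectory_in D Z U I g \<and>
     (\<forall>I' g'. trajectory_in D Z U I' g' \<and> I \<subseteq> I' \<and> (\<forall>t\<in>I. g' t = g t) \<longrightarrow> I' = I)"

text \<open>
  The map \<open>H\<close> carries the trajectory \<open>g\<close> onto \<open>k\<close>, preserving the direction of time. A strictly
  increasing bijection between intervals is automatically a homeomorphism.
\<close>

definition carries_onto ::
  "(real^2 \<Rightarrow> real^2) \<Rightarrow> real set \<Rightarrow> (real \<Rightarrow> real^2) \<Rightarrow> real set \<Rightarrow> (real \<Rightarrow> real^2) \<Rightarrow> bool" where
  "carries_onto H I g J k \<longleftrightarrow>
     (\<exists>h. strict_mono_on I h \<and> h ` I = J \<and> (\<forall>t\<in>I. H (g t) = k (h t)))"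

definition locally_Sigma_equivalent ::
  "(real^2) set \<Rightarrow> vfield \<times> vfield \<Rightarrow> vfield \<times> vfield \<Rightarrow> bool" where
  "locally_Sigma_equivalent D Z1 Z2 \<longleftrightarrow>
     (\<exists>U V H H'. open U \<and> 0 \<in> U \<and> U \<subseteq> D \<and> open V \<and> 0 \<in> V \<and> V \<subseteq> D \<and>
        homeomorphism U V H H' \<and>
        (\<forall>I g. orbit_in D Z1 U I g \<longrightarrow> (\<exists>J k. orbit_in D Z2 V J k \<and> carries_onto H I g J k)) \<and>
        (\<forall>J k. orbit_in D Z2 V J k \<longrightarrow> (\<exists>I g. orbit_in D Z1 U I g \<and> carries_onto H I g J k)) \<and>
        H ` (switching_line D \<inter> U) = switching_line D \<inter> V)"

text \<open>The two complex eigenvalues of a real matrix, counted with algebraic multiplicity.\<close>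

definition eigenvalues_of :: "real^2^2 \<Rightarrow> complex \<Rightarrow> complex \<Rightarrow> bool" where
  "eigenvalues_of A l1 l2 \<longleftrightarrow>
     (\<forall>z. det (mat z - (\<chi> i j. complex_of_real (A $ i $ j))) = (z - l1) * (z - l2))"

text \<open>The entry \<open>$ 2 $ 1\<close> of the Jacobian is the \<open>x\<close>-derivative of the second component.\<close>

definition Omega0 :: "(real^2) set \<Rightarrow> (vfield \<times> vfield) set" where
  "Omega0 D = {(X, Y) \<in> Omega D. X 0 = 0 \<and> Y 0 = 0 \<and>
     det (jacobian X (at 0)) * det (jacobian Y (at 0)) \<noteq> 0 \<and>
     jacobian X (at 0) $ 2 $ 1 * jacobian Y (at 0) $ 2 $ 1 > 0}"

definition ell :: "complex \<Rightarrow> complex \<Rightarrow> real" where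
  "ell lp lm = (if Im lp * Im lm \<noteq> 0 then Re lp / \<bar>Im lp\<bar> + Re lm / \<bar>Im lm\<bar> else 1)"

text \<open>
  The conditions below do not depend on how the two eigenvalues are labelled, as those of a real
  matrix are either both real or complex conjugate.
\<close>

definition Omega1 :: "(real^2) set \<Rightarrow> (vfield \<times> vfield) set" where
  "Omega1 D = {(X, Y) \<in> Omega0 D. \<exists>l1p l2p l1m l2m.
     eigenvalues_of (jacobian X (at 0)) l1p l2p \<and> eigenvalues_of (jacobian Y (at 0)) l1m l2m \<and>
     l1p \<noteq> l2p \<and> l1m \<noteq> l2m \<and> ell l1p l1m \<noteq> 0}"

definition Omega_fn :: "(real^2) set \<Rightarrow> (vfield \<times> vfield) set" where
  "Omega_fn D = {(X, Y) \<in> Omega1 D. \<exists>l1p l2p l1m l2m.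
     eigenvalues_of (jacobian X (at 0)) l1p l2p \<and> eigenvalues_of (jacobian Y (at 0)) l1m l2m \<and>
     (l1p \<notin> \<real> \<and> l2p \<notin> \<real> \<and> l1m \<in> \<real> \<and> l2m \<in> \<real> \<and> Re (l1m * l2m) > 0 \<or>
      l1m \<notin> \<real> \<and> l2m \<notin> \<real> \<and> l1p \<in> \<real> \<and> l2p \<in> \<real> \<and> Re (l1p * l2p) > 0)}"

definition X_fn :: vfield where
  "X_fn p = vector [- p $ 2, p $ 1]"

definition Y_fn :: "real \<Rightarrow> vfield" where
  "Y_fn \<beta> p = vector [2 * \<beta> * p $ 1 + p $ 2, p $ 1 + 2 * \<beta> * p $ 2]"

text \<open>On \<open>Omega_fn\<close> exactly one of the two pairs of eigenvalues is real.\<close>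

definition beta_fn :: "complex \<Rightarrow> complex \<Rightarrow> complex \<Rightarrow> complex \<Rightarrow> real" where
  "beta_fn l1p l2p l1m l2m =
     (if l1m \<in> \<real> \<and> l2m \<in> \<real> then sgn (Re (l1m + l2m)) else sgn (Re (l1p + l2p)))"

end

theory Submission
  imports Defs
begin

text \<open>
  Near the origin only the crossing behaviour matters: on the switching line both fields point to the same side
  except at the origin, which is never reached in finite time. A piecewise linear change of coordinates fixing the
  line (and, if necessary, the half turn \<open>p \<mapsto> - p\<close> and a reversal of time) makes the focus field rotate
  with positive angular velocity and the node field expand the Euclidean norm, with both fields extended to
  globally Lipschitz fields for which this holds in the whole plane.

  Every nonzero orbit then either stays below the line for all time, or comes from the origin, crosses the positive
  half axis, makes a half turn in the upper half plane, crosses the negative half axis and escapes to infinity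
  below the line. An equivalence with the model is assembled from two halves. Above the line the direction of a point
  is kept and its norm is replaced by the abscissa at which its orbit entered. Below the line orbits are labelled by
  their crossing of an axis or of the unit circle, and a point is determined by the label of its orbit and its norm.
  The resulting map is continuous and injective, hence open by invariance of domain, and it maps whole orbits
  to whole orbits, so by uniqueness of trajectories it does so in every neighbourhood of the origin.
\<close>

section \<open>Flows of Lipschitz fields\<close>

text \<open>With fields that are only continuously differentiable, no explicit flow and no invariant
  directions of the node are at hand. Everything is therefore drawn from sign conditions that
  survive a small perturbation of the linear part: lower bounds, by a multiple of the squared norm,
  on the angular momentum of the focus field and on the radial component of the node field, together
  with the directions of the node field on the two axes. The latter confine the orbits that entered
  on the left to the third quadrant, and those that will leave on the right to the fourth. The
  orbits trapped below the line fill a closed sector between them, whose boundary orbits are known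
  only as limits. Since the norm increases along orbits of the node field, the radius can replace
  time there, so that matching orbits means matching labels. Hitting times and labels are defined
  implicitly; their continuity comes from closed graphs, without derivatives of the flow. The two
  halves of the equivalence must agree on the negative half axis, where the upper half already
  imposes a nonlinear scaling; the radii below are shifted accordingly.\<close>

text \<open>By Cauchy-Schwarz the derivative of the squared norm lies between plus and minus
  \<open>2 * L\<close> times the squared norm, so an exponential weight makes it monotone in either
  direction. Derivatives are required only inside the interval, which covers arcs that end at
  junctions.\<close>

lemma gronwall_open:
  fixes w :: "real \<Rightarrow> 'a::real_inner"
  assumes "a \<le> b" "continuous_on {a..b} w"
    and der: "\<And>t. a < t \<Longrightarrow> t < b \<Longrightarrow> (w has_vector_derivative w' t) (at t)"
    and bnd: "\<And>t. a < t \<Longrightarrow> t < b \<Longrightarrow> norm (w' t) \<le> L * norm (w t)"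
  shows "norm (w b) \<le> exp (L * (b - a)) * norm (w a)"
    and "norm (w a) \<le> exp (L * (b - a)) * norm (w b)"
proof -
  have in': "\<bar>w t \<bullet> w' t\<bar> \<le> L * (w t \<bullet> w t)" if "a < t" "t < b" for t
  proof -
    have "\<bar>w t \<bullet> w' t\<bar> \<le> norm (w t) * norm (w' t)" by (rule Cauchy_Schwarz_ineq2)
    also have "\<dots> \<le> norm (w t) * (L * norm (w t))"
      using bnd[OF that] by (intro mult_left_mono) auto
    finally show ?thesis by (simp add: power2_norm_eq_inner[symmetric] power2_eq_square mult_ac)
  qed
  have d: "((\<lambda>t. w t \<bullet> w t) has_real_derivative 2 * (w t \<bullet> w' t)) (at t)"
    if "a < t" "t < b" for t
    using der[OF that] unfolding has_vector_derivative_def has_field_derivative_def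
    by (auto intro!: derivative_eq_intros simp: inner_commute algebra_simps)
  have "exp (-(2*L*(b-a))) * (w b \<bullet> w b) \<le> exp (-(2*L*(a-a))) * (w a \<bullet> w a)"
  proof (rule DERIV_nonpos_imp_decreasing_open[where f = "\<lambda>t. exp (-(2*L*(t-a))) * (w t \<bullet> w t)"])
    show "continuous_on {a..b} (\<lambda>t. exp (-(2*L*(t-a))) * (w t \<bullet> w t))"
      using assms(2) by (intro continuous_intros)
    fix t assume t: "a < t" "t < b"
    have "((\<lambda>t. exp (-(2*L*(t-a))) * (w t \<bullet> w t)) has_real_derivative
        exp (-(2*L*(t-a))) * (2 * (w t \<bullet> w' t) - 2 * L * (w t \<bullet> w t))) (at t)"
      using t by (auto intro!: derivative_eq_intros d simp: algebra_simps)
    moreover have "2 * (w t \<bullet> w' t) - 2 * L * (w t \<bullet> w t) \<le> 0" using in'[OF t] by linarith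
    ultimately show "\<exists>y. ((\<lambda>t. exp (-(2*L*(t-a))) * (w t \<bullet> w t)) has_real_derivative y) (at t) \<and> y \<le> 0"
      by (meson exp_ge_zero mult_nonneg_nonpos)
  qed (use assms in auto)
  then have "(norm (w b))\<^sup>2 \<le> (exp (L * (b - a)) * norm (w a))\<^sup>2"
    using exp_double[of "L * (b - a)"]
    by (simp add: power2_norm_eq_inner[symmetric] power_mult_distrib exp_minus divide_simps mult.assoc)
      (simp add: mult_ac)
  then show "norm (w b) \<le> exp (L * (b - a)) * norm (w a)"
    by (rule power2_le_imp_le) auto
  have "exp (2*L*(a-a)) * (w a \<bullet> w a) \<le> exp (2*L*(b-a)) * (w b \<bullet> w b)"
  proof (rule DERIV_nonneg_imp_increasing_open[where f = "\<lambda>t. exp (2*L*(t-a)) * (w t \<bullet> w t)"])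
    show "continuous_on {a..b} (\<lambda>t. exp (2*L*(t-a)) * (w t \<bullet> w t))"
      using assms(2) by (intro continuous_intros)
    fix t assume t: "a < t" "t < b"
    have "((\<lambda>t. exp (2*L*(t-a)) * (w t \<bullet> w t)) has_real_derivative
        exp (2*L*(t-a)) * (2 * (w t \<bullet> w' t) + 2 * L * (w t \<bullet> w t))) (at t)"
      using t by (auto intro!: derivative_eq_intros d simp: algebra_simps)
    moreover have "2 * (w t \<bullet> w' t) + 2 * L * (w t \<bullet> w t) \<ge> 0" using in'[OF t] by linarith
    ultimately show "\<exists>y. ((\<lambda>t. exp (2*L*(t-a)) * (w t \<bullet> w t)) has_real_derivative y) (at t) \<and> 0 \<le> y"
      by (meson exp_ge_zero mult_nonneg_nonneg)
  qed (use assms in auto)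
  then have "(norm (w a))\<^sup>2 \<le> (exp (L * (b - a)) * norm (w b))\<^sup>2"
    using exp_double[of "L * (b - a)"]
    by (simp add: power2_norm_eq_inner[symmetric] power_mult_distrib mult.assoc)
  then show "norm (w a) \<le> exp (L * (b - a)) * norm (w b)"
    by (rule power2_le_imp_le) auto
qed

text \<open>The oriented integral from 0 to \<open>t\<close>: for \<open>t\<close> of either sign
  one of the two intervals is empty or a point.\<close>

definition signed_integral :: "(real \<Rightarrow> 'a::euclidean_space) \<Rightarrow> real \<Rightarrow> 'a" where
  "signed_integral f t = integral {0..t} f - integral {t..0} f"

lemma signed_integral_0 [simp]: "signed_integral f 0 = 0"
  by (simp add: signed_integral_def)

lemma signed_integral_deriv:
  fixes f :: "real \<Rightarrow> 'a::euclidean_space"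
  assumes "continuous_on UNIV f"
  shows "(signed_integral f has_vector_derivative f t) (at t)"
proof -
  \<comment> \<open>A base point to the left of both 0 and \<open>t\<close> gives a single formula
    near \<open>t\<close>, also across 0.\<close>
  define M where "M = \<bar>t\<bar> + 1"
  have cont: "continuous_on A f" for A using assms continuous_on_subset by blast
  have int: "f integrable_on {a..b}" for a b using cont integrable_continuous_real by blast
  have eq: "signed_integral f s = integral {-M..s} f - integral {-M..0} f" if "s \<in> {-M<..<M}" for s
  proof (cases "s \<ge> 0")
    case True
    then have "integral {-M..0} f + integral {0..s} f = integral {-M..s} f"
      by (intro Henstock_Kurzweil_Integration.integral_combine int) (auto simp: M_def)
    then show ?thesis using True by (cases "s = 0") (auto simp: signed_integral_def eq_diff_eq add.commute)
  next
    case False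
    then have "integral {-M..s} f + integral {s..0} f = integral {-M..0} f"
      using that by (intro Henstock_Kurzweil_Integration.integral_combine int) auto
    then show ?thesis using False by (auto simp: signed_integral_def algebra_simps)
  qed
  have "((\<lambda>s. integral {-M..s} f) has_vector_derivative f t) (at t within {-M..M})"
    by (rule integral_has_vector_derivative[OF cont]) (auto simp: M_def)
  then have "((\<lambda>s. integral {-M..s} f) has_vector_derivative f t) (at t)"
    by (subst (asm) at_within_interior) (auto simp: M_def)
  then have "((\<lambda>s. integral {-M..s} f - integral {-M..0} f) has_vector_derivative f t) (at t)"
    by (auto intro!: derivative_eq_intros)
  then show ?thesis
    by (rule has_vector_derivative_transform_within_open[of _ _ _ "{-M<..<M}"])
       (auto simp: eq M_def)
qed

text \<open>The right-hand side is a primitive of the bound on \<open>f\<close>, taken at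
  \<open>\<bar>t\<bar>\<close>. The growth rate \<open>2 * L\<close> is the one allowed by the
  weighted norm of the existence proof; negative times are reflected.\<close>

lemma signed_integral_bound:
  fixes f :: "real \<Rightarrow> 'a::euclidean_space"
  assumes f: "continuous_on UNIV f" and "L > 0"
    and bnd: "\<And>s. norm (f s) \<le> K * exp (2 * L * \<bar>s\<bar>) + M"
  shows "norm (signed_integral f t) \<le> K * (exp (2 * L * \<bar>t\<bar>) - 1) / (2 * L) + M * \<bar>t\<bar>"
proof -
  let ?phi = "\<lambda>s. K * (exp (2 * L * s) - 1) / (2 * L) + M * s"
  have dphi: "(?phi has_vector_derivative K * exp (2 * L * s) + M) (at s)" for s
    using \<open>L > 0\<close> unfolding has_real_derivative_iff_has_vector_derivative[symmetric]
    by (auto intro!: derivative_eq_intros simp: field_simps)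
  have cphi: "continuous_on A ?phi" for A
    using \<open>L > 0\<close> by (intro continuous_intros) auto
  have dG: "(signed_integral f has_vector_derivative f s) (at s)" for s
    by (rule signed_integral_deriv[OF f])
  have dG': "((\<lambda>s. signed_integral f (- s)) has_vector_derivative - f (- s)) (at s)" for s
  proof -
    have "(uminus has_vector_derivative -1) (at s)" by (auto intro!: derivative_eq_intros)
    from vector_diff_chain_at[OF this dG] show ?thesis by (simp add: o_def)
  qed
  have c: "continuous_on A g" if "\<And>s. (g has_vector_derivative g' s) (at s)" for A and g g' :: "real \<Rightarrow> 'a"
    using that by (meson continuous_at_imp_continuous_on has_vector_derivative_continuous)
  consider "t = 0" | "t > 0" | "t < 0" by linarith
  then show ?thesis
  proof cases
    case 2
    have "norm (signed_integral f t - signed_integral f 0) \<le> ?phi t - ?phi 0"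
      by (rule differentiable_bound_general[OF 2 c[OF dG] cphi dG dphi]) (metis bnd abs_of_pos)
    then show ?thesis using 2 by simp
  next
    case 3
    then have "0 < - t" by simp
    have "norm (signed_integral f (-(-t)) - signed_integral f (-0)) \<le> ?phi (-t) - ?phi 0"
      by (rule differentiable_bound_general[OF \<open>0 < -t\<close> c[OF dG'] cphi dG' dphi])
         (metis bnd abs_of_pos abs_minus_cancel norm_minus_cancel)
    then show ?thesis using 3 by simp
  qed simp
qed

text \<open>Picard iteration on the whole line at once, in a weighted norm: with the solution
  written as \<open>p\<close> plus \<open>exp (2 * L * \<bar>t\<bar>)\<close> times a bounded
  function, the integral operator contracts by 1/2, and no local solutions have to be
  continued.\<close>

lemma global_solution_exists:
  fixes F :: "'a::euclidean_space \<Rightarrow> 'a"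
  assumes lip: "L-lipschitz_on UNIV F" and "L > 0"
  shows "\<exists>x. x 0 = p \<and> (\<forall>t. (x has_vector_derivative F (x t)) (at t))"
proof -
  have cF: "continuous_on UNIV F" using lip lipschitz_on_continuous_on by blast
  have lF: "norm (F u - F v) \<le> L * norm (u - v)" for u v
    using lipschitz_onD[OF lip, of u v] by (simp add: dist_norm)
  define f where "f y s = F (p + exp (2 * L * \<bar>s\<bar>) *\<^sub>R apply_bcontfun y s)" for y s
  have cf: "continuous_on UNIV (f y)" for y
    unfolding f_def by (intro continuous_on_compose2[OF cF] continuous_intros) auto
  define \<Phi> where "\<Phi> y t = exp (-(2 * L * \<bar>t\<bar>)) *\<^sub>R signed_integral (f y) t" for y t
  have cI: "continuous_on UNIV (signed_integral (f y))" for y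
    by (meson cf continuous_at_imp_continuous_on has_vector_derivative_continuous signed_integral_deriv)
  have bnd: "norm (f y s) \<le> (L * norm y) * exp (2 * L * \<bar>s\<bar>) + norm (F p)" for y s
  proof -
    have "norm (f y s) \<le> norm (f y s - F p) + norm (F p)" by (metis diff_add_cancel norm_triangle_ineq)
    also have "norm (f y s - F p) \<le> L * (exp (2 * L * \<bar>s\<bar>) * norm (apply_bcontfun y s))"
      using lF[of "p + exp (2 * L * \<bar>s\<bar>) *\<^sub>R apply_bcontfun y s" p] by (simp add: f_def)
    also have "\<dots> \<le> L * (exp (2 * L * \<bar>s\<bar>) * norm y)"
      using \<open>L > 0\<close> by (intro mult_left_mono norm_bounded) auto
    finally show ?thesis by (simp add: mult_ac)
  qed
  have \<Phi>: "\<Phi> y \<in> bcontfun" for y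
  proof (rule bcontfun_normI)
    show "continuous_on UNIV (\<Phi> y)"
      unfolding \<Phi>_def by (intro continuous_intros cI)
    fix t
    have e1: "exp (-(2 * L * \<bar>t\<bar>)) * (exp (2 * L * \<bar>t\<bar>) - 1) \<le> 1"
      by (simp add: algebra_simps flip: exp_add)
    \<comment> \<open>Controls the contribution of the constant \<open>F p\<close>, whose integral
      grows linearly.\<close>
    have e2: "exp (-(2 * L * \<bar>t\<bar>)) * \<bar>t\<bar> \<le> 1 / (2 * L)"
    proof -
      have "2 * L * \<bar>t\<bar> \<le> exp (2 * L * \<bar>t\<bar>)" using exp_ge_add_one_self[of "2 * L * \<bar>t\<bar>"] by linarith
      then show ?thesis using \<open>L > 0\<close> by (simp add: exp_minus field_simps)
    qed
    have "norm (\<Phi> y t) \<le> exp (-(2 * L * \<bar>t\<bar>)) *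
        ((L * norm y) * (exp (2 * L * \<bar>t\<bar>) - 1) / (2 * L) + norm (F p) * \<bar>t\<bar>)"
      unfolding \<Phi>_def norm_scaleR abs_exp_cancel
      by (intro mult_left_mono signed_integral_bound[OF cf \<open>L > 0\<close> bnd]) auto
    also have "\<dots> = norm y / 2 * (exp (-(2 * L * \<bar>t\<bar>)) * (exp (2 * L * \<bar>t\<bar>) - 1))
         + norm (F p) * (exp (-(2 * L * \<bar>t\<bar>)) * \<bar>t\<bar>)"
      using \<open>L > 0\<close> by (simp add: field_simps)
    also have "\<dots> \<le> norm y / 2 * 1 + norm (F p) * (1 / (2 * L))"
      by (intro add_mono mult_left_mono e1 e2) auto
    finally show "norm (\<Phi> y t) \<le> norm y / 2 * 1 + norm (F p) * (1 / (2 * L))" .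
  qed
  define T where "T y = Bcontfun (\<Phi> y)" for y
  have T: "apply_bcontfun (T y) = \<Phi> y" for y
    unfolding T_def by (rule Bcontfun_inverse[OF \<Phi>])
  have contr: "dist (T y) (T z) \<le> 1/2 * dist y z" for y z
  proof -
    have "norm (f y s - f z s) \<le> (L * norm (y - z)) * exp (2 * L * \<bar>s\<bar>) + 0" for s
    proof -
      have "norm (f y s - f z s) \<le> L * norm ((p + exp (2 * L * \<bar>s\<bar>) *\<^sub>R y s) - (p + exp (2 * L * \<bar>s\<bar>) *\<^sub>R z s))"
        unfolding f_def by (rule lF)
      also have "(p + exp (2 * L * \<bar>s\<bar>) *\<^sub>R y s) - (p + exp (2 * L * \<bar>s\<bar>) *\<^sub>R z s)
          = exp (2 * L * \<bar>s\<bar>) *\<^sub>R (y - z) s" by (simp add: algebra_simps)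
      also have "L * norm \<dots> \<le> L * (exp (2 * L * \<bar>s\<bar>) * norm (y - z))"
        using \<open>L > 0\<close> norm_bounded[of "y - z" s] by simp
      finally show ?thesis by (simp add: mult_ac)
    qed
    note b = signed_integral_bound[OF continuous_on_diff[OF cf cf] \<open>L > 0\<close> this]
    have int: "f y integrable_on {a..b}" for y a b
      using cf continuous_on_subset integrable_continuous_real by blast
    have sd: "signed_integral (f y) t - signed_integral (f z) t = signed_integral (\<lambda>s. f y s - f z s) t" for t
      unfolding signed_integral_def by (simp add: Henstock_Kurzweil_Integration.integral_diff int)
    have "norm (T y - T z) \<le> 1/2 * norm (y - z)"
    proof (rule norm_bound)
      fix t
      have e1: "exp (-(2 * L * \<bar>t\<bar>)) * (exp (2 * L * \<bar>t\<bar>) - 1) \<le> 1"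
        by (simp add: algebra_simps flip: exp_add)
      have "norm ((T y - T z) t) = exp (-(2 * L * \<bar>t\<bar>)) * norm (signed_integral (\<lambda>s. f y s - f z s) t)"
        by (simp add: T \<Phi>_def sd flip: scaleR_diff_right)
      also have "\<dots> \<le> exp (-(2 * L * \<bar>t\<bar>)) * ((L * norm (y - z)) * (exp (2 * L * \<bar>t\<bar>) - 1) / (2 * L) + 0 * \<bar>t\<bar>)"
        by (intro mult_left_mono b) auto
      also have "\<dots> = norm (y - z) / 2 * (exp (-(2 * L * \<bar>t\<bar>)) * (exp (2 * L * \<bar>t\<bar>) - 1))"
        using \<open>L > 0\<close> by (simp add: field_simps)
      also have "\<dots> \<le> norm (y - z) / 2 * 1"
        by (intro mult_left_mono e1) auto
      finally show "norm ((T y - T z) t) \<le> 1/2 * norm (y - z)" by simp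
    qed
    then show ?thesis by (simp add: dist_norm)
  qed
  have "\<exists>!y. T y = y" by (rule banach_fix_type[of "1/2"]) (use contr in auto)
  then obtain y where y: "T y = y" by blast
  define x where "x t = p + signed_integral (f y) t" for t
  have "apply_bcontfun y t = \<Phi> y t" for t using T[of y] y by simp
  then have "x t = p + exp (2 * L * \<bar>t\<bar>) *\<^sub>R apply_bcontfun y t" for t
    by (simp add: x_def \<Phi>_def flip: exp_add)
  then have fx: "f y t = F (x t)" for t by (simp add: f_def)
  have "(x has_vector_derivative F (x t)) (at t)" for t
    unfolding x_def fx[symmetric, unfolded x_def]
    by (auto intro!: derivative_eq_intros signed_integral_deriv[OF cf])
  moreover have "x 0 = p" by (simp add: x_def)
  ultimately show ?thesis by blast
qed

definition globally_lipschitz :: "('a::metric_space \<Rightarrow> 'b::metric_space) \<Rightarrow> bool" where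
  "globally_lipschitz F \<longleftrightarrow> (\<exists>L. L-lipschitz_on UNIV F)"

lemma globally_lipschitzE:
  fixes F :: "'a::real_normed_vector \<Rightarrow> 'b::real_normed_vector"
  assumes "globally_lipschitz F"
  obtains L where "L > 0" "L-lipschitz_on UNIV F" "\<And>u v. norm (F u - F v) \<le> L * norm (u - v)"
proof -
  obtain L where L: "L-lipschitz_on UNIV F" using assms by (auto simp: globally_lipschitz_def)
  have M: "(max L 1)-lipschitz_on UNIV F" by (rule lipschitz_on_le[OF L]) simp
  show ?thesis
    by (rule that[OF _ M]) (use lipschitz_onD[OF M] in \<open>auto simp: dist_norm\<close>)
qed

lemma globally_lipschitzI:
  fixes F :: "'a::real_normed_vector \<Rightarrow> 'b::real_normed_vector"
  assumes "\<And>u v. norm (F u - F v) \<le> L * norm (u - v)"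
  shows "globally_lipschitz F"
proof -
  have "norm (F u - F v) \<le> \<bar>L\<bar> * norm (u - v)" for u v
    using assms[of u v] mult_right_mono[OF abs_ge_self, of "norm (u - v)" L] by simp
  then show ?thesis unfolding globally_lipschitz_def
    by (intro exI[of _ "\<bar>L\<bar>"] lipschitz_onI) (auto simp: dist_norm)
qed

lemma globally_lipschitz_continuous:
  "globally_lipschitz F \<Longrightarrow> continuous_on A F"
  unfolding globally_lipschitz_def
  using lipschitz_on_continuous_on continuous_on_subset by blast

text \<open>Gronwall applied to the difference, from whichever end the agreement is given. As
  derivatives are asked for only inside, this applies to an arc between two junctions.\<close>

lemma solutions_agree:
  fixes x y :: "real \<Rightarrow> 'a::euclidean_space"
  assumes F: "globally_lipschitz F" and "a \<le> b"
    and c: "continuous_on {a..b} x" "continuous_on {a..b} y"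
    and dx: "\<And>t. a < t \<Longrightarrow> t < b \<Longrightarrow> (x has_vector_derivative F (x t)) (at t)"
    and dy: "\<And>t. a < t \<Longrightarrow> t < b \<Longrightarrow> (y has_vector_derivative F (y t)) (at t)"
    and eq: "x a = y a \<or> x b = y b" and t: "t \<in> {a..b}"
  shows "x t = y t"
proof -
  obtain L where L: "L > 0" "\<And>u v. norm (F u - F v) \<le> L * norm (u - v)"
    using globally_lipschitzE[OF F] by metis
  have sub: "continuous_on {u..v} (\<lambda>t. x t - y t)" if "a \<le> u" "v \<le> b" for u v
    using that by (intro continuous_on_diff continuous_on_subset[OF c(1)] continuous_on_subset[OF c(2)]) auto
  have der: "((\<lambda>t. x t - y t) has_vector_derivative F (x t) - F (y t)) (at t)" if "a < t" "t < b" for t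
    using dx[OF that] dy[OF that] by (auto intro!: derivative_eq_intros)
  from eq show ?thesis
  proof
    assume "x a = y a"
    have "norm (x t - y t) \<le> exp (L * (t - a)) * norm (x a - y a)"
      by (rule gronwall_open(1)[where w = "\<lambda>t. x t - y t" and w' = "\<lambda>t. F (x t) - F (y t)"])
        (use t sub der L in simp_all)
    then show ?thesis using \<open>x a = y a\<close> by simp
  next
    assume "x b = y b"
    have "norm (x t - y t) \<le> exp (L * (b - t)) * norm (x b - y b)"
      by (rule gronwall_open(2)[where w = "\<lambda>t. x t - y t" and w' = "\<lambda>t. F (x t) - F (y t)"])
        (use t sub der L in simp_all)
    then show ?thesis using \<open>x b = y b\<close> by simp
  qed
qed

section \<open>The flow of a globally Lipschitz field\<close>

text \<open>The choice is harmless: \<open>flow_unique\<close> shows that there is only one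
  candidate.\<close>

definition flow :: "('a::euclidean_space \<Rightarrow> 'a) \<Rightarrow> real \<Rightarrow> 'a \<Rightarrow> 'a" where
  "flow F t p = (SOME x. x 0 = p \<and> (\<forall>t. (x has_vector_derivative F (x t)) (at t))) t"

lemma solution_continuous:
  "(\<And>t. (x has_vector_derivative x' t) (at t)) \<Longrightarrow> continuous_on A x"
  by (meson continuous_at_imp_continuous_on has_vector_derivative_continuous)

context
  fixes F :: "'a::euclidean_space \<Rightarrow> 'a"
  assumes F: "globally_lipschitz F"
begin

lemma flow_0 [simp]: "flow F 0 p = p"
  and flow_deriv: "((\<lambda>t. flow F t p) has_vector_derivative F (flow F t p)) (at t)"
proof -
  obtain L where L: "L > 0" "L-lipschitz_on UNIV F"
    using globally_lipschitzE[OF F] by metis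
  have "\<exists>x. x 0 = p \<and> (\<forall>t. (x has_vector_derivative F (x t)) (at t))"
    by (rule global_solution_exists) (use L in auto)
  then have "(\<lambda>t. flow F t p) 0 = p \<and> (\<forall>t. ((\<lambda>t. flow F t p) has_vector_derivative F (flow F t p)) (at t))"
    unfolding flow_def by (rule someI_ex)
  then show "flow F 0 p = p" "((\<lambda>t. flow F t p) has_vector_derivative F (flow F t p)) (at t)" by auto
qed

lemma flow_continuous_time: "continuous_on A (\<lambda>t. flow F t p)"
  using flow_deriv by (rule solution_continuous)

lemma flow_unique:
  assumes "\<And>t. (x has_vector_derivative F (x t)) (at t)"
  shows "x t = flow F (t - s) (x s)"
proof -
  let ?y = "\<lambda>t. flow F (t - s) (x s)"
  have dy: "(?y has_vector_derivative F (?y t)) (at t)" for t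
  proof -
    have "((\<lambda>t. t - s) has_vector_derivative 1) (at t)" by (auto intro!: derivative_eq_intros)
    from vector_diff_chain_at[OF this flow_deriv[of "x s" "t - s"]] show ?thesis by (simp add: o_def)
  qed
  have cx: "continuous_on A x" for A by (rule solution_continuous[OF assms])
  have cy: "continuous_on A ?y" for A by (rule solution_continuous[OF dy])
  show ?thesis
  proof (cases "s \<le> t")
    case True
    show ?thesis
      by (rule solutions_agree[OF F True cx cy assms dy]) (use True in auto)
  next
    case False
    then have "t \<le> s" by simp
    show ?thesis
      by (rule solutions_agree[OF F \<open>t \<le> s\<close> cx cy assms dy]) (use \<open>t \<le> s\<close> in auto)
  qed
qed

lemma flow_add: "flow F (s + t) p = flow F s (flow F t p)"
  using flow_unique[of "\<lambda>t. flow F t p" "s + t" t] flow_deriv by simp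

lemma flow_minus_cancel [simp]: "flow F (- t) (flow F t p) = p" "flow F t (flow F (- t) p) = p"
  using flow_add[of "-t" t p] flow_add[of t "-t" p] by simp_all

lemma flow_dependence:
  obtains L where "L > 0" "\<And>t p q. norm (flow F t p - flow F t q) \<le> exp (L * \<bar>t\<bar>) * norm (p - q)"
proof -
  obtain L where L: "L > 0" "\<And>u v. norm (F u - F v) \<le> L * norm (u - v)"
    using globally_lipschitzE[OF F] by metis
  have der: "((\<lambda>t. flow F t p - flow F t q) has_vector_derivative F (flow F t p) - F (flow F t q)) (at t)" for t p q
    by (auto intro!: derivative_eq_intros flow_deriv)
  have "norm (flow F t p - flow F t q) \<le> exp (L * \<bar>t\<bar>) * norm (p - q)" for t p q
  proof (cases "0 \<le> t")
    case True
    from gronwall_open(1)[OF this solution_continuous[OF der] der L(2), of p q] True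
    show ?thesis by simp
  next
    case False
    then have "t \<le> 0" by simp
    from gronwall_open(2)[OF this solution_continuous[OF der] der L(2), of p q] this
    show ?thesis by simp
  qed
  with L(1) show ?thesis by (rule that)
qed

text \<open>Lipschitz dependence on the initial point is uniform for bounded times; what remains is
  continuity in time along a single orbit.\<close>

lemma flow_continuous: "continuous_on A (\<lambda>z. flow F (fst z) (snd z))"
proof -
  obtain L where L: "L > 0" "\<And>t p q. norm (flow F t p - flow F t q) \<le> exp (L * \<bar>t\<bar>) * norm (p - q)"
    using flow_dependence by metis
  have "((\<lambda>z. flow F (fst z) (snd z)) \<longlongrightarrow> flow F t0 p0) (at (t0, p0))" for t0 p0
  proof -
    have c1: "((\<lambda>z. flow F (fst z) p0) \<longlongrightarrow> flow F t0 p0) (at (t0, p0))"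
    proof -
      have "isCont (\<lambda>t. flow F t p0) t0" by (rule has_vector_derivative_continuous[OF flow_deriv])
      moreover have "(fst \<longlongrightarrow> t0) (at (t0, p0))" using tendsto_fst[OF tendsto_ident_at, of "(t0, p0)"] by simp
      ultimately show ?thesis by (rule isCont_tendsto_compose)
    qed
    have "((\<lambda>z. exp (L * \<bar>fst z\<bar>) * norm (snd z - p0)) \<longlongrightarrow> exp (L * \<bar>t0\<bar>) * norm (p0 - p0)) (at (t0, p0))"
      using tendsto_fst[OF tendsto_ident_at, of "(t0, p0)"] tendsto_snd[OF tendsto_ident_at, of "(t0, p0)"]
      by (intro tendsto_intros) auto
    then have "((\<lambda>z. exp (L * \<bar>fst z\<bar>) * norm (snd z - p0)) \<longlongrightarrow> 0) (at (t0, p0))" by simp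
    then have "((\<lambda>z. flow F (fst z) (snd z) - flow F (fst z) p0) \<longlongrightarrow> 0) (at (t0, p0))"
      by (rule Lim_null_comparison[rotated]) (simp add: L)
    from tendsto_add[OF this c1] show ?thesis by simp
  qed
  then have "continuous_on UNIV (\<lambda>z. flow F (fst z) (snd z))"
    by (auto intro!: continuous_at_imp_continuous_on simp: isCont_def)
  then show ?thesis using continuous_on_subset by blast
qed

lemma continuous_on_flow [continuous_intros]:
  assumes "continuous_on A f" "continuous_on A g"
  shows "continuous_on A (\<lambda>x. flow F (f x) (g x))"
  using continuous_on_compose2[OF flow_continuous[of UNIV] continuous_on_Pair[OF assms]] by auto

lemma tendsto_flow:
  assumes "(f \<longlongrightarrow> t) G" "(g \<longlongrightarrow> p) G"
  shows "((\<lambda>x. flow F (f x) (g x)) \<longlongrightarrow> flow F t p) G"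
proof -
  have "isCont (\<lambda>z. flow F (fst z) (snd z)) (t, p)"
    using flow_continuous[of UNIV] by (simp add: continuous_on_eq_continuous_at)
  from isCont_tendsto_compose[OF this tendsto_Pair[OF assms]] show ?thesis by simp
qed

lemma flow_fixed: "F p = 0 \<Longrightarrow> flow F t p = p"
  using flow_unique[of "\<lambda>_. p" t 0] by (auto intro!: derivative_eq_intros)

lemma flow_eq_0_iff: "F 0 = 0 \<Longrightarrow> flow F t p = 0 \<longleftrightarrow> p = 0"
  using flow_fixed[of 0] flow_minus_cancel(1)[of t p] by metis

end

section \<open>Continuity from a closed graph\<close>

text \<open>If \<open>f (u n)\<close> stayed away from \<open>f x\<close>, boundedness would give a
  convergent subsequence, whose limit the second hypothesis forces to be \<open>f x\<close>. This
  serves for implicitly defined quantities such as hitting times and orbit labels, whose defining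
  relations are closed.\<close>

lemma closed_graph_continuous_on:
  fixes f :: "'a::metric_space \<Rightarrow> 'b::heine_borel"
  assumes bnd: "\<And>u x. (\<And>n. u n \<in> S) \<Longrightarrow> x \<in> S \<Longrightarrow> u \<longlonglongrightarrow> x \<Longrightarrow> bounded (range (\<lambda>n::nat. f (u n)))"
    and lim: "\<And>u x y. (\<And>n. u n \<in> S) \<Longrightarrow> x \<in> S \<Longrightarrow> u \<longlonglongrightarrow> x \<Longrightarrow> (\<lambda>n::nat. f (u n)) \<longlonglongrightarrow> y \<Longrightarrow> y = f x"
  shows "continuous_on S f"
proof (rule continuous_on_sequentiallyI)
  fix u x assume u: "\<forall>n. u n \<in> S" and x: "x \<in> S" and ux: "u \<longlonglongrightarrow> x"
  show "(\<lambda>n. f (u n)) \<longlonglongrightarrow> f x"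
  proof (rule ccontr)
    assume "\<not> (\<lambda>n. f (u n)) \<longlonglongrightarrow> f x"
    then obtain e where "e > 0" and e: "\<forall>N. \<exists>n\<ge>N. \<not> dist (f (u n)) (f x) < e"
      unfolding lim_sequentially by auto
    from e have "infinite {n. \<not> dist (f (u n)) (f x) < e}"
      unfolding infinite_nat_iff_unbounded_le by simp
    from infinite_enumerate[OF this] obtain r :: "nat \<Rightarrow> nat"
      where r: "strict_mono r" "\<forall>n. r n \<in> {n. \<not> dist (f (u n)) (f x) < e}"
      by (elim exE conjE)
    have "bounded (range (\<lambda>n. f (u n)))" by (rule bnd[OF _ x ux]) (use u in simp)
    then have "bounded (range (\<lambda>n. f (u (r n))))" by (rule bounded_subset) (rule image_subsetI, simp)
    then obtain y and q :: "nat \<Rightarrow> nat" where q: "strict_mono q" "((\<lambda>n. f (u (r n))) \<circ> q) \<longlonglongrightarrow> y"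
      using bounded_imp_convergent_subsequence by blast
    have lim_y: "(\<lambda>n. f (u (r (q n)))) \<longlonglongrightarrow> y" using q(2) by (simp add: o_def)
    have lim_x: "(\<lambda>n. u (r (q n))) \<longlonglongrightarrow> x"
      using LIMSEQ_subseq_LIMSEQ[OF LIMSEQ_subseq_LIMSEQ[OF ux r(1)] q(1)] by (simp add: o_def)
    have "y = f x"
      by (rule lim[OF _ x lim_x lim_y]) (use u in simp)
    then have d0: "(\<lambda>n. dist (f (u (r (q n)))) (f x)) \<longlonglongrightarrow> 0"
      using lim_y tendsto_dist_iff[of "\<lambda>n. f (u (r (q n)))" "f x" sequentially] by simp
    have "e \<le> dist (f (u (r (q n)))) (f x)" for n
      using r(2) by (simp add: not_less)
    then have "e \<le> 0" using LIMSEQ_le_const[OF d0, of e] by blast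
    with \<open>e > 0\<close> show False by simp
  qed
qed

section \<open>Crossing trajectories\<close>

lemma norm_real2: "(norm p)\<^sup>2 = (p $ 1)\<^sup>2 + (p $ 2)\<^sup>2" for p :: "real^2"
  by (simp add: power2_norm_eq_inner inner_vec_def UNIV_2 flip: power2_eq_square)

lemma inner_real2: "p \<bullet> q = p $ 1 * q $ 1 + p $ 2 * q $ 2" for p q :: "real^2"
  by (simp add: inner_vec_def UNIV_2)

lemma eq_real2: "p = q \<longleftrightarrow> p $ 1 = q $ 1 \<and> p $ 2 = q $ 2" for p q :: "real^2"
  by (simp add: vec_eq_iff forall_2)

lemma has_derivative_component:
  fixes g :: "real \<Rightarrow> real^'n"
  assumes "(g has_vector_derivative d) (at t)"
  shows "((\<lambda>t. g t $ i) has_real_derivative d $ i) (at t)"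
  using bounded_linear.has_vector_derivative[OF bounded_linear_vec_nth assms, of i]
  by (simp add: has_real_derivative_iff_has_vector_derivative)

text \<open>Filippov arcs inside the switching line are replaced by the rest at the origin, the only
  one that survives when both fields cross the line elsewhere;
  \<open>trajectory_in_iff_cross_traj\<close> justifies this.\<close>

definition traj_arc :: "vfield \<Rightarrow> vfield \<Rightarrow> real set \<Rightarrow> (real \<Rightarrow> real^2) \<Rightarrow> bool" where
  "traj_arc X Y J g \<longleftrightarrow> solution_arc X {p. p $ 2 > 0} J g \<or> solution_arc Y {p. p $ 2 < 0} J g \<or>
     solution_arc (\<lambda>_. 0) {0} J g"

definition cross_traj :: "vfield \<Rightarrow> vfield \<Rightarrow> (real^2) set \<Rightarrow> real set \<Rightarrow> (real \<Rightarrow> real^2) \<Rightarrow> bool" where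
  "cross_traj X Y U I g \<longleftrightarrow>
     is_interval I \<and> I \<noteq> {} \<and> continuous_on I g \<and> g ` I \<subseteq> U \<and>
     (\<exists>S. (\<forall>a b. {a..b} \<subseteq> I \<longrightarrow> finite (S \<inter> {a..b})) \<and>
          (\<forall>a b. {a<..<b} \<subseteq> I \<and> {a<..<b} \<inter> S = {} \<longrightarrow> traj_arc X Y {a<..<b} g))"

definition max_traj :: "vfield \<Rightarrow> vfield \<Rightarrow> (real^2) set \<Rightarrow> real set \<Rightarrow> (real \<Rightarrow> real^2) \<Rightarrow> bool" where
  "max_traj X Y U I g \<longleftrightarrow> cross_traj X Y U I g \<and>
     (\<forall>I' g'. cross_traj X Y U I' g' \<and> I \<subseteq> I' \<and> (\<forall>t\<in>I. g' t = g t) \<longrightarrow> I' = I)"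

lemma traj_arc_subset: "traj_arc X Y J g \<Longrightarrow> K \<subseteq> J \<Longrightarrow> traj_arc X Y K g"
  unfolding traj_arc_def solution_arc_def by blast

text \<open>The map \<open>\<Lambda>\<close> has to coincide with the linear \<open>L\<close> only
  on the region \<open>R\<close> that contains the arc, which allows for piecewise linear changes of
  coordinates; the chain rule supplies the factor \<open>\<tau>\<close>.\<close>

lemma solution_arc_image:
  assumes sol: "solution_arc F R J g" and "open J'" and J': "\<And>s. s \<in> J' \<Longrightarrow> \<tau> * s + d \<in> J"
    and L: "bounded_linear L" and R: "\<And>p. p \<in> R \<Longrightarrow> \<Lambda> p = L p \<and> \<Lambda> p \<in> R' \<and> F' (\<Lambda> p) = \<tau> *\<^sub>R L (F p)"
  shows "solution_arc F' R' J' (\<lambda>t. \<Lambda> (g (\<tau> * t + d)))"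
  unfolding solution_arc_def
proof
  fix t assume t: "t \<in> J'"
  have g: "g (\<tau> * s + d) \<in> R" "(g has_vector_derivative F (g (\<tau> * s + d))) (at (\<tau> * s + d))" if "s \<in> J'" for s
    using sol J'[OF that] by (auto simp: solution_arc_def)
  have "((\<lambda>t. \<tau> * t + d) has_vector_derivative \<tau>) (at t)" by (auto intro!: derivative_eq_intros)
  from vector_diff_chain_at[OF this g(2)[OF t]]
  have "((\<lambda>t. g (\<tau> * t + d)) has_vector_derivative \<tau> *\<^sub>R F (g (\<tau> * t + d))) (at t)" by (simp add: o_def)
  from bounded_linear.has_vector_derivative[OF L this]
  have "((\<lambda>t. L (g (\<tau> * t + d))) has_vector_derivative \<tau> *\<^sub>R L (F (g (\<tau> * t + d)))) (at t)"
    by (simp add: linear_cmul[OF bounded_linear.linear[OF L]])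
  then have "((\<lambda>t. \<Lambda> (g (\<tau> * t + d))) has_vector_derivative \<tau> *\<^sub>R L (F (g (\<tau> * t + d)))) (at t)"
    by (rule has_vector_derivative_transform_within_open[OF _ \<open>open J'\<close> t]) (use g R in auto)
  then show "\<Lambda> (g (\<tau> * t + d)) \<in> R' \<and>
      ((\<lambda>t. \<Lambda> (g (\<tau> * t + d))) has_vector_derivative F' (\<Lambda> (g (\<tau> * t + d)))) (at t)"
    using R[OF g(1)[OF t]] by metis
qed

lemma cross_trajD:
  assumes "cross_traj X Y U I g"
  shows "is_interval I" "I \<noteq> {}" "continuous_on I g" "g ` I \<subseteq> U"
  using assms unfolding cross_traj_def by blast+

lemma cross_traj_junctions:
  assumes "cross_traj X Y U I g"
  shows "\<exists>S. (\<forall>a b. {a..b} \<subseteq> I \<longrightarrow> finite (S \<inter> {a..b})) \<and>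
    (\<forall>a b. {a<..<b} \<subseteq> I \<and> {a<..<b} \<inter> S = {} \<longrightarrow> traj_arc X Y {a<..<b} g)"
  using assms unfolding cross_traj_def by (elim conjE)

lemma cross_traj_image:
  assumes g: "cross_traj X Y U I g" and \<tau>: "\<tau> = 1 \<or> \<tau> = -1" and \<Lambda>: "continuous_on UNIV \<Lambda>"
    and arc: "\<And>a b a' b'. traj_arc X Y {a<..<b} g \<Longrightarrow>
      (\<And>s. s \<in> {a'<..<b'} \<Longrightarrow> \<tau> * s + d \<in> {a<..<b}) \<Longrightarrow>
      traj_arc X' Y' {a'<..<b'} (\<lambda>t. \<Lambda> (g (\<tau> * t + d)))"
  shows "cross_traj X' Y' (\<Lambda> ` U) ((\<lambda>t. \<tau> * t + d) -` I) (\<lambda>t. \<Lambda> (g (\<tau> * t + d)))"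
proof -
  note I = cross_trajD[OF g]
  obtain S where S: "\<forall>a b. {a..b} \<subseteq> I \<longrightarrow> finite (S \<inter> {a..b})"
      "\<forall>a b. {a<..<b} \<subseteq> I \<and> {a<..<b} \<inter> S = {} \<longrightarrow> traj_arc X Y {a<..<b} g"
    using cross_traj_junctions[OF g] by (elim exE conjE)
  \<comment> \<open>As \<open>\<tau>\<close> squares to 1, \<open>?e'\<close> is the inverse of the
    time change \<open>?e\<close>.\<close>
  let ?e = "\<lambda>t. \<tau> * t + d" and ?e' = "\<lambda>t. \<tau> * (t - d)"
  have ee: "?e (?e' t) = t" "?e' (?e t) = t" for t using \<tau> by auto
  have 0: "?e -` A = ?e' ` A" for A
  proof (intro equalityI subsetI)
    fix x assume "x \<in> ?e -` A"
    then show "x \<in> ?e' ` A" by (intro image_eqI[of _ _ "?e x"]) (simp_all only: ee vimage_eq)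
  next
    fix x assume "x \<in> ?e' ` A"
    then show "x \<in> ?e -` A" by (elim imageE) (simp only: ee vimage_eq)
  qed
  have "connected (?e' ` I)"
    using I(1) by (intro connected_continuous_image continuous_intros) (simp add: is_interval_connected)
  then have 1: "is_interval (?e -` I)" by (simp add: 0 is_interval_connected_1)
  have 2: "continuous_on (?e -` I) (\<lambda>t. \<Lambda> (g (?e t)))"
    by (rule continuous_on_compose2[OF \<Lambda>], rule continuous_on_compose2[OF I(3)])
      (auto intro!: continuous_intros)
  have 3: "finite (?e -` S \<inter> {a..b})" if ab: "{a..b} \<subseteq> ?e -` I" for a b
  proof -
    \<comment> \<open>The end points of the interval of original times; they swap when time is
      reversed.\<close>
    define a1 b1 where "a1 = (if \<tau> = 1 then a + d else d - b)" and "b1 = (if \<tau> = 1 then b + d else d - a)"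
    have mem: "s \<in> {a1..b1} \<longleftrightarrow> ?e' s \<in> {a..b}" for s using \<tau> by (auto simp: a1_def b1_def)
    have "s \<in> I" if "s \<in> {a1..b1}" for s
      using that ab ee unfolding mem by (metis subsetD vimageE)
    then have "finite (S \<inter> {a1..b1})" by (intro S(1)[rule_format]) auto
    then have "finite (?e -` (S \<inter> {a1..b1}))" unfolding 0 by (rule finite_imageI)
    then show ?thesis by (rule rev_finite_subset) (unfold subset_iff Int_iff vimage_eq mem ee, blast)
  qed
  have 4: "traj_arc X' Y' {a<..<b} (\<lambda>t. \<Lambda> (g (?e t)))"
    if ab: "{a<..<b} \<subseteq> ?e -` I" "{a<..<b} \<inter> ?e -` S = {}" for a b
  proof -
    define a1 b1 where "a1 = (if \<tau> = 1 then a + d else d - b)" and "b1 = (if \<tau> = 1 then b + d else d - a)"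
    have mem: "s \<in> {a1<..<b1} \<longleftrightarrow> ?e' s \<in> {a<..<b}" for s using \<tau> by (auto simp: a1_def b1_def)
    have "s \<in> I \<and> s \<notin> S" if "s \<in> {a1<..<b1}" for s
    proof -
      have "?e' s \<in> ?e -` I" "?e' s \<notin> ?e -` S" using that ab unfolding mem by auto
      then show ?thesis by (simp only: vimage_eq ee simp_thms)
    qed
    then have "traj_arc X Y {a1<..<b1} g" by (intro S(2)[rule_format]) auto
    then show ?thesis by (rule arc) (simp only: mem ee)
  qed
  have 5: "?e -` I \<noteq> {}" using I(2) by (simp add: 0)
  show ?thesis unfolding cross_traj_def
    by (intro conjI exI[of _ "?e -` S"] allI impI 1 2 3 4 5) (use I(4) in auto)
qed

lemma cross_traj_conj:
  assumes g: "cross_traj X Y U I g" and \<tau>: "\<tau> = 1 \<or> \<tau> = -1" and \<Lambda>: "continuous_on UNIV \<Lambda>" "\<Lambda> 0 = 0"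
    and L: "bounded_linear L" "bounded_linear M"
    and up: "\<And>p. p $ 2 > 0 \<Longrightarrow> \<Lambda> p = L p \<and> \<Lambda> p $ 2 > 0 \<and> X' (\<Lambda> p) = \<tau> *\<^sub>R L (X p)"
    and lo: "\<And>p. p $ 2 < 0 \<Longrightarrow> \<Lambda> p = M p \<and> \<Lambda> p $ 2 < 0 \<and> Y' (\<Lambda> p) = \<tau> *\<^sub>R M (Y p)"
  shows "cross_traj X' Y' (\<Lambda> ` U) ((\<lambda>t. \<tau> * t + d) -` I) (\<lambda>t. \<Lambda> (g (\<tau> * t + d)))"
proof (rule cross_traj_image[OF g \<tau> \<Lambda>(1)])
  fix a b a' b' assume "traj_arc X Y {a<..<b} g" and J: "\<And>s. s \<in> {a'<..<b'} \<Longrightarrow> \<tau> * s + d \<in> {a<..<b}"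
  then consider "solution_arc X {p. p $ 2 > 0} {a<..<b} g" | "solution_arc Y {p. p $ 2 < 0} {a<..<b} g"
    | "solution_arc (\<lambda>_. 0) {0} {a<..<b} g" by (auto simp: traj_arc_def)
  then show "traj_arc X' Y' {a'<..<b'} (\<lambda>t. \<Lambda> (g (\<tau> * t + d)))"
  proof cases
    case 1
    have "solution_arc X' {p. p $ 2 > 0} {a'<..<b'} (\<lambda>t. \<Lambda> (g (\<tau> * t + d)))"
      by (rule solution_arc_image[OF 1 open_greaterThanLessThan J L(1)]) (assumption, unfold mem_Collect_eq, rule up)
    then show ?thesis by (simp add: traj_arc_def)
  next
    case 2
    have "solution_arc Y' {p. p $ 2 < 0} {a'<..<b'} (\<lambda>t. \<Lambda> (g (\<tau> * t + d)))"
      by (rule solution_arc_image[OF 2 open_greaterThanLessThan J L(2)]) (assumption, unfold mem_Collect_eq, rule lo)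
    then show ?thesis by (simp add: traj_arc_def)
  next
    case 3
    have "solution_arc (\<lambda>_. 0) {0} {a'<..<b'} (\<lambda>t. \<Lambda> (g (\<tau> * t + d)))"
      by (rule solution_arc_image[OF 3 _ J bounded_linear_zero]) (use \<Lambda>(2) in auto)
    then show ?thesis by (simp add: traj_arc_def)
  qed
qed

text \<open>The half turn exchanges the half planes, so the two fields swap their roles; hence this
  is no instance of \<open>cross_traj_conj\<close>.\<close>

lemma cross_traj_flip:
  assumes g: "cross_traj X Y U I g"
  shows "cross_traj (\<lambda>p. - Y (- p)) (\<lambda>p. - X (- p)) (uminus ` U) I (\<lambda>t. - g t)"
proof -
  have "cross_traj (\<lambda>p. - Y (- p)) (\<lambda>p. - X (- p)) (uminus ` U) ((\<lambda>t. 1 * t + 0) -` I) (\<lambda>t. - g (1 * t + 0))"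
  proof (rule cross_traj_image[OF g])
    fix a b a' b' :: real
    assume "traj_arc X Y {a<..<b} g" and J: "\<And>s. s \<in> {a'<..<b'} \<Longrightarrow> 1 * s + 0 \<in> {a<..<b}"
    then consider "solution_arc X {p. p $ 2 > 0} {a<..<b} g" | "solution_arc Y {p. p $ 2 < 0} {a<..<b} g"
      | "solution_arc (\<lambda>_. 0) {0} {a<..<b} g" by (auto simp: traj_arc_def)
    then show "traj_arc (\<lambda>p. - Y (- p)) (\<lambda>p. - X (- p)) {a'<..<b'} (\<lambda>t. - g (1 * t + 0))"
    proof cases
      case 1
      have "solution_arc (\<lambda>p. - X (- p)) {p. p $ 2 < 0} {a'<..<b'} (\<lambda>t. - g (1 * t + 0))"
        by (rule solution_arc_image[OF 1 _ J, of _ uminus])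
          (auto intro: bounded_linear_minus bounded_linear_ident)
      then show ?thesis by (simp add: traj_arc_def)
    next
      case 2
      have "solution_arc (\<lambda>p. - Y (- p)) {p. p $ 2 > 0} {a'<..<b'} (\<lambda>t. - g (1 * t + 0))"
        by (rule solution_arc_image[OF 2 _ J, of _ uminus])
          (auto intro: bounded_linear_minus bounded_linear_ident)
      then show ?thesis by (simp add: traj_arc_def)
    next
      case 3
      have "solution_arc (\<lambda>_. 0) {0} {a'<..<b'} (\<lambda>t. - g (1 * t + 0))"
        by (rule solution_arc_image[OF 3 _ J, of _ uminus])
          (auto intro: bounded_linear_minus bounded_linear_ident)
      then show ?thesis by (simp add: traj_arc_def)
    qed
  qed (auto intro!: continuous_intros)
  then show ?thesis by simp
qed

lemma cross_traj_restrict: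
  assumes "cross_traj X Y U I g" "is_interval J" "J \<noteq> {}" "J \<subseteq> I" "g ` J \<subseteq> V"
  shows "cross_traj X Y V J g"
proof -
  note I = cross_trajD[OF assms(1)]
  obtain S where S: "\<forall>a b. {a..b} \<subseteq> I \<longrightarrow> finite (S \<inter> {a..b})"
      "\<forall>a b. {a<..<b} \<subseteq> I \<and> {a<..<b} \<inter> S = {} \<longrightarrow> traj_arc X Y {a<..<b} g"
    using cross_traj_junctions[OF assms(1)] by (elim exE conjE)
  show ?thesis unfolding cross_traj_def
  proof (intro conjI exI[of _ S] allI impI)
    show "continuous_on J g" using I(3) assms(4) by (rule continuous_on_subset)
    show "finite (S \<inter> {a..b})" if "{a..b} \<subseteq> J" for a b
      using that assms(4) by (intro S(1)[rule_format]) (rule subset_trans)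
    show "traj_arc X Y {a<..<b} g" if "{a<..<b} \<subseteq> J \<and> {a<..<b} \<inter> S = {}" for a b
      by (rule S(2)[rule_format]) (use that assms(4) in blast)
  qed (use assms in auto)
qed

text \<open>Only finitely many junctions lie between \<open>t0\<close> and \<open>t1\<close>, so
  there is a first one after \<open>t0\<close>.\<close>

lemma cross_traj_first_arc:
  assumes g: "cross_traj X Y U I g" and t: "t0 \<in> I" "t1 \<in> I" "t0 < t1"
  obtains t2 where "t0 < t2" "t2 \<le> t1" "traj_arc X Y {t0<..<t2} g"
proof -
  note I = cross_trajD[OF g]
  obtain S where S: "\<forall>a b. {a..b} \<subseteq> I \<longrightarrow> finite (S \<inter> {a..b})"
      "\<forall>a b. {a<..<b} \<subseteq> I \<and> {a<..<b} \<inter> S = {} \<longrightarrow> traj_arc X Y {a<..<b} g"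
    using cross_traj_junctions[OF g] by (elim exE conjE)
  have sub: "{t0..t1} \<subseteq> I" using mem_is_interval_1_I[OF I(1) t(1,2)] by auto
  \<comment> \<open>Inserting \<open>t1\<close> keeps the set nonempty when there is no
    junction.\<close>
  define T where "T = insert t1 (S \<inter> {t0<..t1})"
  have fin: "finite T" unfolding T_def using finite_subset[OF _ S(1)[rule_format, OF sub]] by (simp add: subset_iff)
  have "Min T \<in> T" using fin by (intro Min_in) (auto simp: T_def)
  then have 1: "t0 < Min T" "Min T \<le> t1" using t(3) by (auto simp: T_def)
  have 2: "{t0<..<Min T} \<inter> S = {}"
  proof -
    have False if "s \<in> {t0<..<Min T}" "s \<in> S" for s
    proof -
      have "s \<in> T" using that 1 by (auto simp: T_def)
      then have "Min T \<le> s" using fin by simp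
      then show False using that by auto
    qed
    then show ?thesis by blast
  qed
  have "traj_arc X Y {t0<..<Min T} g" by (rule S(2)[rule_format]) (use sub 1 2 in auto)
  with 1 show ?thesis by (rule that)
qed

section \<open>Uniqueness of trajectories across the line\<close>

definition crossing :: "vfield \<Rightarrow> vfield \<Rightarrow> bool" where
  "crossing X Y \<longleftrightarrow> globally_lipschitz X \<and> globally_lipschitz Y \<and> X 0 = 0 \<and> Y 0 = 0 \<and>
     (\<forall>p. p $ 2 = 0 \<and> p $ 1 \<noteq> 0 \<longrightarrow> p $ 1 * X p $ 2 > 0 \<and> p $ 1 * Y p $ 2 > 0)"

text \<open>The field that governs the motion just after \<open>p\<close>: the positive half axis
  counts as upper side, the negative one as lower side, and the origin is at rest.\<close>

definition branch :: "vfield \<Rightarrow> vfield \<Rightarrow> real^2 \<Rightarrow> vfield" where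
  "branch X Y p = (if p $ 2 > 0 \<or> p $ 2 = 0 \<and> p $ 1 > 0 then X else if p = 0 then (\<lambda>_. 0) else Y)"

lemma initially_decreasing:
  fixes h k :: "real \<Rightarrow> real"
  assumes "a < b" and h: "continuous_on {a..b} h" and k: "continuous_on {a..b} k" and "k a < 0"
    and der: "\<And>t. a < t \<Longrightarrow> t < b \<Longrightarrow> (h has_real_derivative k t) (at t)"
  obtains t where "a < t" "t < b" "h t < h a"
proof -
  have "\<exists>d>0. \<forall>t\<in>{a..b}. dist t a < d \<longrightarrow> dist (k t) (k a) < - k a"
    using k \<open>a < b\<close> \<open>k a < 0\<close> unfolding continuous_on_iff by simp
  then obtain d where "d > 0" and d: "\<forall>t\<in>{a..b}. dist t a < d \<longrightarrow> dist (k t) (k a) < - k a" by blast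
  define c where "c = a + min ((b - a) / 2) (d / 2)"
  have c: "a < c" "c < b" "c - a < d" using \<open>a < b\<close> \<open>d > 0\<close> by (auto simp: c_def min_def field_simps)
  have "h c < h a"
  proof (rule DERIV_neg_imp_decreasing_open[OF c(1)])
    show "continuous_on {a..c} h" using c by (intro continuous_on_subset[OF h]) auto
    fix t assume t: "a < t" "t < c"
    then have "dist (k t) (k a) < - k a" using c by (intro d[rule_format]) (auto simp: dist_real_def)
    then have "k t < 0" by (auto simp: dist_real_def)
    with der[of t] t c show "\<exists>y. (h has_real_derivative y) (at t) \<and> y < 0" by auto
  qed
  with c show ?thesis by (intro that[of c])
qed

text \<open>The starting point decides which kind of arc follows. An upper arc cannot leave a point
  of the negative half axis, where \<open>X\<close> points down; a lower arc cannot leave the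
  positive half axis, where \<open>Y\<close> points up; and neither can leave the origin, where both
  fields have the constant solution.\<close>

lemma initial_arc:
  assumes XY: "crossing X Y" and "a < b" and c: "continuous_on {a..b} g"
    and arc: "traj_arc X Y {a<..<b} g" and t: "a < t" "t < b"
  shows "(g has_vector_derivative branch X Y (g a) (g t)) (at t)"
proof -
  have lip: "globally_lipschitz X" "globally_lipschitz Y" and z: "X 0 = 0" "Y 0 = 0"
    and cr: "\<And>p. p $ 2 = 0 \<Longrightarrow> p $ 1 \<noteq> 0 \<Longrightarrow> p $ 1 * X p $ 2 > 0 \<and> p $ 1 * Y p $ 2 > 0"
    using XY unfolding crossing_def by auto
  have ga: "(g \<longlongrightarrow> g a) (at_right a)"
    using c \<open>a < b\<close> by (metis at_within_Icc_at_right atLeastAtMost_iff continuous_on order.refl less_imp_le)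
  have ev: "\<forall>\<^sub>F s in at_right a. s \<in> {a<..<b}" using \<open>a < b\<close> by (auto simp: eventually_at_right)
  have ga2: "((\<lambda>s. g s $ 2) \<longlongrightarrow> g a $ 2) (at_right a)" by (intro tendsto_intros ga)
  have zero: "g s = 0" if "g a = 0" "globally_lipschitz F" "F 0 = 0" "a < s" "s < b"
      "\<And>s. a < s \<Longrightarrow> s < b \<Longrightarrow> (g has_vector_derivative F (g s)) (at s)" for F s
    by (rule solutions_agree[OF that(2), of a b g "\<lambda>_. 0"]) (use that \<open>a < b\<close> c in auto)
  have cF: "continuous_on {a..b} (\<lambda>s. F (g s) $ 2)" if "globally_lipschitz F" for F :: vfield
    by (intro continuous_intros continuous_on_compose2[OF globally_lipschitz_continuous[OF that] c]) auto
  have cg: "continuous_on {a..b} (\<lambda>s. g s $ 2)" by (intro continuous_intros c)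
  from arc consider
      (up) "\<And>s. s \<in> {a<..<b} \<Longrightarrow> g s $ 2 > 0 \<and> (g has_vector_derivative X (g s)) (at s)"
    | (lo) "\<And>s. s \<in> {a<..<b} \<Longrightarrow> g s $ 2 < 0 \<and> (g has_vector_derivative Y (g s)) (at s)"
    | (no) "\<And>s. s \<in> {a<..<b} \<Longrightarrow> g s = 0 \<and> (g has_vector_derivative 0) (at s)"
    unfolding traj_arc_def solution_arc_def by auto
  then show ?thesis
  proof cases
    case up
    have "g a $ 2 \<ge> 0"
      by (rule tendsto_lowerbound[OF ga2 eventually_mono[OF ev]]) (use up in \<open>auto simp: less_imp_le\<close>)
    moreover have "g a \<noteq> 0" using zero[of X t] up[of t] up t lip z by fastforce
    moreover have False if *: "g a $ 2 = 0" "g a $ 1 < 0"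
    proof -
      have k: "X (g a) $ 2 < 0" using cr[of "g a"] * by (auto simp: zero_less_mult_iff)
      obtain s where "a < s" "s < b" "g s $ 2 < g a $ 2"
        by (rule initially_decreasing[OF \<open>a < b\<close> cg cF[OF lip(1)] k]) (use up in \<open>auto intro!: has_derivative_component\<close>)
      then show False using up[of s] * by auto
    qed
    ultimately have "branch X Y (g a) = X" unfolding branch_def eq_real2 by force
    then show ?thesis using up t by simp
  next
    case lo
    have "g a $ 2 \<le> 0"
      by (rule tendsto_upperbound[OF ga2 eventually_mono[OF ev]]) (use lo in \<open>auto simp: less_imp_le\<close>)
    moreover have "g a \<noteq> 0" using zero[of Y t] lo[of t] lo t lip z by fastforce
    moreover have False if *: "g a $ 2 = 0" "g a $ 1 > 0"
    proof -
      have k: "- Y (g a) $ 2 < 0" using cr[of "g a"] * by (auto simp: zero_less_mult_iff)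
      obtain s where "a < s" "s < b" "- g s $ 2 < - g a $ 2"
        by (rule initially_decreasing[OF \<open>a < b\<close> continuous_on_minus[OF cg] continuous_on_minus[OF cF[OF lip(2)]] k])
          (use lo in \<open>auto intro!: DERIV_minus has_derivative_component\<close>)
      then show False using lo[of s] * by auto
    qed
    ultimately have "branch X Y (g a) = Y" unfolding branch_def by force
    then show ?thesis using lo t by simp
  next
    case no
    have "g a = 0"
      by (rule tendsto_unique[OF _ ga], simp)
        (rule tendsto_eventually, rule eventually_mono[OF ev], use no in auto)
    then show ?thesis using no[of t] t by (auto simp: branch_def)
  qed
qed

text \<open>At the last time of agreement both curves start a new arc from the same point, hence
  follow the same \<open>branch\<close> and agree a little longer.\<close>

lemma cross_traj_unique_forward:
  assumes XY: "crossing X Y" and g: "cross_traj X Y U I g" and k: "cross_traj X Y V J k"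
    and t: "t0 \<in> I" "t0 \<in> J" "t1 \<in> I" "t1 \<in> J" "t0 \<le> t1" and eq: "g t0 = k t0"
  shows "g t1 = k t1"
proof (rule ccontr)
  assume ne: "g t1 \<noteq> k t1"
  have sub: "{t0..t1} \<subseteq> I" "{t0..t1} \<subseteq> J"
    using mem_is_interval_1_I[OF cross_trajD(1)[OF g] t(1,3)] mem_is_interval_1_I[OF cross_trajD(1)[OF k] t(2,4)] by auto
  have c: "continuous_on {t0..t1} g" "continuous_on {t0..t1} k"
    using cross_trajD(3)[OF g] cross_trajD(3)[OF k] sub continuous_on_subset by blast+
  define A where "A = {t \<in> {t0..t1}. g t - k t = 0}"
  have "closed A" unfolding A_def
    by (rule continuous_closed_preimage_constant) (use c in \<open>auto intro!: continuous_intros\<close>)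
  then have "compact ({t0..t1} \<inter> A)" by (intro compact_Int_closed) auto
  also have "{t0..t1} \<inter> A = A" by (auto simp: A_def)
  finally have "compact A" .
  moreover have "A \<noteq> {}" using eq t by (auto simp: A_def)
  ultimately obtain s where s: "s \<in> A" "\<And>r. r \<in> A \<Longrightarrow> r \<le> s"
    using compact_attains_sup[of A] by blast
  have s01: "t0 \<le> s" "s < t1" "g s = k s" using s(1) ne by (auto simp: A_def less_le)
  have sI: "s \<in> I" "s \<in> J" using s01 sub by auto
  obtain u where u: "s < u" "u \<le> t1" "traj_arc X Y {s<..<u} g"
    by (rule cross_traj_first_arc[OF g sI(1) t(3) s01(2)])
  obtain v where v: "s < v" "v \<le> t1" "traj_arc X Y {s<..<v} k"
    by (rule cross_traj_first_arc[OF k sI(2) t(4) s01(2)])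
  define w where "w = min u v"
  have w: "s < w" "w \<le> t1" "w \<le> u" "w \<le> v" using u v by (auto simp: w_def)
  have arcs: "traj_arc X Y {s<..<w} g" "traj_arc X Y {s<..<w} k"
    by (rule traj_arc_subset[OF u(3)], use w in force) (rule traj_arc_subset[OF v(3)], use w in force)
  have cw: "continuous_on {s..w} g" "continuous_on {s..w} k"
    using c s01 w by (auto elim!: continuous_on_subset)
  have lip: "globally_lipschitz (branch X Y (g s))"
    using XY unfolding crossing_def branch_def
    by (auto intro: globally_lipschitzI[of _ 0])
  have "g w = k w"
    by (rule solutions_agree[OF lip, of s w])
      (use w cw initial_arc[OF XY w(1) cw(1) arcs(1)] initial_arc[OF XY w(1) cw(2) arcs(2)] s01 in auto)
  then have "w \<in> A" using w s01 by (auto simp: A_def)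
  then show False using s(2) w by fastforce
qed

section \<open>Equivalence of maximal trajectories\<close>

definition mirror :: "real^2 \<Rightarrow> real^2" where
  "mirror p = vector [- p $ 1, p $ 2]"

text \<open>Its solutions are the reflected solutions of \<open>F\<close> run backwards. This
  symmetry preserves the crossing directions on the line and the sense of rotation, so statements
  about the past follow from statements about the future.\<close>

definition mirror_field :: "vfield \<Rightarrow> vfield" where
  "mirror_field F p = - mirror (F (mirror p))"

lemma mirror_nth [simp]: "mirror p $ 1 = - p $ 1" "mirror p $ 2 = p $ 2"
  by (simp_all add: mirror_def vector_2)

lemma mirror_mirror [simp]: "mirror (mirror p) = p"
  by (simp add: eq_real2)

lemma mirror_0 [simp]: "mirror 0 = 0"
  by (simp add: eq_real2)

lemma mirror_eq_0_iff [simp]: "mirror p = 0 \<longleftrightarrow> p = 0"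
  by (simp add: eq_real2)

lemma norm_mirror [simp]: "norm (mirror p) = norm p"
  by (rule power2_eq_imp_eq) (simp_all add: norm_real2)

lemma bounded_linear_mirror: "bounded_linear mirror"
  by (rule bounded_linear_intro[of _ 1]) (simp_all add: eq_real2)

lemma globally_lipschitz_mirror_field: "globally_lipschitz F \<Longrightarrow> globally_lipschitz (mirror_field F)"
proof (erule globally_lipschitzE)
  fix L assume L: "\<And>u v. norm (F u - F v) \<le> L * norm (u - v)"
  show "globally_lipschitz (mirror_field F)"
  proof (rule globally_lipschitzI)
    fix u v
    have m: "mirror x - mirror y = mirror (x - y)" for x y by (simp add: eq_real2)
    have "norm (mirror_field F u - mirror_field F v) = norm (F (mirror u) - F (mirror v))"
      using norm_mirror[of "F (mirror v) - F (mirror u)"]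
      by (simp add: mirror_field_def m norm_minus_commute)
    also have "\<dots> \<le> L * norm (mirror u - mirror v)" by (rule L)
    finally show "norm (mirror_field F u - mirror_field F v) \<le> L * norm (u - v)" by (simp add: m)
  qed
qed

lemma crossing_mirror:
  assumes "crossing X Y"
  shows "crossing (mirror_field X) (mirror_field Y)"
proof -
  have "p $ 1 * mirror_field X p $ 2 > 0 \<and> p $ 1 * mirror_field Y p $ 2 > 0"
    if "p $ 2 = 0 \<and> p $ 1 \<noteq> 0" for p
  proof -
    have "mirror p $ 2 = 0 \<and> mirror p $ 1 \<noteq> 0" using that by simp
    then have "mirror p $ 1 * X (mirror p) $ 2 > 0 \<and> mirror p $ 1 * Y (mirror p) $ 2 > 0"
      using assms unfolding crossing_def by blast
    then show ?thesis by (simp add: mirror_field_def)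
  qed
  with assms show ?thesis
    unfolding crossing_def by (simp add: globally_lipschitz_mirror_field mirror_field_def)
qed

lemma cross_traj_mirror:
  assumes "cross_traj X Y U I g"
  shows "cross_traj (mirror_field X) (mirror_field Y) (mirror ` U) ((\<lambda>t. - 1 * t + 0) -` I) (\<lambda>t. mirror (g (- 1 * t + 0)))"
  by (rule cross_traj_conj[OF assms _ _ _ bounded_linear_mirror bounded_linear_mirror])
    (auto simp: mirror_field_def bounded_linear.linear bounded_linear_mirror linear_continuous_on)

lemma cross_traj_shift:
  assumes "cross_traj X Y U I g"
  shows "cross_traj X Y U ((\<lambda>t. t + d) -` I) (\<lambda>t. g (t + d))"
  using cross_traj_conj[OF assms, of 1 "\<lambda>p. p" "\<lambda>p. p" "\<lambda>p. p" X Y d]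
  by (simp add: bounded_linear_ident)

lemma cross_traj_unique:
  assumes XY: "crossing X Y" and g: "cross_traj X Y U I g" and k: "cross_traj X Y V J k"
    and t: "t0 \<in> I" "t0 \<in> J" "t1 \<in> I" "t1 \<in> J" and eq: "g t0 = k t0"
  shows "g t1 = k t1"
proof (cases "t0 \<le> t1")
  case True
  show ?thesis by (rule cross_traj_unique_forward[OF XY g k t True eq])
next
  case False
  have "mirror (g (-1 * - t1 + 0)) = mirror (k (-1 * - t1 + 0))"
    by (rule cross_traj_unique_forward[OF crossing_mirror[OF XY] cross_traj_mirror[OF g] cross_traj_mirror[OF k], of "- t0"])
      (use t eq False in auto)
  then show ?thesis by (metis mirror_mirror add_0_right mult_minus1 minus_minus)
qed

lemma max_traj_bij:
  assumes g: "max_traj X Y U I g"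
    and fwd: "\<And>I g. cross_traj X Y U I g \<Longrightarrow> cross_traj X' Y' (\<Lambda> ` U) (e -` I) (\<lambda>t. \<Lambda> (g (e t)))"
    and bwd: "\<And>I g. cross_traj X' Y' (\<Lambda> ` U) I g \<Longrightarrow> cross_traj X Y U (e' -` I) (\<lambda>t. \<Lambda>' (g (e' t)))"
    and inv: "\<And>p. \<Lambda>' (\<Lambda> p) = p" "\<And>t::real. e' (e t) = t" "\<And>t. e (e' t) = t"
  shows "max_traj X' Y' (\<Lambda> ` U) (e -` I) (\<lambda>t. \<Lambda> (g (e t)))"
  unfolding max_traj_def
proof (intro conjI allI impI)
  show "cross_traj X' Y' (\<Lambda> ` U) (e -` I) (\<lambda>t. \<Lambda> (g (e t)))"
    using g fwd unfolding max_traj_def by blast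
  fix I' g' assume *: "cross_traj X' Y' (\<Lambda> ` U) I' g' \<and> e -` I \<subseteq> I' \<and> (\<forall>t\<in>e -` I. g' t = \<Lambda> (g (e t)))"
  then have "cross_traj X Y U (e' -` I') (\<lambda>t. \<Lambda>' (g' (e' t)))" using bwd by blast
  moreover have "I \<subseteq> e' -` I'" using * inv by (metis subset_iff vimage_eq)
  moreover have "\<forall>t\<in>I. \<Lambda>' (g' (e' t)) = g t"
    using * inv by (metis vimage_eq)
  ultimately have "e' -` I' = I" using g unfolding max_traj_def by blast
  then show "I' = e -` I" using inv by (metis (no_types, lifting) set_eqI vimage_eq)
qed

lemma max_traj_shift:
  assumes "max_traj X Y U I g"
  shows "max_traj X Y U ((\<lambda>t. t + d) -` I) (\<lambda>t. g (t + d))"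
  using max_traj_bij[OF assms, of X Y "\<lambda>p. p" "\<lambda>t. t + d" "\<lambda>t. t - d" "\<lambda>p. p"]
    cross_traj_shift[of X Y U _ _ d] cross_traj_shift[of X Y U _ _ "- d"] by simp

lemma max_traj_reverse:
  assumes "max_traj X Y U I g"
  shows "max_traj (\<lambda>p. - X p) (\<lambda>p. - Y p) U (uminus -` I) (\<lambda>t. g (- t))"
proof -
  have r: "cross_traj (\<lambda>p. - X p) (\<lambda>p. - Y p) U (uminus -` I) (\<lambda>t. g (- t))" if "cross_traj X Y U I g" for I g X Y
    using cross_traj_conj[OF that, of "-1" "\<lambda>p. p" "\<lambda>p. p" "\<lambda>p. p" "\<lambda>p. - X p" "\<lambda>p. - Y p" 0]
    by (simp add: bounded_linear_ident)
  show ?thesis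
    using max_traj_bij[OF assms, of "\<lambda>p. - X p" "\<lambda>p. - Y p" "\<lambda>p. p" uminus uminus "\<lambda>p. p"]
      r[of X Y] r[of "\<lambda>p. - X p" "\<lambda>p. - Y p"] by simp
qed

lemma cross_traj_cong:
  assumes "cross_traj X Y U I g" "\<And>t. t \<in> I \<Longrightarrow> g t = k t"
  shows "cross_traj X Y U I k"
proof -
  note I = cross_trajD[OF assms(1)]
  obtain S where S: "\<forall>a b. {a..b} \<subseteq> I \<longrightarrow> finite (S \<inter> {a..b})"
      "\<forall>a b. {a<..<b} \<subseteq> I \<and> {a<..<b} \<inter> S = {} \<longrightarrow> traj_arc X Y {a<..<b} g"
    using cross_traj_junctions[OF assms(1)] by (elim exE conjE)
  have arc: "solution_arc F R {a<..<b} k" if "solution_arc F R {a<..<b} g" "{a<..<b} \<subseteq> I" for F R a b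
    unfolding solution_arc_def
  proof
    fix t assume t: "t \<in> {a<..<b}"
    have "(g has_vector_derivative F (g t)) (at t)" "g t \<in> R" using that t by (auto simp: solution_arc_def)
    moreover from this(1) have "(k has_vector_derivative F (g t)) (at t)"
      by (rule has_vector_derivative_transform_within_open[OF _ open_greaterThanLessThan t])
        (use that assms(2) in auto)
    ultimately show "k t \<in> R \<and> (k has_vector_derivative F (k t)) (at t)"
      using assms(2)[of t] that t by auto
  qed
  show ?thesis unfolding cross_traj_def
  proof (intro conjI exI[of _ S] allI impI)
    show "continuous_on I k" using I(3) assms(2) by (subst continuous_on_cong[OF refl]) auto
    show "k ` I \<subseteq> U" using I(4) assms(2) by auto
    show "traj_arc X Y {a<..<b} k" if "{a<..<b} \<subseteq> I \<and> {a<..<b} \<inter> S = {}" for a b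
      using S(2)[rule_format, OF that] that arc unfolding traj_arc_def by blast
  qed (use I S in auto)
qed

lemma max_traj_cong:
  assumes "max_traj X Y U I g" "\<And>t. t \<in> I \<Longrightarrow> g t = k t"
  shows "max_traj X Y U I k"
  using assms cross_traj_cong[of X Y U I g k] unfolding max_traj_def by (metis (no_types, lifting))

text \<open>By uniqueness an extension of a piece of \<open>c\<close> must follow \<open>c\<close>,
  so maximality inside \<open>U\<close> becomes a property of the time interval alone.\<close>

lemma max_traj_curve_iff:
  assumes XY: "crossing X Y" and c: "cross_traj X Y UNIV UNIV c"
  shows "max_traj X Y U I c \<longleftrightarrow> is_interval I \<and> I \<noteq> {} \<and> c ` I \<subseteq> U \<and>
    (\<forall>I'. is_interval I' \<and> I \<subseteq> I' \<and> c ` I' \<subseteq> U \<longrightarrow> I' = I)"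
proof
  assume p: "max_traj X Y U I c"
  then have I: "is_interval I" "I \<noteq> {}" "c ` I \<subseteq> U" unfolding max_traj_def cross_traj_def by blast+
  have "I' = I" if "is_interval I'" "I \<subseteq> I'" "c ` I' \<subseteq> U" for I'
    using p cross_traj_restrict[OF c that(1) _ subset_UNIV that(3)] that I(2) unfolding max_traj_def by blast
  with I show "is_interval I \<and> I \<noteq> {} \<and> c ` I \<subseteq> U \<and>
    (\<forall>I'. is_interval I' \<and> I \<subseteq> I' \<and> c ` I' \<subseteq> U \<longrightarrow> I' = I)" by blast
next
  assume *: "is_interval I \<and> I \<noteq> {} \<and> c ` I \<subseteq> U \<and>
    (\<forall>I'. is_interval I' \<and> I \<subseteq> I' \<and> c ` I' \<subseteq> U \<longrightarrow> I' = I)"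
  show "max_traj X Y U I c" unfolding max_traj_def
  proof (intro conjI allI impI)
    show "cross_traj X Y U I c" by (rule cross_traj_restrict[OF c]) (use * in auto)
    fix I' g' assume g': "cross_traj X Y U I' g' \<and> I \<subseteq> I' \<and> (\<forall>t\<in>I. g' t = c t)"
    obtain t0 where t0: "t0 \<in> I" using * by blast
    have "g' t = c t" if "t \<in> I'" for t
      by (rule cross_traj_unique[OF XY _ c, of U I' g' t0]) (use g' t0 that in auto)
    then have "c ` I' \<subseteq> U" using cross_trajD(4)[of X Y U I' g'] g' by force
    then show "I' = I" using * g' cross_trajD(1)[of X Y U I' g'] by blast
  qed
qed

section \<open>Equivalences that respect all subsets of the plane\<close>

text \<open>All sets \<open>U\<close> are quantified over, so that one global equivalence yields
  local ones in neighbourhoods of any size. The second pair of fields is observed only in the image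
  of \<open>U\<close>, as \<open>H\<close> need not be onto.\<close>

definition orbit_equiv :: "vfield \<Rightarrow> vfield \<Rightarrow> vfield \<Rightarrow> vfield \<Rightarrow> (real^2 \<Rightarrow> real^2) \<Rightarrow> bool" where
  "orbit_equiv X Y X' Y' H \<longleftrightarrow> continuous_on UNIV H \<and> inj H \<and> H 0 = 0 \<and> (\<forall>p. H p $ 2 = 0 \<longleftrightarrow> p $ 2 = 0) \<and>
     (\<forall>U I g. max_traj X Y U I g \<longrightarrow> (\<exists>J k. max_traj X' Y' (H ` U) J k \<and> carries_onto H I g J k)) \<and>
     (\<forall>U J k. max_traj X' Y' (H ` U) J k \<longrightarrow> (\<exists>I g. max_traj X Y U I g \<and> carries_onto H I g J k))"

lemma orbit_equivD:
  assumes "orbit_equiv X Y X' Y' H"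
  shows "continuous_on UNIV H" "inj H" "H 0 = 0" "H p $ 2 = 0 \<longleftrightarrow> p $ 2 = 0"
    "max_traj X Y U I g \<Longrightarrow> \<exists>J k. max_traj X' Y' (H ` U) J k \<and> carries_onto H I g J k"
    "max_traj X' Y' (H ` U) J k \<Longrightarrow> \<exists>I g. max_traj X Y U I g \<and> carries_onto H I g J k"
  using assms unfolding orbit_equiv_def by blast+

lemma orbit_equivI:
  assumes "continuous_on UNIV H" "inj H" "H 0 = 0" "\<And>p. H p $ 2 = 0 \<longleftrightarrow> p $ 2 = 0"
    "\<And>U I g. max_traj X Y U I g \<Longrightarrow> \<exists>J k. max_traj X' Y' (H ` U) J k \<and> carries_onto H I g J k"
    "\<And>U J k. max_traj X' Y' (H ` U) J k \<Longrightarrow> \<exists>I g. max_traj X Y U I g \<and> carries_onto H I g J k"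
  shows "orbit_equiv X Y X' Y' H"
  unfolding orbit_equiv_def by (intro conjI allI impI assms)

lemma carries_onto_trans:
  assumes "carries_onto H I g J k" "carries_onto K J k M m"
  shows "carries_onto (\<lambda>p. K (H p)) I g M m"
proof -
  obtain h1 where h1: "strict_mono_on I h1" "h1 ` I = J" "\<forall>t\<in>I. H (g t) = k (h1 t)"
    using assms(1) unfolding carries_onto_def by blast
  obtain h2 where h2: "strict_mono_on J h2" "h2 ` J = M" "\<forall>t\<in>J. K (k t) = m (h2 t)"
    using assms(2) unfolding carries_onto_def by blast
  show ?thesis unfolding carries_onto_def
  proof (intro exI[of _ "h2 \<circ> h1"] conjI)
    show "strict_mono_on I (h2 \<circ> h1)"
      using h1 h2 unfolding strict_mono_on_def by auto
    show "(h2 \<circ> h1) ` I = M" unfolding h2(2)[symmetric] h1(2)[symmetric] by (rule image_comp[symmetric])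
    show "\<forall>t\<in>I. K (H (g t)) = m ((h2 \<circ> h1) t)" using h1 h2 by auto
  qed
qed

lemma orbit_equiv_trans:
  assumes "orbit_equiv X Y X' Y' H" "orbit_equiv X' Y' X'' Y'' K"
  shows "orbit_equiv X Y X'' Y'' (\<lambda>p. K (H p))"
proof -
  have im: "(\<lambda>p. K (H p)) ` U = K ` H ` U" for U by auto
  have 1: "\<exists>J k. max_traj X'' Y'' (K ` H ` U) J k \<and> carries_onto (\<lambda>p. K (H p)) I g J k"
    if g: "max_traj X Y U I g" for U I g
  proof -
    obtain J k where k: "max_traj X' Y' (H ` U) J k" "carries_onto H I g J k"
      using orbit_equivD(5)[OF assms(1) g] by blast
    obtain M m where "max_traj X'' Y'' (K ` H ` U) M m" "carries_onto K J k M m"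
      using orbit_equivD(5)[OF assms(2) k(1)] by blast
    with carries_onto_trans[OF k(2)] show ?thesis by blast
  qed
  have 2: "\<exists>I g. max_traj X Y U I g \<and> carries_onto (\<lambda>p. K (H p)) I g J k"
    if k: "max_traj X'' Y'' (K ` H ` U) J k" for U J k
  proof -
    obtain I g where g: "max_traj X' Y' (H ` U) I g" "carries_onto K I g J k"
      using orbit_equivD(6)[OF assms(2) k] by blast
    obtain M m where "max_traj X Y U M m" "carries_onto H M m I g"
      using orbit_equivD(6)[OF assms(1) g(1)] by blast
    with carries_onto_trans[OF _ g(2)] show ?thesis by blast
  qed
  have "continuous_on UNIV (\<lambda>p. K (H p))"
    by (rule continuous_on_compose2[OF orbit_equivD(1)[OF assms(2)] orbit_equivD(1)[OF assms(1)]]) simp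
  moreover have "inj (\<lambda>p. K (H p))"
    using inj_compose[OF orbit_equivD(2)[OF assms(2)] orbit_equivD(2)[OF assms(1)]] by (simp only: o_def)
  ultimately show ?thesis
    using 1 2 orbit_equivD(3,4)[OF assms(1)] orbit_equivD(3,4)[OF assms(2)] by (intro orbit_equivI) (simp_all add: im)
qed

lemma carries_onto_id: "(\<And>t. t \<in> I \<Longrightarrow> H (g t) = k t) \<Longrightarrow> carries_onto H I g I k"
  unfolding carries_onto_def by (rule exI[of _ id]) (auto simp: strict_mono_on_def)

lemma orbit_equiv_bij:
  assumes "continuous_on UNIV \<Lambda>" "\<Lambda> 0 = 0" "\<And>p. \<Lambda> p $ 2 = 0 \<longleftrightarrow> p $ 2 = 0"
    and inv: "\<And>p. \<Lambda>' (\<Lambda> p) = p" "\<And>p. \<Lambda> (\<Lambda>' p) = p"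
    and fwd: "\<And>U I g. cross_traj X Y U I g \<Longrightarrow> cross_traj X' Y' (\<Lambda> ` U) I (\<lambda>t. \<Lambda> (g t))"
    and bwd: "\<And>U I g. cross_traj X' Y' U I g \<Longrightarrow> cross_traj X Y (\<Lambda>' ` U) I (\<lambda>t. \<Lambda>' (g t))"
  shows "orbit_equiv X Y X' Y' \<Lambda>"
proof -
  have im: "\<Lambda>' ` \<Lambda> ` U = U" "\<Lambda> ` \<Lambda>' ` U = U" for U by (auto simp: image_image inv)
  have 1: "max_traj X' Y' (\<Lambda> ` U) I (\<lambda>t. \<Lambda> (g t))" if "max_traj X Y U I g" for U I g
    using max_traj_bij[OF that, of X' Y' \<Lambda> "\<lambda>t. t" "\<lambda>t. t" \<Lambda>'] fwd bwd[of "\<Lambda> ` U"] inv im by simp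
  have 2: "max_traj X Y U I (\<lambda>t. \<Lambda>' (g t))" if "max_traj X' Y' (\<Lambda> ` U) I g" for U I g
    using max_traj_bij[OF that, of X Y \<Lambda>' "\<lambda>t. t" "\<lambda>t. t" \<Lambda>] bwd[of "\<Lambda> ` U"] fwd[of U] inv im by simp
  have 3: "inj \<Lambda>" using inv(1) by (metis injI)
  show ?thesis
  proof (rule orbit_equivI[OF assms(1) 3 assms(2,3)])
    show "\<exists>J k. max_traj X' Y' (\<Lambda> ` U) J k \<and> carries_onto \<Lambda> I g J k" if "max_traj X Y U I g" for U I g
      using 1[OF that] carries_onto_id[of I \<Lambda> g "\<lambda>t. \<Lambda> (g t)", OF refl] by blast
    show "\<exists>I g. max_traj X Y U I g \<and> carries_onto \<Lambda> I g J k" if "max_traj X' Y' (\<Lambda> ` U) J k" for U J k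
      using 2[OF that] carries_onto_id[of J \<Lambda> "\<lambda>t. \<Lambda>' (k t)" k, OF inv(2)] by blast
  qed
qed

lemma orbit_equiv_reverse:
  assumes "orbit_equiv (\<lambda>p. - X p) (\<lambda>p. - Y p) (\<lambda>p. - X' p) (\<lambda>p. - Y' p) H"
  shows "orbit_equiv X Y X' Y' H"
proof -
  have unreverse: "max_traj X Y U (uminus -` I) (\<lambda>t. g (- t))" if "max_traj (\<lambda>p. - X p) (\<lambda>p. - Y p) U I g" for X Y U I g
    using max_traj_reverse[OF that] by simp
  have uu: "uminus -` uminus -` I = I" for I :: "real set" by auto
  have rev: "carries_onto H (uminus -` I) (\<lambda>t. g (- t)) (uminus -` J) (\<lambda>t. k (- t))"
    if c: "carries_onto H I g J k" for I g J k
  proof -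
    obtain h where h: "strict_mono_on I h" "h ` I = J" "\<forall>t\<in>I. H (g t) = k (h t)"
      using c unfolding carries_onto_def by blast
    show ?thesis unfolding carries_onto_def
    proof (intro exI[of _ "\<lambda>t. - h (- t)"] conjI)
      show "strict_mono_on (uminus -` I) (\<lambda>t. - h (- t))"
        using h(1) unfolding strict_mono_on_def by simp
      show "(\<lambda>t. - h (- t)) ` (uminus -` I) = uminus -` J"
      proof (intro equalityI subsetI)
        fix x assume "x \<in> uminus -` J"
        then obtain s where "s \<in> I" "h s = - x" using h(2) by auto
        then show "x \<in> (\<lambda>t. - h (- t)) ` (uminus -` I)" by (intro image_eqI[of _ _ "- s"]) auto
      qed (use h(2) in auto)
    qed (use h(3) in auto)
  qed
  have 1: "\<exists>J k. max_traj X' Y' (H ` U) J k \<and> carries_onto H I g J k" if g: "max_traj X Y U I g" for U I g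
  proof -
    obtain J k where "max_traj (\<lambda>p. - X' p) (\<lambda>p. - Y' p) (H ` U) J k"
        "carries_onto H (uminus -` I) (\<lambda>t. g (- t)) J k"
      using orbit_equivD(5)[OF assms max_traj_reverse[OF g]] by blast
    then show ?thesis
      using unreverse[of X' Y' "H ` U" J k] rev[of "uminus -` I" "\<lambda>t. g (- t)" J k] unfolding uu minus_minus by blast
  qed
  have 2: "\<exists>I g. max_traj X Y U I g \<and> carries_onto H I g J k" if k: "max_traj X' Y' (H ` U) J k" for U J k
  proof -
    obtain I g where "max_traj (\<lambda>p. - X p) (\<lambda>p. - Y p) U I g"
        "carries_onto H I g (uminus -` J) (\<lambda>t. k (- t))"
      using orbit_equivD(6)[OF assms max_traj_reverse[OF k]] by blast
    then show ?thesis
      using unreverse[of X Y U I g] rev[of I g "uminus -` J" "\<lambda>t. k (- t)"] unfolding uu minus_minus by blast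
  qed
  show ?thesis by (rule orbit_equivI[OF orbit_equivD(1-4)[OF assms] 1 2])
qed

text \<open>By uniqueness every maximal trajectory is, up to a shift of time, a piece of one of
  these global curves, and an increasing bijection of the real line carries maximal time intervals
  to maximal ones.\<close>

lemma orbit_equiv_curves:
  assumes XY: "crossing X Y" "crossing X' Y'"
    and H: "continuous_on UNIV H" "inj H" "H 0 = 0" "\<And>p. H p $ 2 = 0 \<longleftrightarrow> p $ 2 = 0"
    and ex: "\<And>p. \<exists>c c' h. cross_traj X Y UNIV UNIV c \<and> c 0 = p \<and> cross_traj X' Y' UNIV UNIV c' \<and>
      strict_mono h \<and> surj (h :: real \<Rightarrow> real) \<and> (\<forall>t. H (c t) = c' (h t))"
  shows "orbit_equiv X Y X' Y' H"
proof -
  have locate: "\<And>t. t \<in> I \<Longrightarrow> g t = c (t - t0 + s0)" "max_traj X Y U ((\<lambda>t. t + (t0 - s0)) -` I) c"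
    if XY: "crossing X Y" and g: "max_traj X Y U I g" and c: "cross_traj X Y UNIV UNIV c"
      and t0: "t0 \<in> I" "g t0 = c s0" for X Y U I g c t0 s0
  proof -
    have c': "cross_traj X Y UNIV UNIV (\<lambda>t. c (t + (s0 - t0)))" using cross_traj_shift[OF c] by simp
    have g': "cross_traj X Y U I g" using g unfolding max_traj_def by blast
    have "g t = c (t + (s0 - t0))" if "t \<in> I" for t
      by (rule cross_traj_unique[OF XY g' c', of t0]) (use t0 that in auto)
    then show *: "g t = c (t - t0 + s0)" if "t \<in> I" for t using that by (simp add: algebra_simps)
    show "max_traj X Y U ((\<lambda>t. t + (t0 - s0)) -` I) c"
      by (rule max_traj_cong[OF max_traj_shift[OF g]]) (use * in \<open>auto simp: algebra_simps\<close>)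
  qed
  \<comment> \<open>Both sides express maximality of a time interval. The map \<open>h\<close>
    preserves and reflects intervals and inclusions, and injectivity of \<open>H\<close> does the
    same for containment in \<open>U\<close>.\<close>
  have seg: "max_traj X' Y' (H ` U) (h ` I) c' \<longleftrightarrow> max_traj X Y U I c"
    if c: "cross_traj X Y UNIV UNIV c" "cross_traj X' Y' UNIV UNIV c'" and h: "strict_mono h" "surj (h :: real \<Rightarrow> real)"
      and Hc: "\<forall>t. H (c t) = c' (h t)" for U I c c' h
  proof -
    have int: "is_interval (h ` I) \<longleftrightarrow> is_interval I" for I
    proof -
      have "(\<forall>a\<in>I. \<forall>b\<in>I. \<forall>x. h a \<le> x \<and> x \<le> h b \<longrightarrow> x \<in> h ` I) \<longleftrightarrow>
          (\<forall>a\<in>I. \<forall>b\<in>I. \<forall>x. h a \<le> h x \<and> h x \<le> h b \<longrightarrow> h x \<in> h ` I)"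
        using h(2) by (metis surjD)
      also have "\<dots> \<longleftrightarrow> (\<forall>a\<in>I. \<forall>b\<in>I. \<forall>x. a \<le> x \<and> x \<le> b \<longrightarrow> x \<in> I)"
        using strict_mono_less_eq[OF h(1)] strict_mono_eq[OF h(1)] by (auto simp: image_iff)
      finally show ?thesis unfolding is_interval_1 by (simp add: image_iff Ball_def) blast
    qed
    have img: "c' ` h ` I \<subseteq> H ` U \<longleftrightarrow> c ` I \<subseteq> U" for I
      using Hc inj_image_mem_iff[OF H(2)] by (auto simp: subset_iff image_iff Ball_def) (metis injD[OF H(2)])+
    have sub: "h ` I \<subseteq> h ` I' \<longleftrightarrow> I \<subseteq> I'" "h ` I = h ` I' \<longleftrightarrow> I = I'" for I I'
      using inj_image_subset_iff inj_image_eq_iff strict_mono_imp_inj_on[OF h(1)] by metis+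
    \<comment> \<open>Since \<open>h\<close> is onto, every set of times of the second curve is an
      image.\<close>
    have all: "(\<forall>I'. P I') \<longleftrightarrow> (\<forall>I'. P (h ` I'))" for P
      by (metis surj_image_vimage_eq[OF h(2)])
    show ?thesis
      unfolding max_traj_curve_iff[OF XY(1) c(1)] max_traj_curve_iff[OF XY(2) c(2)]
      by (subst all) (simp add: int img sub)
  qed
  have 1: "\<exists>J k. max_traj X' Y' (H ` U) J k \<and> carries_onto H I g J k" if g: "max_traj X Y U I g" for U I g
  proof -
    obtain t0 where t0: "t0 \<in> I" using g unfolding max_traj_def cross_traj_def by blast
    obtain c c' h where c: "cross_traj X Y UNIV UNIV c" "c 0 = g t0" "cross_traj X' Y' UNIV UNIV c'"
      "strict_mono h" "surj (h :: real \<Rightarrow> real)" "\<forall>t. H (c t) = c' (h t)" using ex[of "g t0"] by (elim exE conjE)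
    note l = locate[OF XY(1) g c(1) t0 c(2)[symmetric]]
    have "max_traj X' Y' (H ` U) (h ` ((\<lambda>t. t + (t0 - 0)) -` I)) c'"
      using seg[OF c(1,3-6)] l(2) by blast
    moreover have "carries_onto H I g (h ` ((\<lambda>t. t + (t0 - 0)) -` I)) c'"
      unfolding carries_onto_def
    proof (intro exI[of _ "\<lambda>t. h (t - t0)"] conjI)
      show "strict_mono_on I (\<lambda>t. h (t - t0))" using c(4) by (auto simp: strict_mono_on_def strict_mono_def)
      have "(\<lambda>t. t + (t0 - 0)) -` I = (\<lambda>t. t - t0) ` I"
        by (auto intro!: image_eqI[of _ _ "_ + t0"])
      then show "(\<lambda>t. h (t - t0)) ` I = h ` ((\<lambda>t. t + (t0 - 0)) -` I)"
        by (simp only: image_image)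
      show "\<forall>t\<in>I. H (g t) = c' (h (t - t0))" using l(1) c(6) by simp
    qed
    ultimately show ?thesis by blast
  qed
  have 2: "\<exists>I g. max_traj X Y U I g \<and> carries_onto H I g J k" if k: "max_traj X' Y' (H ` U) J k" for U J k
  proof -
    obtain t0 where t0: "t0 \<in> J" using k unfolding max_traj_def cross_traj_def by blast
    then have "k t0 \<in> H ` U" using k unfolding max_traj_def cross_traj_def by blast
    then obtain p where p: "k t0 = H p" by blast
    obtain c c' h where c: "cross_traj X Y UNIV UNIV c" "c 0 = p" "cross_traj X' Y' UNIV UNIV c'"
      "strict_mono h" "surj (h :: real \<Rightarrow> real)" "\<forall>t. H (c t) = c' (h t)" using ex[of p] by (elim exE conjE)
    have k0: "k t0 = c' (h 0)" using p c by metis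
    note l = locate[OF XY(2) k c(3) t0 k0]
    \<comment> \<open>The times of \<open>c\<close> that correspond to \<open>J\<close>, after the
      shift that places \<open>t0\<close> at \<open>h 0\<close>.\<close>
    define I where "I = h -` ((\<lambda>t. t + (t0 - h 0)) -` J)"
    have hI: "h ` I = (\<lambda>t. t + (t0 - h 0)) -` J" unfolding I_def by (rule surj_image_vimage_eq[OF c(5)])
    have "max_traj X Y U I c" using seg[OF c(1,3-6), of U I] l(2) hI by simp
    moreover have "carries_onto H I c J k"
      unfolding carries_onto_def
    proof (intro exI[of _ "\<lambda>t. h t + (t0 - h 0)"] conjI)
      show "strict_mono_on I (\<lambda>t. h t + (t0 - h 0))" using c(4) by (auto simp: strict_mono_on_def strict_mono_def)
      have "(\<lambda>t. h t + (t0 - h 0)) ` I = (\<lambda>t. t + (t0 - h 0)) ` h ` I" by (simp add: image_image)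
      also have "\<dots> = J" unfolding hI by (rule surj_image_vimage_eq) (rule surj_plus_right)
      finally show "(\<lambda>t. h t + (t0 - h 0)) ` I = J" .
      show "\<forall>t\<in>I. H (c t) = k (h t + (t0 - h 0))" using l(1) c(6) by (simp add: I_def)
    qed
    ultimately show ?thesis by blast
  qed
  show ?thesis by (rule orbit_equivI[OF H 1 2])
qed

section \<open>The half turn above the switching line\<close>

definition axis_point :: "real \<Rightarrow> real^2" where
  "axis_point s = vector [s, 0]"

lemma axis_point_nth [simp]: "axis_point s $ 1 = s" "axis_point s $ 2 = 0"
  by (simp_all add: axis_point_def vector_2)

lemma axis_point_eq_0_iff [simp]: "axis_point s = 0 \<longleftrightarrow> s = 0"
  by (simp add: eq_real2)

lemma norm_axis_point [simp]: "norm (axis_point s) = \<bar>s\<bar>"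
  by (rule power2_eq_imp_eq) (simp_all add: norm_real2)

lemma mirror_axis_point [simp]: "mirror (axis_point s) = axis_point (- s)"
  by (simp add: eq_real2)

lemma eq_axis_pointI: "p $ 2 = 0 \<Longrightarrow> p = axis_point (p $ 1)"
  by (simp add: eq_real2)

lemma continuous_on_axis_point [continuous_intros]:
  assumes "continuous_on A f"
  shows "continuous_on A (\<lambda>x. axis_point (f x))"
proof -
  have "axis_point (f x) = f x *\<^sub>R axis_point 1" for x by (simp add: eq_real2)
  then show ?thesis using assms by (simp only:) (intro continuous_intros)
qed

lemma flow_mirror_field:
  assumes "globally_lipschitz F"
  shows "flow (mirror_field F) t (mirror p) = mirror (flow F (- t) p)"
proof -
  have "((\<lambda>t. mirror (flow F (- t) p)) has_vector_derivative mirror_field F (mirror (flow F (- t) p))) (at t)" for t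
  proof -
    have "(uminus has_vector_derivative -1) (at t)" by (auto intro!: derivative_eq_intros)
    from vector_diff_chain_at[OF this flow_deriv[OF assms, of p "- t"]]
    have "((\<lambda>t. flow F (- t) p) has_vector_derivative - F (flow F (- t) p)) (at t)" by (simp add: o_def)
    from bounded_linear.has_vector_derivative[OF bounded_linear_mirror this]
    show ?thesis by (simp add: mirror_field_def linear_neg[OF bounded_linear.linear[OF bounded_linear_mirror]])
  qed
  from flow_unique[OF globally_lipschitz_mirror_field[OF assms] this, of t 0]
  show ?thesis by (simp add: flow_0[OF assms])
qed

lemma flow_component_deriv:
  fixes F :: "real^2 \<Rightarrow> real^2"
  assumes "globally_lipschitz F"
  shows "((\<lambda>t. flow F t p $ i) has_real_derivative F (flow F t p) $ i) (at t)"
  by (rule has_derivative_component[OF flow_deriv[OF assms]])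

text \<open>The expression \<open>p $ 1 * X p $ 2 - p $ 2 * X p $ 1\<close> is the squared norm
  times the angular velocity, which is thus bounded below by \<open>c\<close>.\<close>

definition rotating :: "vfield \<Rightarrow> bool" where
  "rotating X \<longleftrightarrow> globally_lipschitz X \<and> X 0 = 0 \<and>
     (\<exists>c>0. \<forall>p. c * (norm p)\<^sup>2 \<le> p $ 1 * X p $ 2 - p $ 2 * X p $ 1)"

lemma rotating_mirror: "rotating X \<Longrightarrow> rotating (mirror_field X)"
proof -
  assume X: "rotating X"
  then obtain c where "c > 0" and c: "\<And>p. c * (norm p)\<^sup>2 \<le> p $ 1 * X p $ 2 - p $ 2 * X p $ 1"
    unfolding rotating_def by blast
  have "c * (norm p)\<^sup>2 \<le> p $ 1 * mirror_field X p $ 2 - p $ 2 * mirror_field X p $ 1" for p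
    using c[of "mirror p"] by (simp add: mirror_field_def)
  with X \<open>c > 0\<close> show ?thesis
    unfolding rotating_def by (auto simp: globally_lipschitz_mirror_field mirror_field_def)
qed

context
  fixes X :: vfield
  assumes X: "rotating X"
begin

lemma rotating_lip: "globally_lipschitz X" and rotating_0: "X 0 = 0"
  using X unfolding rotating_def by blast+

lemma rotating_axis: "p $ 2 = 0 \<Longrightarrow> p $ 1 \<noteq> 0 \<Longrightarrow> p $ 1 * X p $ 2 > 0"
proof -
  assume p: "p $ 2 = 0" "p $ 1 \<noteq> 0"
  obtain c where "c > 0" and c: "\<And>p. c * (norm p)\<^sup>2 \<le> p $ 1 * X p $ 2 - p $ 2 * X p $ 1"
    using X unfolding rotating_def by blast
  have "0 < c * (norm p)\<^sup>2" using p \<open>c > 0\<close> by (simp add: norm_real2)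
  also have "\<dots> \<le> p $ 1 * X p $ 2" using c[of p] p by simp
  finally show ?thesis .
qed

lemmas rot_flow_0 [simp] = flow_0[OF rotating_lip]
lemmas rot_flow_deriv = flow_component_deriv[OF rotating_lip]
lemmas rot_flow_eq_0 = flow_eq_0_iff[OF rotating_lip rotating_0]

lemma leaves_upper_on_left:
  assumes "p $ 2 = 0" "p $ 1 < 0"
  obtains d where "d > 0" "\<And>h. 0 < h \<Longrightarrow> h < d \<Longrightarrow> flow X h p $ 2 < 0"
proof -
  have "X p $ 2 < 0" using rotating_axis[of p] assms by (auto simp: zero_less_mult_iff)
  then obtain d where "d > 0" "\<forall>h>0. h < d \<longrightarrow> flow X 0 p $ 2 > flow X (0 + h) p $ 2"
    using DERIV_neg_dec_right[OF rot_flow_deriv[of p 2 0]] by auto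
  then show ?thesis using assms by (intro that[of d]) auto
qed

lemma enters_upper_on_right:
  assumes "p $ 2 = 0" "p $ 1 > 0"
  obtains d where "d > 0" "\<And>h. 0 < h \<Longrightarrow> h < d \<Longrightarrow> flow X h p $ 2 > 0"
proof -
  have "X p $ 2 > 0" using rotating_axis[of p] assms by (auto simp: zero_less_mult_iff)
  then obtain d where "d > 0" "\<forall>h>0. h < d \<longrightarrow> flow X 0 p $ 2 < flow X (0 + h) p $ 2"
    using DERIV_pos_inc_right[OF rot_flow_deriv[of p 2 0]] by auto
  then show ?thesis using assms by (intro that[of d]) auto
qed

text \<open>Above the line the polar angle is confined to an interval of length \<open>pi\<close>
  and increases at rate at least \<open>c\<close>, which cannot last longer than
  \<open>pi / c\<close>.\<close>

lemma upper_reaches_left_open: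
  assumes c: "c > 0" "\<And>p. c * (norm p)\<^sup>2 \<le> p $ 1 * X p $ 2 - p $ 2 * X p $ 1" and p: "p $ 2 > 0"
  shows "\<exists>t. 0 \<le> t \<and> t \<le> pi / c \<and> flow X t p $ 2 = 0 \<and> flow X t p $ 1 < 0 \<and>
    (\<forall>s. 0 \<le> s \<and> s < t \<longrightarrow> flow X s p $ 2 > 0)"
proof -
  let ?x = "\<lambda>t. flow X t p $ 1" and ?y = "\<lambda>t. flow X t p $ 2"
  have cont: "continuous_on A ?y" for A by (intro continuous_intros flow_continuous_time rotating_lip)
  have "\<exists>t\<in>{0..pi/c}. ?y t \<le> 0"
  proof (rule ccontr)
    assume "\<not> ?thesis"
    then have pos: "?y t > 0" if "0 \<le> t" "t \<le> pi / c" for t using that by force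
    \<comment> \<open>The arctangent of \<open>x / y\<close> is \<open>pi / 2\<close> minus the
      polar angle, hence decreases at rate at least \<open>c\<close>.\<close>
    let ?f = "\<lambda>t. arctan (?x t / ?y t) + c * t"
    have "?f (pi / c) \<le> ?f 0"
    proof (rule DERIV_nonpos_imp_nonincreasing[where f = ?f])
      fix t assume t: "0 \<le> t" "t \<le> pi / c"
      let ?p = "flow X t p"
      have y: "?y t > 0" using pos t by blast
      have d: "(?f has_real_derivative inverse (1 + (?x t / ?y t)\<^sup>2) *
          ((X ?p $ 1 * ?y t - ?x t * X ?p $ 2) / (?y t * ?y t)) + c) (at t)"
        using y by (auto intro!: derivative_eq_intros rot_flow_deriv)
      have "1 + (?x t / ?y t)\<^sup>2 = ((?x t)\<^sup>2 + (?y t)\<^sup>2) / (?y t * ?y t)"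
        using y by (simp add: field_simps power2_eq_square)
      then have "inverse (1 + (?x t / ?y t)\<^sup>2) * ((X ?p $ 1 * ?y t - ?x t * X ?p $ 2) / (?y t * ?y t))
          = (X ?p $ 1 * ?y t - ?x t * X ?p $ 2) / ((?x t)\<^sup>2 + (?y t)\<^sup>2)"
        using y by simp
      also have "\<dots> \<le> - c"
        using c(2)[of ?p] y by (simp add: norm_real2 divide_le_eq sum_power2_gt_zero_iff algebra_simps)
      finally show "\<exists>d. (?f has_real_derivative d) (at t) \<and> d \<le> 0" using d by force
    qed (use c in simp)
    moreover have "arctan (?x 0 / ?y 0) < pi / 2" "- (pi / 2) < arctan (?x (pi / c) / ?y (pi / c))"
      using arctan_ubound arctan_lbound by blast+
    ultimately show False using c(1) by simp
  qed
  then have "compact {t \<in> {0..pi/c}. ?y t \<le> 0}" "{t \<in> {0..pi/c}. ?y t \<le> 0} \<noteq> {}"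
    using continuous_closed_preimage[OF cont[of "{0..pi/c}"], of "{..0}"]
      compact_Int_closed[of "{0..pi/c}" "{t \<in> {0..pi/c}. ?y t \<le> 0}"]
    by (auto simp: vimage_def Int_def conj_commute cong: conj_cong)
  then obtain t where t: "t \<in> {0..pi/c}" "?y t \<le> 0" and min: "\<And>s. s \<in> {0..pi/c} \<Longrightarrow> ?y s \<le> 0 \<Longrightarrow> t \<le> s"
    using compact_attains_inf[of "{t \<in> {0..pi/c}. ?y t \<le> 0}"] by auto
  have pos: "?y s > 0" if "0 \<le> s" "s < t" for s
    using min[of s] t that by force
  have "t > 0" using t p by (cases "t = 0") auto
  have "?y t = 0"
  proof -
    have "(?y \<longlongrightarrow> ?y t) (at_left t)"
      using cont[of UNIV] unfolding continuous_on_def by (meson UNIV_I subset_UNIV tendsto_within_subset)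
    moreover have "\<forall>\<^sub>F s in at_left t. s \<in> {0<..<t}" using \<open>t > 0\<close> by (auto simp: eventually_at_left)
    then have "\<forall>\<^sub>F s in at_left t. 0 \<le> ?y s" by (rule eventually_mono) (use pos in \<open>force intro: less_imp_le\<close>)
    ultimately have "0 \<le> ?y t" by (intro tendsto_lowerbound) auto
    with t show ?thesis by simp
  qed
  \<comment> \<open>On the positive half axis the field points up, so the orbit would have been
    below the line just before \<open>t\<close>.\<close>
  have "?x t < 0"
  proof (rule ccontr)
    assume "\<not> ?x t < 0"
    moreover have "flow X t p \<noteq> 0" using p rot_flow_eq_0[of t p] by auto
    ultimately have "?x t > 0" using \<open>?y t = 0\<close> by (auto simp: eq_real2)
    then have "X (flow X t p) $ 2 > 0"
      using rotating_axis[of "flow X t p"] \<open>?y t = 0\<close> by (auto simp: zero_less_mult_iff)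
    then obtain d where d: "d > 0" "\<forall>h>0. h < d \<longrightarrow> ?y (t - h) < ?y t"
      using DERIV_pos_inc_left[OF rot_flow_deriv[of p 2 t]] by auto
    have "?y (t - min (d / 2) t) < 0" using d \<open>t > 0\<close> \<open>?y t = 0\<close> by (auto simp: min_def)
    moreover have "?y (t - min (d / 2) t) > 0" using d \<open>t > 0\<close> by (intro pos) auto
    ultimately show False by simp
  qed
  with t pos \<open>?y t = 0\<close> show ?thesis by auto
qed

text \<open>Weak inequalities along the way let the condition pass to limits; the strict one at the
  end is recovered because orbits do not reach the origin.\<close>

definition hits_left :: "real^2 \<Rightarrow> real \<Rightarrow> bool" where
  "hits_left p t \<longleftrightarrow> 0 \<le> t \<and> flow X t p $ 2 = 0 \<and> flow X t p $ 1 < 0 \<and> (\<forall>s\<in>{0..t}. flow X s p $ 2 \<ge> 0)"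

text \<open>Just after the hit the orbit is below the line, so the hitting time is the last one up
  to which it has stayed in the closed upper half plane. This gives uniqueness.\<close>

lemma hits_left_max: "hits_left p t \<Longrightarrow> (\<And>s. s \<in> {0..u} \<Longrightarrow> flow X s p $ 2 \<ge> 0) \<Longrightarrow> u \<le> t"
proof (rule ccontr)
  assume h: "hits_left p t" and u: "\<And>s. s \<in> {0..u} \<Longrightarrow> flow X s p $ 2 \<ge> 0" and "\<not> u \<le> t"
  then have "t < u" "0 \<le> t" "flow X t p $ 2 = 0" "flow X t p $ 1 < 0" by (auto simp: hits_left_def)
  then obtain d where d: "d > 0" "\<And>h. 0 < h \<Longrightarrow> h < d \<Longrightarrow> flow X h (flow X t p) $ 2 < 0"
    by (metis leaves_upper_on_left)
  define h where "h = min (d / 2) (u - t)"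
  have "flow X (h + t) p $ 2 < 0"
    using d \<open>t < u\<close> by (subst flow_add[OF rotating_lip]) (auto simp: h_def)
  moreover have "flow X (h + t) p $ 2 \<ge> 0"
    using d \<open>t < u\<close> \<open>0 \<le> t\<close> by (intro u) (auto simp: h_def min_def)
  ultimately show False by simp
qed

lemma hits_left_unique: "hits_left p t \<Longrightarrow> hits_left p u \<Longrightarrow> t = u"
  by (intro order_antisym) (auto intro: hits_left_max simp: hits_left_def)

text \<open>The bound is uniform in \<open>p\<close>: from the open half plane it takes at most
  \<open>pi / c\<close>, and a start on the positive half axis costs at most 1 more, the time
  allowed for entering the open half plane.\<close>

lemma hits_left_exists: "\<exists>B. \<forall>p. p \<noteq> 0 \<and> p $ 2 \<ge> 0 \<longrightarrow> (\<exists>t\<le>B. hits_left p t \<and> (\<forall>s\<in>{0<..<t}. flow X s p $ 2 > 0))"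
proof -
  obtain c where c: "c > 0" "\<And>p. c * (norm p)\<^sup>2 \<le> p $ 1 * X p $ 2 - p $ 2 * X p $ 1"
    using X unfolding rotating_def by blast
  have "\<exists>t\<le>pi / c + 1. hits_left p t \<and> (\<forall>s\<in>{0<..<t}. flow X s p $ 2 > 0)" if p: "p \<noteq> 0" "p $ 2 \<ge> 0" for p
  proof -
    consider "p $ 2 > 0" | "p $ 2 = 0" "p $ 1 > 0" | "p $ 2 = 0" "p $ 1 < 0"
      using p by (fastforce simp: eq_real2)
    then show ?thesis
    proof cases
      case 1
      then obtain t where t: "0 \<le> t" "t \<le> pi / c" "flow X t p $ 2 = 0" "flow X t p $ 1 < 0"
        "\<forall>s. 0 \<le> s \<and> s < t \<longrightarrow> flow X s p $ 2 > 0"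
        using upper_reaches_left_open[OF c] by blast
      have "flow X s p $ 2 \<ge> 0" if "s \<in> {0..t}" for s
        using t that by (cases "s = t") (auto intro: less_imp_le)
      then show ?thesis using t by (intro exI[of _ t]) (auto simp: hits_left_def)
    next
      case 2
      then obtain d where d: "d > 0" "\<And>h. 0 < h \<Longrightarrow> h < d \<Longrightarrow> flow X h p $ 2 > 0"
        by (metis enters_upper_on_right)
      define h where "h = min (d / 2) 1"
      have h: "0 < h" "h < d" "h \<le> 1" using d by (auto simp: h_def)
      then have "flow X h p $ 2 > 0" using d by blast
      then obtain t where t: "0 \<le> t" "t \<le> pi / c" "flow X t (flow X h p) $ 2 = 0" "flow X t (flow X h p) $ 1 < 0"
        "\<forall>s. 0 \<le> s \<and> s < t \<longrightarrow> flow X s (flow X h p) $ 2 > 0"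
        using upper_reaches_left_open[OF c] by blast
      have pos: "flow X s p $ 2 > 0" if "0 < s" "s < t + h" for s
        using t(5)[rule_format, of "s - h"] d(2)[of s] that h flow_add[OF rotating_lip, of "s - h" h p]
        by (cases "s < h") auto
      have e: "flow X (t + h) p $ 2 = 0" "flow X (t + h) p $ 1 < 0"
        using t by (simp_all add: flow_add[OF rotating_lip])
      have "flow X s p $ 2 \<ge> 0" if "s \<in> {0..t+h}" for s
        using pos[of s] that 2 e(1) by (cases "s = 0 \<or> s = t + h") (auto intro: less_imp_le)
      then show ?thesis using t h e pos by (intro exI[of _ "t + h"]) (auto simp: hits_left_def)
    next
      case 3
      then show ?thesis using c by (intro exI[of _ 0]) (auto simp: hits_left_def)
    qed
  qed
  then show ?thesis by blast
qed

definition time_left :: "real^2 \<Rightarrow> real" where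
  "time_left p = (THE t. hits_left p t)"

lemma time_left_eq: "hits_left p t \<Longrightarrow> time_left p = t"
  unfolding time_left_def by (rule the_equality) (auto intro: hits_left_unique)

lemma hits_left_time:
  assumes "p \<noteq> 0" "p $ 2 \<ge> 0"
  shows "hits_left p (time_left p)"
proof -
  obtain t where "hits_left p t" using hits_left_exists assms by blast
  then show ?thesis using time_left_eq by simp
qed

lemma time_left_bounded: "\<exists>B. \<forall>p. p \<noteq> 0 \<and> p $ 2 \<ge> 0 \<longrightarrow> 0 \<le> time_left p \<and> time_left p \<le> B"
proof -
  obtain B where B: "\<And>p. p \<noteq> 0 \<and> p $ 2 \<ge> 0 \<Longrightarrow> \<exists>t\<le>B. hits_left p t \<and> (\<forall>s\<in>{0<..<t}. flow X s p $ 2 > 0)"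
    using hits_left_exists by blast
  have "0 \<le> time_left p \<and> time_left p \<le> B" if p: "p \<noteq> 0 \<and> p $ 2 \<ge> 0" for p
  proof -
    obtain t where "t \<le> B" "hits_left p t" using B[OF p] by blast
    then show ?thesis using time_left_eq by (auto simp: hits_left_def)
  qed
  then show ?thesis by blast
qed

lemma upper_before_time_left:
  assumes "p \<noteq> 0" "p $ 2 \<ge> 0" "0 < s" "s < time_left p"
  shows "flow X s p $ 2 > 0"
proof -
  obtain B t where "hits_left p t" and pos: "\<forall>s\<in>{0<..<t}. flow X s p $ 2 > 0"
    using hits_left_exists assms(1,2) by blast
  then show ?thesis using time_left_eq[of p t] assms by auto
qed

text \<open>Hitting times are uniformly bounded, and limits of pairs satisfying
  \<open>hits_left\<close> satisfy it again, so the graph is closed.\<close>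

lemma continuous_time_left: "continuous_on {p. p \<noteq> 0 \<and> p $ 2 \<ge> 0} time_left"
proof (rule closed_graph_continuous_on)
  obtain B where B: "\<And>p. p \<noteq> 0 \<and> p $ 2 \<ge> 0 \<Longrightarrow> 0 \<le> time_left p \<and> time_left p \<le> B"
    using time_left_bounded by blast
  fix u :: "nat \<Rightarrow> real^2" and p assume u: "\<And>n. u n \<in> {p. p \<noteq> 0 \<and> p $ 2 \<ge> 0}"
  then have "range (\<lambda>n. time_left (u n)) \<subseteq> {0..B}" using B by auto
  then show "bounded (range (\<lambda>n. time_left (u n)))" by (rule bounded_subset[OF bounded_closed_interval])
next
  fix u :: "nat \<Rightarrow> real^2" and p t
  assume u: "\<And>n. u n \<in> {p. p \<noteq> 0 \<and> p $ 2 \<ge> 0}" and p: "p \<in> {p. p \<noteq> 0 \<and> p $ 2 \<ge> 0}"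
    and up: "u \<longlonglongrightarrow> p" and ut: "(\<lambda>n. time_left (u n)) \<longlonglongrightarrow> t"
  have h: "hits_left (u n) (time_left (u n))" for n using u[of n] hits_left_time by blast
  have lim: "(\<lambda>n. flow X (time_left (u n)) (u n) $ i) \<longlonglongrightarrow> flow X t p $ i" for i
    by (intro tendsto_intros tendsto_flow[OF rotating_lip] ut up)
  have "t \<ge> 0" by (rule LIMSEQ_le_const[OF ut]) (use h in \<open>auto simp: hits_left_def\<close>)
  moreover have y0: "flow X t p $ 2 = 0"
    using lim[of 2] h unfolding hits_left_def by (simp add: LIMSEQ_const_iff)
  moreover have "flow X t p $ 1 \<le> 0"
    by (rule LIMSEQ_le_const2[OF lim]) (use h in \<open>auto simp: hits_left_def less_imp_le\<close>)
  \<comment> \<open>This excludes equality in the preceding inequality, the only strict condition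
    that the limit could lose.\<close>
  moreover have "flow X t p \<noteq> 0" using rot_flow_eq_0 p by blast
  moreover have "flow X s p $ 2 \<ge> 0" if s: "s \<in> {0..t}" for s
  proof (cases "s = t")
    case False
    have "(\<lambda>n. flow X s (u n) $ 2) \<longlonglongrightarrow> flow X s p $ 2"
      by (intro tendsto_intros tendsto_flow[OF rotating_lip] up)
    moreover have "\<forall>\<^sub>F n in sequentially. s < time_left (u n)"
      using order_tendstoD(1)[OF ut, of s] s False by auto
    then have "\<forall>\<^sub>F n in sequentially. 0 \<le> flow X s (u n) $ 2"
      by (rule eventually_mono) (use h s in \<open>auto simp: hits_left_def\<close>)
    ultimately show ?thesis by (intro tendsto_lowerbound) auto
  qed (use y0 in simp)
  ultimately have "hits_left p t" unfolding hits_left_def by (auto simp: eq_real2)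
  then show "t = time_left p" by (rule time_left_eq[symmetric])
qed

end

section \<open>Entry points and the half return map\<close>

text \<open>The abscissa at which the orbit entered the upper half plane. The backward time to the
  positive half axis is the forward time to the negative one for the mirrored field, and the norm of
  the point reached is its abscissa.\<close>

definition foot :: "vfield \<Rightarrow> real^2 \<Rightarrow> real" where
  "foot X p = norm (flow X (- time_left (mirror_field X) (mirror p)) p)"

definition upper_time :: "vfield \<Rightarrow> real \<Rightarrow> real" where
  "upper_time X s = time_left X (axis_point s)"

text \<open>The half return map: the orbit that enters at abscissa \<open>s\<close> leaves at minus
  this value.\<close>

definition exit_foot :: "vfield \<Rightarrow> real \<Rightarrow> real" where
  "exit_foot X s = norm (flow X (upper_time X s) (axis_point s))"

context
  fixes X :: vfield
  assumes X: "rotating X"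
begin

lemma foot_eq:
  assumes s: "s > 0" and t: "t \<ge> 0" and pos: "\<And>r. r \<in> {0..t} \<Longrightarrow> flow X r (axis_point s) $ 2 \<ge> 0"
  shows "foot X (flow X t (axis_point s)) = s"
proof -
  let ?p = "flow X t (axis_point s)"
  note lip = rotating_lip[OF X]
  have fl: "flow (mirror_field X) r (mirror ?p) = mirror (flow X (t - r) (axis_point s))" for r
    using flow_add[OF lip, of "- r" t "axis_point s"] by (simp add: flow_mirror_field[OF lip])
  have "hits_left (mirror_field X) (mirror ?p) t"
    unfolding hits_left_def[OF rotating_mirror[OF X]] fl
    using s t pos by (auto simp: rot_flow_0[OF X])
  then have "time_left (mirror_field X) (mirror ?p) = t" by (rule time_left_eq[OF rotating_mirror[OF X]])
  then show ?thesis using s by (simp add: foot_def flow_minus_cancel[OF lip])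
qed

lemma foot_props:
  assumes "p \<noteq> 0" "p $ 2 \<ge> 0"
  shows "foot X p > 0"
    and "\<exists>t\<in>{0..upper_time X (foot X p)}. p = flow X t (axis_point (foot X p))"
proof -
  let ?t = "time_left (mirror_field X) (mirror p)"
  note lip = rotating_lip[OF X] and Xm = rotating_mirror[OF X]
  have h: "hits_left (mirror_field X) (mirror p) ?t"
    by (rule hits_left_time[OF Xm]) (use assms in auto)
  let ?q = "flow X (- ?t) p"
  have q: "?q $ 2 = 0" "?q $ 1 > 0" and t: "?t \<ge> 0"
    and pos: "\<And>s. s \<in> {0..?t} \<Longrightarrow> flow X (- s) p $ 2 \<ge> 0"
    using h unfolding hits_left_def[OF Xm] flow_mirror_field[OF lip] by auto
  have qa: "?q = axis_point (?q $ 1)" using q(1) by (rule eq_axis_pointI)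
  then have "norm ?q = ?q $ 1" using q(2) by (metis abs_of_pos norm_axis_point)
  then have f: "?q = axis_point (foot X p)" using qa by (simp add: foot_def)
  show pos_foot: "foot X p > 0" using q(2) f by simp
  have p: "p = flow X ?t (axis_point (foot X p))" unfolding f[symmetric] by (simp add: flow_minus_cancel[OF lip])
  \<comment> \<open>The orbit stays in the closed upper half plane from its foot up to time
    \<open>?t\<close>, and the hitting time is the longest such time.\<close>
  have "?t \<le> upper_time X (foot X p)" unfolding upper_time_def
  proof (rule hits_left_max[OF X hits_left_time[OF X]])
    fix s assume s: "s \<in> {0..?t}"
    have "flow X s (axis_point (foot X p)) = flow X (- (?t - s)) p"
      unfolding f[symmetric] using flow_add[OF lip, of s "- ?t" p] by simp
    then show "0 \<le> flow X s (axis_point (foot X p)) $ 2" using pos[of "?t - s"] s by simp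
  qed (use pos_foot in auto)
  with p t show "\<exists>t\<in>{0..upper_time X (foot X p)}. p = flow X t (axis_point (foot X p))" by auto
qed

lemma continuous_foot: "continuous_on {p. p \<noteq> 0 \<and> p $ 2 \<ge> 0} (foot X)"
proof -
  have c: "continuous_on A mirror" for A
    by (intro linear_continuous_on bounded_linear_mirror)
  have "continuous_on {p. p \<noteq> 0 \<and> p $ 2 \<ge> 0} (\<lambda>p. time_left (mirror_field X) (mirror p))"
    by (rule continuous_on_compose2[OF continuous_time_left[OF rotating_mirror[OF X]] c]) auto
  then show ?thesis unfolding foot_def
    by (intro continuous_intros continuous_on_flow[OF rotating_lip[OF X]]) auto
qed

text \<open>Times spent above the line are bounded and the flow fixes the origin, so Lipschitz
  dependence on the initial point gives a linear bound. It is used for continuity of the equivalence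
  at the origin.\<close>

lemma foot_bound: "\<exists>C>0. \<forall>p. p \<noteq> 0 \<and> p $ 2 \<ge> 0 \<longrightarrow> foot X p \<le> C * norm p"
proof -
  obtain B where B: "\<And>p. p \<noteq> 0 \<and> p $ 2 \<ge> 0 \<Longrightarrow>
      0 \<le> time_left (mirror_field X) p \<and> time_left (mirror_field X) p \<le> B"
    using time_left_bounded[OF rotating_mirror[OF X]] by blast
  obtain L where L: "L > 0" "\<And>t p q. norm (flow X t p - flow X t q) \<le> exp (L * \<bar>t\<bar>) * norm (p - q)"
    using flow_dependence[OF rotating_lip[OF X]] by metis
  have "foot X p \<le> exp (L * B) * norm p" if "p \<noteq> 0 \<and> p $ 2 \<ge> 0" for p
  proof -
    let ?t = "time_left (mirror_field X) (mirror p)"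
    have t: "0 \<le> ?t" "?t \<le> B" using B[of "mirror p"] that by auto
    have "flow X r 0 = 0" for r using rot_flow_eq_0[OF X] by simp
    then have "foot X p \<le> exp (L * \<bar>- ?t\<bar>) * norm p" using L(2)[of "- ?t" p 0] by (simp add: foot_def)
    also have "\<dots> \<le> exp (L * B) * norm p" using t L(1) by (intro mult_right_mono) auto
    finally show ?thesis .
  qed
  then show ?thesis using exp_gt_zero by blast
qed

lemma upper_arc:
  assumes "s > 0"
  shows "upper_time X s > 0" "flow X (upper_time X s) (axis_point s) = axis_point (- exit_foot X s)"
    "exit_foot X s > 0" "\<And>t. 0 < t \<Longrightarrow> t < upper_time X s \<Longrightarrow> flow X t (axis_point s) $ 2 > 0"
    "\<And>t. t \<in> {0..upper_time X s} \<Longrightarrow> flow X t (axis_point s) $ 2 \<ge> 0"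
proof -
  let ?q = "flow X (upper_time X s) (axis_point s)"
  have h: "hits_left X (axis_point s) (upper_time X s)"
    unfolding upper_time_def by (rule hits_left_time[OF X]) (use assms in auto)
  then have q: "?q $ 2 = 0" "?q $ 1 < 0" and t: "0 \<le> upper_time X s"
    and nn: "\<And>t. t \<in> {0..upper_time X s} \<Longrightarrow> flow X t (axis_point s) $ 2 \<ge> 0"
    unfolding hits_left_def[OF X] by auto
  have "upper_time X s \<noteq> 0" using q assms by (auto simp: rot_flow_0[OF X])
  with t show "upper_time X s > 0" by simp
  have qa: "?q = axis_point (?q $ 1)" using q(1) by (rule eq_axis_pointI)
  then have "norm ?q = - ?q $ 1" using q(2) by (metis abs_of_neg norm_axis_point)
  then show "?q = axis_point (- exit_foot X s)" "exit_foot X s > 0"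
    using qa q(2) by (simp_all add: exit_foot_def)
  show "flow X t (axis_point s) $ 2 > 0" if "0 < t" "t < upper_time X s" for t
    by (rule upper_before_time_left[OF X]) (use that assms in \<open>auto simp: upper_time_def\<close>)
  show "flow X t (axis_point s) $ 2 \<ge> 0" if "t \<in> {0..upper_time X s}" for t using nn that .
qed

lemma foot_axis_point:
  assumes "s > 0"
  shows "foot X (axis_point s) = s" "foot X (axis_point (- exit_foot X s)) = s"
  using foot_eq[OF assms, of 0] foot_eq[OF assms, of "upper_time X s"] upper_arc[OF assms] assms
  by (simp_all add: rot_flow_0[OF X])

text \<open>The point \<open>axis_point (- u)\<close> must be the end of its upper arc, since inside
  the arc the second coordinate is positive and the arc begins on the other half axis.\<close>

lemma foot_left_axis:
  assumes "u > 0"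
  shows "exit_foot X (foot X (axis_point (- u))) = u"
proof -
  let ?s = "foot X (axis_point (- u))"
  have "?s > 0" using foot_props(1)[of "axis_point (- u)"] assms by simp
  obtain t where t: "t \<in> {0..upper_time X ?s}" "axis_point (- u) = flow X t (axis_point ?s)"
    using foot_props(2)[of "axis_point (- u)"] assms by auto
  have "t = upper_time X ?s"
  proof (rule ccontr)
    assume "t \<noteq> upper_time X ?s"
    moreover have "t \<noteq> 0"
    proof
      assume "t = 0"
      then have "axis_point (- u) $ 1 = axis_point ?s $ 1" using t(2) by (simp add: rot_flow_0[OF X])
      then show False using assms \<open>?s > 0\<close> by simp
    qed
    ultimately have "flow X t (axis_point ?s) $ 2 > 0"
      using t(1) by (intro upper_arc(4)[OF \<open>?s > 0\<close>]) auto
    then show False unfolding t(2)[symmetric] by simp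
  qed
  then show ?thesis using t(2)[symmetric] assms by (simp add: exit_foot_def)
qed

text \<open>The cosine of the polar angle along the upper arc that enters at
  \<open>s\<close>.\<close>

definition turn :: "real \<Rightarrow> real \<Rightarrow> real" where
  "turn s t = flow X t (axis_point s) $ 1 / norm (flow X t (axis_point s))"

text \<open>The derivative is minus the second coordinate times the angular momentum, divided by the
  cube of the norm; both factors are positive inside the arc.\<close>

lemma turn_decreasing:
  assumes s: "s > 0" and t: "0 \<le> t" "t < u" "u \<le> upper_time X s"
  shows "turn s u < turn s t"
proof -
  let ?g = "\<lambda>t. flow X t (axis_point s)"
  let ?f = "\<lambda>t. ?g t $ 1 / sqrt ((?g t $ 1)\<^sup>2 + (?g t $ 2)\<^sup>2)"
  have n: "norm p = sqrt ((p $ 1)\<^sup>2 + (p $ 2)\<^sup>2)" for p :: "real^2"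
    by (metis norm_real2 norm_ge_zero real_sqrt_unique)
  have nz: "?g t \<noteq> 0" for t using rot_flow_eq_0[OF X] s by simp
  have "?f u < ?f t"
  proof (rule DERIV_neg_imp_decreasing_open[OF t(2), where f = ?f])
    have "continuous_on {t..u} (\<lambda>t. ?g t $ 1 / norm (?g t))"
      by (intro continuous_intros flow_continuous_time[OF rotating_lip[OF X]]) (use nz in auto)
    then show "continuous_on {t..u} ?f" by (simp add: n)
    fix r assume r: "t < r" "r < u"
    have y: "?g r $ 2 > 0" using r t by (intro upper_arc(4)[OF s]) auto
    let ?x = "?g r $ 1" and ?y = "?g r $ 2" and ?a = "X (?g r) $ 1" and ?b = "X (?g r) $ 2"
    define R where "R = sqrt (?x\<^sup>2 + ?y\<^sup>2)"
    have R: "R > 0" "R\<^sup>2 = ?x\<^sup>2 + ?y\<^sup>2" using y by (auto simp: R_def sum_power2_gt_zero_iff)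
    have "((\<lambda>t. (?g t $ 1)\<^sup>2 + (?g t $ 2)\<^sup>2) has_real_derivative 2 * (?x * ?a + ?y * ?b)) (at r)"
      by (auto intro!: derivative_eq_intros rot_flow_deriv[OF X] simp: algebra_simps)
    moreover have divide_cancel: "inverse R / 2 * (2 * z) = z / R" for z
      by (simp add: inverse_eq_divide)
    moreover have "?x\<^sup>2 + ?y\<^sup>2 > 0" using y by (simp add: sum_power2_gt_zero_iff)
    ultimately have "((\<lambda>t. sqrt ((?g t $ 1)\<^sup>2 + (?g t $ 2)\<^sup>2)) has_real_derivative
        inverse R / 2 * (2 * (?x * ?a + ?y * ?b))) (at r)"
      unfolding R_def by (intro DERIV_chain2[OF DERIV_real_sqrt]) 
    also have "inverse R / 2 * (2 * (?x * ?a + ?y * ?b)) = (?x * ?a + ?y * ?b) / R"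
      using divide_cancel[of "?x * ?a + ?y * ?b"] .
    finally have dR: "((\<lambda>t. sqrt ((?g t $ 1)\<^sup>2 + (?g t $ 2)\<^sup>2)) has_real_derivative (?x * ?a + ?y * ?b) / R) (at r)" .
    have d: "(?f has_real_derivative (?a * R - ?x * ((?x * ?a + ?y * ?b) / R)) / R\<^sup>2) (at r)"
      using DERIV_divide[OF rot_flow_deriv[OF X, of "axis_point s" 1 r] dR] R(1)
      unfolding R_def[symmetric] power2_eq_square[of R] by blast
    have "?a * R - ?x * ((?x * ?a + ?y * ?b) / R) = (?a * R\<^sup>2 - ?x * (?x * ?a + ?y * ?b)) / R"
      using R(1) by (simp add: field_simps power2_eq_square)
    also have "\<dots> = ?y * (?a * ?y - ?x * ?b) / R"
      unfolding R(2) by (simp add: algebra_simps power2_eq_square)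
    finally have "(?a * R - ?x * ((?x * ?a + ?y * ?b) / R)) / R\<^sup>2 = ?y * (?a * ?y - ?x * ?b) / R ^ 3"
      by (simp add: power2_eq_square power3_eq_cube)
    also have "\<dots> < 0"
    proof -
      obtain c where c: "c > 0" "\<And>p. c * (norm p)\<^sup>2 \<le> p $ 1 * X p $ 2 - p $ 2 * X p $ 1"
        using X unfolding rotating_def by blast
      have "0 < c * (norm (?g r))\<^sup>2" using c nz by simp
      then have "?a * ?y - ?x * ?b < 0" using c(2)[of "?g r"] by (simp add: mult.commute)
      then show ?thesis using y R by (simp add: divide_neg_pos mult_pos_neg)
    qed
    finally show "\<exists>d. (?f has_real_derivative d) (at r) \<and> d < 0" using d by blast
  qed
  then show ?thesis by (simp add: turn_def n)
qed

end

section \<open>Sources below the switching line\<close>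

text \<open>The second sign condition makes the field point left on the lower vertical half axis.
  Together with the crossing condition it makes the third quadrant forward invariant and the fourth
  backward invariant.\<close>

definition lower_crossing :: "vfield \<Rightarrow> bool" where
  "lower_crossing F \<longleftrightarrow> globally_lipschitz F \<and> F 0 = 0 \<and>
     (\<forall>p. p $ 2 = 0 \<and> p $ 1 \<noteq> 0 \<longrightarrow> p $ 1 * F p $ 2 > 0) \<and>
     (\<forall>p. p $ 1 = 0 \<and> p $ 2 \<noteq> 0 \<longrightarrow> p $ 2 * F p $ 1 > 0)"

lemma lower_crossing_mirror:
  assumes F: "lower_crossing F"
  shows "lower_crossing (mirror_field F)"
proof -
  have 1: "p $ 1 * mirror_field F p $ 2 > 0" if "p $ 2 = 0 \<and> p $ 1 \<noteq> 0" for p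
  proof -
    have "mirror p $ 2 = 0 \<and> mirror p $ 1 \<noteq> 0" using that by simp
    then have "mirror p $ 1 * F (mirror p) $ 2 > 0" using F unfolding lower_crossing_def by blast
    then show ?thesis by (simp add: mirror_field_def)
  qed
  have 2: "p $ 2 * mirror_field F p $ 1 > 0" if "p $ 1 = 0 \<and> p $ 2 \<noteq> 0" for p
  proof -
    have "mirror p $ 1 = 0 \<and> mirror p $ 2 \<noteq> 0" using that by simp
    then have "mirror p $ 2 * F (mirror p) $ 1 > 0" using F unfolding lower_crossing_def by blast
    then show ?thesis by (simp add: mirror_field_def)
  qed
  from F 1 2 show ?thesis
    unfolding lower_crossing_def by (simp add: globally_lipschitz_mirror_field mirror_field_def)
qed

lemma first_nonneg_time:
  fixes y :: "real \<Rightarrow> real"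
  assumes c: "continuous_on {a..b} y" and "a \<le> b" "y a < 0" "y b \<ge> 0"
  obtains t where "a < t" "t \<le> b" "y t = 0" "\<And>s. a \<le> s \<Longrightarrow> s < t \<Longrightarrow> y s < 0"
proof -
  let ?A = "{a..b} \<inter> y -` {0..}"
  have "closed ?A" by (rule continuous_closed_preimage[OF c]) auto
  then have "compact ({a..b} \<inter> ?A)" by (intro compact_Int_closed) auto
  then have "compact ?A" by (simp add: Int_absorb1 Int_assoc[symmetric])
  moreover have "?A \<noteq> {}" using assms by auto
  ultimately obtain t where t: "t \<in> ?A" and min: "\<And>s. s \<in> ?A \<Longrightarrow> t \<le> s"
    using compact_attains_inf[of ?A] by blast
  have neg: "y s < 0" if "a \<le> s" "s < t" for s using min[of s] t that by force
  have "a < t" using t assms(3) by (cases "t = a") auto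
  have "continuous_on {a..t} y" using t by (intro continuous_on_subset[OF c]) auto
  then obtain x where x: "a \<le> x" "x \<le> t" "y x = 0"
    using IVT'[of y a 0 t] t \<open>a < t\<close> assms(3) by auto
  then have "x = t" using neg[of x] by force
  then show ?thesis using that[of t] \<open>a < t\<close> t x neg by auto
qed

context
  fixes F :: vfield
  assumes F: "lower_crossing F"
begin

lemma lc_lip: "globally_lipschitz F" and lc_0: "F 0 = 0"
  using F unfolding lower_crossing_def by blast+

lemma lc_axis: "p $ 2 = 0 \<Longrightarrow> p $ 1 \<noteq> 0 \<Longrightarrow> p $ 1 * F p $ 2 > 0"
  using F unfolding lower_crossing_def by blast

lemma lc_vert: "p $ 1 = 0 \<Longrightarrow> p $ 2 \<noteq> 0 \<Longrightarrow> p $ 2 * F p $ 1 > 0"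
  using F unfolding lower_crossing_def by blast

lemmas lc_flow_0 [simp] = flow_0[OF lc_lip]
lemmas lc_flow_deriv = flow_component_deriv[OF lc_lip]
lemmas lc_flow_eq_0 = flow_eq_0_iff[OF lc_lip lc_0]

lemma lc_cont: "continuous_on A (\<lambda>t. flow F t p $ i)"
  by (intro continuous_intros flow_continuous_time lc_lip)

text \<open>A first arrival on the negative half axis is impossible: the field points down there, so
  the orbit would have to come from above.\<close>

lemma first_hit_right:
  assumes "p $ 2 < 0" "0 \<le> t" "flow F t p $ 2 \<ge> 0"
  obtains u where "0 < u" "u \<le> t" "flow F u p $ 2 = 0" "flow F u p $ 1 > 0"
proof -
  obtain u where u: "0 < u" "u \<le> t" "flow F u p $ 2 = 0" "\<And>s. 0 \<le> s \<Longrightarrow> s < u \<Longrightarrow> flow F s p $ 2 < 0"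
    using first_nonneg_time[OF lc_cont[of _ p 2], of 0 t] assms by auto
  have "flow F u p $ 1 > 0"
  proof (rule ccontr)
    assume "\<not> flow F u p $ 1 > 0"
    moreover have "flow F u p \<noteq> 0" using assms lc_flow_eq_0 by auto
    ultimately have x: "flow F u p $ 1 < 0" using u by (auto simp: eq_real2)
    then have "F (flow F u p) $ 2 < 0" using lc_axis[OF u(3)] by (auto simp: zero_less_mult_iff)
    then obtain d where d: "d > 0" "\<forall>h>0. h < d \<longrightarrow> flow F (u - h) p $ 2 > flow F u p $ 2"
      using DERIV_neg_dec_left[OF lc_flow_deriv[of p 2 u]] by auto
    have "flow F (u - min (d / 2) u) p $ 2 > 0" using d u by (auto simp: min_def)
    moreover have "flow F (u - min (d / 2) u) p $ 2 < 0" using d u by (intro u(4)) auto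
    ultimately show False by simp
  qed
  with u show ?thesis by (intro that[of u])
qed

lemma third_quadrant_initially:
  assumes "p \<noteq> 0" "p $ 1 \<le> 0" "p $ 2 \<le> 0"
  obtains d where "d > 0" "\<And>h. 0 < h \<Longrightarrow> h < d \<Longrightarrow> flow F h p $ 1 < 0 \<and> flow F h p $ 2 < 0"
proof -
  have comp: "\<exists>d>0. \<forall>h. 0 < h \<and> h < d \<longrightarrow> flow F h p $ i < 0" if "p $ i < 0 \<or> p $ i = 0 \<and> F p $ i < 0" for i
    using that
  proof
    assume "p $ i < 0"
    moreover have "isCont (\<lambda>t. flow F t p $ i) 0" using DERIV_isCont[OF lc_flow_deriv] .
    ultimately have "\<forall>\<^sub>F t in at 0. flow F t p $ i < 0"
      unfolding isCont_def by (intro order_tendstoD(2)[of "\<lambda>t. flow F t p $ i" "p $ i"]) auto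
    then show ?thesis unfolding eventually_at by (auto simp: dist_real_def)
  next
    assume "p $ i = 0 \<and> F p $ i < 0"
    then show ?thesis using DERIV_neg_dec_right[OF lc_flow_deriv[of p i 0]] by auto
  qed
  have "p $ 1 < 0 \<or> p $ 1 = 0 \<and> F p $ 1 < 0"
    using assms lc_vert[of p] by (cases "p $ 1 = 0") (auto simp: zero_less_mult_iff eq_real2)
  from comp[OF this] obtain d1 where d1: "d1 > 0" "\<forall>h. 0 < h \<and> h < d1 \<longrightarrow> flow F h p $ 1 < 0" by blast
  have "p $ 2 < 0 \<or> p $ 2 = 0 \<and> F p $ 2 < 0"
    using assms lc_axis[of p] by (cases "p $ 2 = 0") (auto simp: zero_less_mult_iff eq_real2)
  from comp[OF this] obtain d2 where d2: "d2 > 0" "\<forall>h. 0 < h \<and> h < d2 \<longrightarrow> flow F h p $ 2 < 0" by blast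
  show ?thesis by (rule that[of "min d1 d2"]) (use d1 d2 in auto)
qed

text \<open>At the first time when the larger coordinate reaches zero, the vanishing coordinate has
  negative derivative, so it would have been positive just before.\<close>

lemma third_quadrant_invariant:
  assumes "p \<noteq> 0" "p $ 1 \<le> 0" "p $ 2 \<le> 0" "t > 0"
  shows "flow F t p $ 1 < 0 \<and> flow F t p $ 2 < 0"
proof (rule ccontr)
  assume not: "\<not> ?thesis"
  obtain d where d: "d > 0" "\<And>h. 0 < h \<Longrightarrow> h < d \<Longrightarrow> flow F h p $ 1 < 0 \<and> flow F h p $ 2 < 0"
    using third_quadrant_initially[OF assms(1-3)] by blast
  define a where "a = min (d / 2) (t / 2)"
  have a: "0 < a" "a < d" "a < t" using d assms by (auto simp: a_def min_def)
  let ?m = "\<lambda>t. max (flow F t p $ 1) (flow F t p $ 2)"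
  have "continuous_on {a..t} ?m" by (intro continuous_intros lc_cont)
  moreover have "?m a < 0" using d(2)[of a] a by simp
  moreover have "?m t \<ge> 0" using not by auto
  ultimately obtain u where u: "a < u" "u \<le> t" "?m u = 0" and neg: "\<And>s. a \<le> s \<Longrightarrow> s < u \<Longrightarrow> ?m s < 0"
    using first_nonneg_time[OF _ less_imp_le[OF a(3)], of ?m] by blast
  have nz: "flow F u p \<noteq> 0" using assms lc_flow_eq_0 by auto
  have contra: False if zero: "flow F u p $ i = 0" and neg_i: "F (flow F u p) $ i < 0" for i
  proof -
    obtain d where d: "d > 0" "\<forall>h>0. h < d \<longrightarrow> flow F (u - h) p $ i > flow F u p $ i"
      using DERIV_neg_dec_left[OF lc_flow_deriv[of p i u] neg_i] by auto
    have "flow F (u - min (d / 2) (u - a)) p $ i > 0" using d u zero by (auto simp: min_def)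
    moreover have "?m (u - min (d / 2) (u - a)) < 0" using d u by (intro neg) auto
    moreover have "i = 1 \<or> i = 2" using exhaust_2 by blast
    ultimately show False by auto
  qed
  show False
  proof (cases "flow F u p $ 2 = 0")
    case True
    then have "flow F u p $ 1 < 0" using u(3) nz by (auto simp: eq_real2 max_def split: if_splits)
    then have "F (flow F u p) $ 2 < 0" using lc_axis[OF True] by (auto simp: zero_less_mult_iff)
    then show False using contra[OF True] by simp
  next
    case False
    then have *: "flow F u p $ 1 = 0" "flow F u p $ 2 < 0" using u(3) by (auto simp: max_def split: if_splits)
    then have "F (flow F u p) $ 1 < 0" using lc_vert[of "flow F u p"] by (auto simp: zero_less_mult_iff)
    then show False using contra[OF *(1)] by simp
  qed
qed

end

context
  fixes F :: vfield
  assumes F: "lower_crossing F"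
begin

lemma first_hit_left_backward:
  assumes "p $ 2 < 0" "0 \<le> t" "flow F (- t) p $ 2 \<ge> 0"
  obtains u where "0 < u" "u \<le> t" "flow F (- u) p $ 2 = 0" "flow F (- u) p $ 1 < 0"
proof -
  have "flow (mirror_field F) t (mirror p) $ 2 \<ge> 0"
    using assms by (simp add: flow_mirror_field[OF lc_lip[OF F]])
  then obtain u where "0 < u" "u \<le> t" "flow (mirror_field F) u (mirror p) $ 2 = 0"
      "flow (mirror_field F) u (mirror p) $ 1 > 0"
    using first_hit_right[OF lower_crossing_mirror[OF F], of "mirror p" t] assms by auto
  then show ?thesis by (intro that[of u]) (simp_all add: flow_mirror_field[OF lc_lip[OF F]])
qed

lemma fourth_quadrant_invariant:
  assumes "p \<noteq> 0" "p $ 1 \<ge> 0" "p $ 2 \<le> 0" "t < 0"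
  shows "flow F t p $ 1 > 0 \<and> flow F t p $ 2 < 0"
  using third_quadrant_invariant[OF lower_crossing_mirror[OF F], of "mirror p" "- t"] assms
  by (simp add: flow_mirror_field[OF lc_lip[OF F]])

end

section \<open>The radius as a parameter along orbits of a source\<close>

definition source :: "vfield \<Rightarrow> bool" where
  "source Y \<longleftrightarrow> lower_crossing Y \<and> (\<exists>c>0. \<forall>p. c * (norm p)\<^sup>2 \<le> p \<bullet> Y p)"

text \<open>The point of the orbit of \<open>p\<close> at distance \<open>r\<close> from the origin;
  along a nonzero orbit of a source the norm takes each positive value exactly once.\<close>

definition on_sphere :: "vfield \<Rightarrow> real^2 \<Rightarrow> real \<Rightarrow> real^2" where
  "on_sphere Y p r = flow Y (THE t. norm (flow Y t p) = r) p"

context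
  fixes Y :: vfield
  assumes Y: "source Y"
begin

lemma source_lc: "lower_crossing Y"
  using Y unfolding source_def by blast

text \<open>The squared norm grows at relative rate at least \<open>2 * c\<close>, so it remains
  nondecreasing after multiplication by \<open>exp (- (2 * c * t))\<close>.\<close>

lemma norm_flow_growth:
  obtains c where "c > 0" "\<And>s t p. s \<le> t \<Longrightarrow> exp (c * (t - s)) * norm (flow Y s p) \<le> norm (flow Y t p)"
proof -
  obtain c where c: "c > 0" "\<And>p. c * (norm p)\<^sup>2 \<le> p \<bullet> Y p" using Y unfolding source_def by blast
  have "exp (c * (t - s)) * norm (flow Y s p) \<le> norm (flow Y t p)" if "s \<le> t" for s t p
  proof -
    let ?g = "\<lambda>t. flow Y t p"
    let ?f = "\<lambda>t. exp (- (2 * c * t)) * (?g t \<bullet> ?g t)"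
    have "?f s \<le> ?f t"
    proof (rule DERIV_nonneg_imp_nondecreasing[OF that, where f = ?f])
      fix x
      have "(?g has_vector_derivative Y (?g x)) (at x)" by (rule flow_deriv[OF lc_lip[OF source_lc]])
      then have "((\<lambda>t. ?g t \<bullet> ?g t) has_real_derivative 2 * (?g x \<bullet> Y (?g x))) (at x)"
        unfolding has_vector_derivative_def has_field_derivative_def
        by (auto intro!: derivative_eq_intros simp: inner_commute algebra_simps)
      then have "(?f has_real_derivative exp (- (2 * c * x)) * (2 * (?g x \<bullet> Y (?g x) - c * (norm (?g x))\<^sup>2))) (at x)"
        by (auto intro!: derivative_eq_intros simp: algebra_simps power2_norm_eq_inner)
      moreover have "exp (- (2 * c * x)) * (2 * (?g x \<bullet> Y (?g x) - c * (norm (?g x))\<^sup>2)) \<ge> 0"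
        using c(2)[of "?g x"] by simp
      ultimately show "\<exists>d. (?f has_real_derivative d) (at x) \<and> 0 \<le> d" by blast
    qed
    then have *: "exp (- (2 * c * s)) * (norm (?g s))\<^sup>2 \<le> exp (- (2 * c * t)) * (norm (?g t))\<^sup>2"
      by (simp add: power2_norm_eq_inner)
    have e: "exp (2 * c * t) * exp (- (2 * c * s)) = (exp (c * (t - s)))\<^sup>2"
      unfolding exp_double[symmetric] exp_add[symmetric] by (simp add: algebra_simps)
    have e1: "exp (2 * c * t) * exp (- (2 * c * t)) = 1" by (simp flip: exp_add)
    have "(exp (c * (t - s)))\<^sup>2 * (norm (?g s))\<^sup>2 \<le> (norm (?g t))\<^sup>2"
      using mult_left_mono[OF * exp_ge_zero[of "2 * c * t"]]
      unfolding mult.assoc[of "exp (2 * c * t)", symmetric] e e1 mult_1 .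
    then have "(exp (c * (t - s)) * norm (?g s))\<^sup>2 \<le> (norm (?g t))\<^sup>2"
      by (simp only: power_mult_distrib)
    then show ?thesis by (rule power2_le_imp_le) (rule norm_ge_zero)
  qed
  with c(1) show ?thesis by (rule that)
qed

lemma norm_flow_strict_mono:
  assumes "p \<noteq> 0" "s < t"
  shows "norm (flow Y s p) < norm (flow Y t p)"
proof -
  obtain c where c: "c > 0" "\<And>s t p. s \<le> t \<Longrightarrow> exp (c * (t - s)) * norm (flow Y s p) \<le> norm (flow Y t p)"
    using norm_flow_growth by metis
  have "norm (flow Y s p) > 0" using assms lc_flow_eq_0[OF source_lc] by simp
  moreover have "exp (c * (t - s)) > 1" using assms c by simp
  ultimately have "norm (flow Y s p) < exp (c * (t - s)) * norm (flow Y s p)" by simp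
  also have "\<dots> \<le> norm (flow Y t p)" using c assms by simp
  finally show ?thesis .
qed

lemma norm_flow_less_iff: "p \<noteq> 0 \<Longrightarrow> norm (flow Y s p) < norm (flow Y t p) \<longleftrightarrow> s < t"
  using norm_flow_strict_mono[of p] by (metis linorder_neqE_linordered_idom order_less_asym less_irrefl)

lemma norm_flow_eq_iff: "p \<noteq> 0 \<Longrightarrow> norm (flow Y s p) = norm (flow Y t p) \<longleftrightarrow> s = t"
  using norm_flow_strict_mono[of p] by (metis linorder_neqE_linordered_idom less_irrefl)

text \<open>Exponential growth bounds the time between two radii by the logarithm of their quotient.
  This is the local bound required by the closed graph argument in
  \<open>continuous_on_sphere\<close>.\<close>

lemma time_bound:
  obtains c where "c > 0" "\<And>t p. p \<noteq> 0 \<Longrightarrow> \<bar>t\<bar> \<le> \<bar>ln (norm (flow Y t p) / norm p)\<bar> / c"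
proof -
  obtain c where c: "c > 0" "\<And>s t p. s \<le> t \<Longrightarrow> exp (c * (t - s)) * norm (flow Y s p) \<le> norm (flow Y t p)"
    using norm_flow_growth by metis
  have "\<bar>t\<bar> \<le> \<bar>ln (norm (flow Y t p) / norm p)\<bar> / c" if "p \<noteq> 0" for t p
  proof -
    have pos: "norm p > 0" "norm (flow Y t p) > 0" using that lc_flow_eq_0[OF source_lc] by auto
    have "c * \<bar>t\<bar> \<le> \<bar>ln (norm (flow Y t p) / norm p)\<bar>"
    proof (cases "t \<ge> 0")
      case True
      have "exp (c * t) \<le> norm (flow Y t p) / norm p"
        using c(2)[OF True, of p] pos lc_flow_0[OF source_lc] by (simp add: le_divide_eq)
      then have "c * t \<le> ln (norm (flow Y t p) / norm p)" using pos by (simp add: ln_ge_iff)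
      then show ?thesis using True by simp
    next
      case False
      then have "exp (c * (- t)) \<le> norm p / norm (flow Y t p)"
        using c(2)[of t 0 p] pos lc_flow_0[OF source_lc] by (simp add: le_divide_eq)
      then have "c * (- t) \<le> ln (norm p / norm (flow Y t p))" using pos by (simp add: ln_ge_iff)
      also have "\<dots> = - ln (norm (flow Y t p) / norm p)" using pos by (simp add: ln_div)
      finally show ?thesis using False by simp
    qed
    then show ?thesis using c(1) by (simp add: field_simps)
  qed
  with c(1) show ?thesis by (rule that)
qed

lemma radius_attained:
  assumes "p \<noteq> 0" "r > 0"
  shows "\<exists>!t. norm (flow Y t p) = r"
proof -
  obtain d where d: "d > 0" "\<And>s t p. s \<le> t \<Longrightarrow> exp (d * (t - s)) * norm (flow Y s p) \<le> norm (flow Y t p)"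
    using norm_flow_growth by metis
  \<comment> \<open>Within this time, forward or backward, the guaranteed growth covers the quotient
    \<open>r / norm p\<close>.\<close>
  define T where "T = \<bar>ln (r / norm p)\<bar> / d"
  have T: "T \<ge> 0" using d by (simp add: T_def)
  have e: "exp (d * T) \<ge> r / norm p" "exp (- (d * T)) \<le> r / norm p"
  proof -
    have "r / norm p = exp (ln (r / norm p))" using assms by simp
    moreover have "ln (r / norm p) \<le> d * T" "- (d * T) \<le> ln (r / norm p)" using d by (auto simp: T_def)
    ultimately show "exp (d * T) \<ge> r / norm p" "exp (- (d * T)) \<le> r / norm p" by (metis exp_le_cancel_iff)+
  qed
  have "r \<le> norm (flow Y T p)"
    using d(2)[of 0 T p] e(1) T assms lc_flow_0[OF source_lc] by (simp add: divide_le_eq)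
  moreover have "norm (flow Y (- T) p) \<le> r"
  proof -
    have "exp (d * T) * norm (flow Y (- T) p) \<le> norm p"
      using d(2)[of "- T" 0 p] T lc_flow_0[OF source_lc] by simp
    then have "norm (flow Y (- T) p) \<le> exp (- (d * T)) * norm p" by (simp add: exp_minus field_simps)
    also have "\<dots> \<le> r" using e(2) assms by (simp add: le_divide_eq)
    finally show ?thesis .
  qed
  moreover have "continuous_on {- T..T} (\<lambda>t. norm (flow Y t p))"
    by (intro continuous_intros flow_continuous_time lc_lip source_lc)
  ultimately obtain t where "norm (flow Y t p) = r" using IVT'[of "\<lambda>t. norm (flow Y t p)" "- T" r T] T by auto
  then show ?thesis using norm_flow_eq_iff[OF assms(1)] by metis
qed

lemma on_sphere_flow:
  assumes "p \<noteq> 0"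
  shows "on_sphere Y p (norm (flow Y t p)) = flow Y t p"
proof -
  have "(THE s. norm (flow Y s p) = norm (flow Y t p)) = t"
    using norm_flow_eq_iff[OF assms] by (intro the_equality) auto
  then show ?thesis by (simp add: on_sphere_def)
qed

lemma on_sphere_obtain:
  assumes "p \<noteq> 0" "r > 0"
  obtains t where "on_sphere Y p r = flow Y t p" "norm (flow Y t p) = r"
  using radius_attained[OF assms] on_sphere_flow[OF assms(1)] by metis

lemma norm_on_sphere [simp]: "p \<noteq> 0 \<Longrightarrow> r > 0 \<Longrightarrow> norm (on_sphere Y p r) = r"
  using on_sphere_obtain by metis

lemma on_sphere_self: "p \<noteq> 0 \<Longrightarrow> on_sphere Y p (norm p) = p"
  using on_sphere_flow[of p 0] lc_flow_0[OF source_lc] by simp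

lemma on_sphere_of_flow: "p \<noteq> 0 \<Longrightarrow> r > 0 \<Longrightarrow> on_sphere Y (flow Y t p) r = on_sphere Y p r"
proof -
  assume p: "p \<noteq> 0" and r: "r > 0"
  obtain s where s: "on_sphere Y p r = flow Y s p" "norm (flow Y s p) = r" using on_sphere_obtain[OF p r] by metis
  have e: "flow Y (s - t) (flow Y t p) = flow Y s p" using flow_add[OF lc_lip[OF source_lc], of "s - t" t p] by simp
  have "flow Y t p \<noteq> 0" using lc_flow_eq_0[OF source_lc] p by simp
  from on_sphere_flow[OF this, of "s - t"] show ?thesis by (simp add: e s)
qed

lemma on_sphere_on_sphere: "p \<noteq> 0 \<Longrightarrow> r > 0 \<Longrightarrow> r' > 0 \<Longrightarrow> on_sphere Y (on_sphere Y p r) r' = on_sphere Y p r'"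
  using on_sphere_obtain[of p r] on_sphere_of_flow by metis

lemma continuous_on_sphere:
  "continuous_on {z. fst z \<noteq> 0 \<and> snd z > 0} (\<lambda>z. on_sphere Y (fst z) (snd z))"
proof -
  let ?S = "{z :: (real^2) \<times> real. fst z \<noteq> 0 \<and> snd z > 0}"
  let ?t = "\<lambda>z :: (real^2) \<times> real. THE t. norm (flow Y t (fst z)) = snd z"
  obtain c where c: "c > 0" "\<And>t p. p \<noteq> 0 \<Longrightarrow> \<bar>t\<bar> \<le> \<bar>ln (norm (flow Y t p) / norm p)\<bar> / c"
    using time_bound by metis
  have t: "norm (flow Y (?t z) (fst z)) = snd z" if "z \<in> ?S" for z
    using theI'[OF radius_attained[of "fst z" "snd z"]] that by simp
  have "continuous_on ?S ?t"
  proof (rule closed_graph_continuous_on)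
    fix u :: "nat \<Rightarrow> (real^2) \<times> real" and z assume u: "\<And>n. u n \<in> ?S" and z: "z \<in> ?S" and uz: "u \<longlonglongrightarrow> z"
    have uf: "(\<lambda>n. fst (u n)) \<longlonglongrightarrow> fst z" and us: "(\<lambda>n. snd (u n)) \<longlonglongrightarrow> snd z"
      using uz by (auto intro: tendsto_fst tendsto_snd)
    have "(\<lambda>n. \<bar>ln (snd (u n) / norm (fst (u n)))\<bar> / c) \<longlonglongrightarrow> \<bar>ln (snd z / norm (fst z))\<bar> / c"
      using z c by (intro tendsto_intros uf us) auto
    then have "bounded (range (\<lambda>n. \<bar>ln (snd (u n) / norm (fst (u n)))\<bar> / c))" by (rule convergent_imp_bounded)
    then obtain B where B: "\<And>n. \<bar>\<bar>ln (snd (u n) / norm (fst (u n)))\<bar> / c\<bar> \<le> B"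
      unfolding bounded_iff by auto
    have "\<bar>?t (u n)\<bar> \<le> B" for n
      using c(2)[of "fst (u n)" "?t (u n)"] t[OF u[of n]] B[of n] u[of n] c(1) by auto
    then show "bounded (range (\<lambda>n. ?t (u n)))" unfolding bounded_iff by auto
    fix s assume ts: "(\<lambda>n. ?t (u n)) \<longlonglongrightarrow> s"
    have "(\<lambda>n. norm (flow Y (?t (u n)) (fst (u n)))) \<longlonglongrightarrow> norm (flow Y s (fst z))"
      by (intro tendsto_intros tendsto_flow[OF lc_lip[OF source_lc]] ts uf)
    moreover have "(\<lambda>n. norm (flow Y (?t (u n)) (fst (u n)))) = (\<lambda>n. snd (u n))" using t[OF u] by auto
    ultimately have "norm (flow Y s (fst z)) = snd z" using us LIMSEQ_unique by metis
    then show "s = ?t z" using radius_attained[of "fst z" "snd z"] z t[OF z] by auto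
  qed
  then show ?thesis unfolding on_sphere_def
    by (intro continuous_on_flow[OF lc_lip[OF source_lc]] continuous_intros)
qed

lemma continuous_on_on_sphere [continuous_intros]:
  assumes "continuous_on A f" "continuous_on A g" "\<And>x. x \<in> A \<Longrightarrow> f x \<noteq> 0" "\<And>x. x \<in> A \<Longrightarrow> g x > 0"
  shows "continuous_on A (\<lambda>x. on_sphere Y (f x) (g x))"
  using continuous_on_compose2[OF continuous_on_sphere continuous_on_Pair[OF assms(1,2)]] assms(3,4)
  by (simp add: image_subset_iff)

end

section \<open>Orbit labels below the switching line\<close>

text \<open>An injective continuous function on an interval is monotone; since -1 is its least value
  and is taken at 1, \<open>f\<close> decreases and its supremum is its limit at 0. It will describe
  how the unit circle points of orbits through axis points sweep out an arc, up to an edge that none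
  of them attains.\<close>

lemma injective_to_edge:
  fixes f :: "real \<Rightarrow> real"
  assumes c: "continuous_on {0<..1} f" and inj: "inj_on f {0<..1}" and f1: "f 1 = -1"
    and bnd: "\<And>u. u \<in> {0<..1} \<Longrightarrow> -1 \<le> f u \<and> f u \<le> K"
  defines "w \<equiv> Sup (f ` {0<..1})"
  shows "\<And>u. u \<in> {0<..1} \<Longrightarrow> f u < w" "\<And>y. -1 \<le> y \<Longrightarrow> y < w \<Longrightarrow> \<exists>u\<in>{0<..1}. f u = y"
    "continuous_on {0..1} (\<lambda>u. if u = 0 then w else f u)"
proof -
  have ba: "bdd_above (f ` {0<..1})" using bnd by (intro bdd_aboveI2[of _ _ K]) auto
  have dec: "f b < f a" if ab: "0 < a" "a < b" "b \<le> 1" for a b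
  proof (cases "b = 1")
    case True
    have "f a \<noteq> f 1" using inj_onD[OF inj, of a 1] ab by auto
    then show ?thesis using bnd[of a] ab f1 True by auto
  next
    case False
    have "continuous_on {a..1} f" using ab by (intro continuous_on_subset[OF c]) auto
    moreover have "inj_on f {a..1}" using ab by (intro inj_on_subset[OF inj]) auto
    ultimately have "(f a < f b \<and> f b < f 1) \<or> (f 1 < f b \<and> f b < f a)"
      using continuous_inj_imp_mono[of a b 1 f] ab False by auto
    then show ?thesis using bnd[of b] f1 ab by auto
  qed
  show lt: "f u < w" if u: "u \<in> {0<..1}" for u
  proof -
    have "f u < f (u / 2)" using dec[of "u / 2" u] u by auto
    also have "\<dots> \<le> w" unfolding w_def using u by (intro cSUP_upper ba) auto
    finally show ?thesis .
  qed
  have approach: "\<exists>u\<in>{0<..1}. y < f u" if y: "y < w" for y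
    using less_cSUP_iff[OF _ ba, of y] y unfolding w_def by auto
  show "\<exists>u\<in>{0<..1}. f u = y" if y: "-1 \<le> y" "y < w" for y
  proof -
    obtain a where a: "a \<in> {0<..1}" "y < f a" using approach[OF y(2)] by blast
    have "continuous_on {a..1} f" using a by (intro continuous_on_subset[OF c]) auto
    then obtain u where "a \<le> u" "u \<le> 1" "f u = y" using IVT2'[of f 1 y a] a y f1 by auto
    then show ?thesis using a by (intro bexI[of _ u]) auto
  qed
  show "continuous_on {0..1} (\<lambda>u. if u = 0 then w else f u)"
    unfolding continuous_on_def
  proof
    fix x :: real assume x: "x \<in> {0..1}"
    let ?h = "\<lambda>u. if u = 0 then w else f u"
    show "(?h \<longlongrightarrow> ?h x) (at x within {0..1})"
    proof (cases "x = 0")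
      case True
      have "(?h \<longlongrightarrow> w) (at 0 within {0..1})"
      proof (rule order_tendstoI)
        fix y assume "y < w"
        then obtain a where a: "a \<in> {0<..1}" "y < f a" using approach by blast
        have h: "y < ?h u" if "u \<in> {0..1}" "dist u 0 < a" for u
          using that a dec[of u a] \<open>y < w\<close> by (cases "u = 0") (auto simp: dist_real_def)
        then show "\<forall>\<^sub>F u in at 0 within {0..1}. y < ?h u"
          unfolding eventually_at using a(1) h by (intro exI[of _ a] conjI ballI impI) (simp, blast)
      next
        fix y assume "w < y"
        then have h: "?h u < y" if "u \<in> {0..1}" for u
          using that lt[of u] by (cases "u = 0") auto
        show "\<forall>\<^sub>F u in at 0 within {0..1}. ?h u < y"
          unfolding eventually_at using h by (intro exI[of _ 1] conjI ballI impI) (simp, blast)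
      qed
      then show ?thesis using True by simp
    next
      case False
      then have "x > 0" using x by simp
      have "(f \<longlongrightarrow> f x) (at x within {0<..1})"
        using c x \<open>x > 0\<close> unfolding continuous_on_def by auto
      moreover have "at x within {0<..1} = at x within {0..1}"
        by (rule at_within_nhd[of _ "{0<..}"]) (use \<open>x > 0\<close> in auto)
      ultimately have "(f \<longlongrightarrow> f x) (at x within {0..1})" by simp
      then have "(?h \<longlongrightarrow> f x) (at x within {0..1})"
        by (rule Lim_transform_within[OF _ \<open>x > 0\<close>]) (auto simp: dist_real_def)
      then show ?thesis using False by simp
    qed
  qed
qed

section \<open>A chart by orbit label and radius\<close>

definition semicircle :: "real \<Rightarrow> real^2" where
  "semicircle x = vector [x, - sqrt (1 - x\<^sup>2)]"

lemma semicircle_nth [simp]: "semicircle x $ 1 = x" "semicircle x $ 2 = - sqrt (1 - x\<^sup>2)"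
  by (simp_all add: semicircle_def vector_2)

lemma eq_semicircle:
  assumes "norm p = 1" "p $ 2 \<le> 0"
  shows "p = semicircle (p $ 1)"
proof -
  have "(p $ 2)\<^sup>2 = 1 - (p $ 1)\<^sup>2" using norm_real2[of p] assms by simp
  then have "- p $ 2 = sqrt (1 - (p $ 1)\<^sup>2)" using assms(2) by (intro real_sqrt_unique[symmetric]) auto
  then show ?thesis by (simp add: eq_real2)
qed

lemma norm_semicircle:
  assumes "\<bar>x\<bar> \<le> 1"
  shows "norm (semicircle x) = 1"
proof -
  have "x\<^sup>2 \<le> 1" using assms by (simp add: abs_square_le_1)
  then have "(norm (semicircle x))\<^sup>2 = 1\<^sup>2" by (simp add: norm_real2)
  then show ?thesis by (rule power2_eq_imp_eq) auto
qed

lemma continuous_on_semicircle [continuous_intros]: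
  assumes "continuous_on A f"
  shows "continuous_on A (\<lambda>x. semicircle (f x))"
proof -
  have "semicircle y = y *\<^sub>R vector [1, 0] + (- sqrt (1 - y\<^sup>2)) *\<^sub>R vector [0, 1]" for y
    by (simp add: eq_real2 vector_2)
  then show ?thesis using assms by (simp only:) (intro continuous_intros)
qed

lemma norm_1_component: "norm p = 1 \<Longrightarrow> \<bar>p $ i\<bar> \<le> 1" for p :: "real^2"
  using component_le_norm_cart[of p i] by simp

text \<open>The abscissa on the lower unit semicircle approached by the orbits entering at
  \<open>- u\<close> as \<open>u\<close> tends to 0: the left boundary of the trapped
  orbits.\<close>

definition left_edge :: "vfield \<Rightarrow> real" where
  "left_edge Y = Sup ((\<lambda>u. on_sphere Y (axis_point (- u)) 1 $ 1) ` {0<..1})"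

text \<open>Orbits leaving at \<open>1 / u\<close> approach this edge as \<open>u\<close> tends to
  0, that is, as the exit moves to infinity. The signs make \<open>injective_to_edge\<close>
  applicable on this side as well.\<close>

definition right_edge :: "vfield \<Rightarrow> real" where
  "right_edge Y = - Sup ((\<lambda>u. - on_sphere Y (axis_point (1 / u)) 1 $ 1) ` {0<..1})"

text \<open>One real label for all orbits below the line: a negative \<open>l\<close> is the
  abscissa of entry, a label \<open>l > 1\<close> encodes the abscissa of exit as
  \<open>1 / (l - 1)\<close>, and from 0 to 1 the trapped orbits are numbered affinely between the
  two edges. Label 0 is the limit of entries close to the origin, label 1 that of exits far
  away.\<close>

definition orbit_rep :: "vfield \<Rightarrow> real \<Rightarrow> real^2" where
  "orbit_rep Y l = (if l < 0 then on_sphere Y (axis_point l) 1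
     else if l \<le> 1 then semicircle (left_edge Y + l * (right_edge Y - left_edge Y))
     else on_sphere Y (axis_point (1 / (l - 1))) 1)"

definition chart_point :: "vfield \<Rightarrow> real \<Rightarrow> real \<Rightarrow> real^2" where
  "chart_point Y l r = on_sphere Y (orbit_rep Y l) r"

text \<open>The radii that an orbit has in the closed lower half plane: at least the entry radius
  \<open>- l\<close> if it enters, at most the exit radius \<open>1 / (l - 1)\<close> if it leaves.
  The product form makes sense for all \<open>l\<close> and is a closed condition apart from
  \<open>r > 0\<close>.\<close>

definition chart_dom :: "real \<Rightarrow> real \<Rightarrow> bool" where
  "chart_dom l r \<longleftrightarrow> r > 0 \<and> - l \<le> r \<and> r * (l - 1) \<le> 1"

context
  fixes Y :: vfield
  assumes Y: "source Y"
begin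

lemma src_lc: "lower_crossing Y" and src_lip: "globally_lipschitz Y"
  using source_lc[OF Y] lc_lip by blast+

lemmas src_flow_0 [simp] = flow_0[OF src_lip]
lemmas src_flow_eq_0 [simp] = flow_eq_0_iff[OF src_lip lc_0[OF src_lc]]
lemmas src_flow_add = flow_add[OF src_lip]

lemma left_orbit:
  assumes "u > 0" "t \<ge> 0"
  shows "flow Y t (axis_point (- u)) $ 1 < 0" "flow Y t (axis_point (- u)) $ 2 \<le> 0"
    "flow Y t (axis_point (- u)) $ 2 = 0 \<longleftrightarrow> t = 0"
  using third_quadrant_invariant[OF src_lc, of "axis_point (- u)" t] assms
  by (cases "t = 0"; force)+

lemma right_orbit:
  assumes "u > 0" "t \<le> 0"
  shows "flow Y t (axis_point u) $ 1 > 0" "flow Y t (axis_point u) $ 2 \<le> 0"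
    "flow Y t (axis_point u) $ 2 = 0 \<longleftrightarrow> t = 0"
  using fourth_quadrant_invariant[OF src_lc, of "axis_point u" t] assms
  by (cases "t = 0"; force)+

text \<open>Otherwise one of the two axis points would lie in the strict future of the other, but
  after entering on the left an orbit does not meet the line again.\<close>

lemma left_orbit_inj:
  assumes "u > 0" "v > 0" "t \<ge> 0" "t' \<ge> 0" and eq: "flow Y t (axis_point (- u)) = flow Y t' (axis_point (- v))"
  shows "u = v"
proof -
  have *: "u = v" if "u > 0" "v > 0" "t \<le> t'" "0 \<le> t" and eq: "flow Y t (axis_point (- u)) = flow Y t' (axis_point (- v))"
    for u v t t'
  proof -
    have "axis_point (- u) = flow Y (- t) (flow Y t' (axis_point (- v)))"
      using flow_minus_cancel[OF src_lip] eq by metis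
    then have e: "axis_point (- u) = flow Y (t' - t) (axis_point (- v))"
      using src_flow_add[of "- t" t'] by simp
    then have "flow Y (t' - t) (axis_point (- v)) $ 2 = 0" by (metis axis_point_nth(2))
    then have "t' - t = 0" using left_orbit(3)[of v "t' - t"] that by simp
    then have "axis_point (- u) $ 1 = axis_point (- v) $ 1" using e by simp
    then show "u = v" by simp
  qed
  show ?thesis using *[of u v t t'] *[of v u t' t] assms by (cases "t \<le> t'") auto
qed

lemma right_orbit_inj:
  assumes "u > 0" "v > 0" "t \<le> 0" "t' \<le> 0" and eq: "flow Y t (axis_point u) = flow Y t' (axis_point v)"
  shows "u = v"
proof -
  have *: "u = v" if "u > 0" "v > 0" "t \<ge> t'" "0 \<ge> t" and eq: "flow Y t (axis_point u) = flow Y t' (axis_point v)"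
    for u v t t'
  proof -
    have "axis_point u = flow Y (- t) (flow Y t' (axis_point v))"
      using flow_minus_cancel[OF src_lip] eq by metis
    then have e: "axis_point u = flow Y (t' - t) (axis_point v)"
      using src_flow_add[of "- t" t'] by simp
    then have "flow Y (t' - t) (axis_point v) $ 2 = 0" by (metis axis_point_nth(2))
    then have "t' - t = 0" using right_orbit(3)[of v "t' - t"] that by simp
    then have "axis_point u $ 1 = axis_point v $ 1" using e by simp
    then show "u = v" by simp
  qed
  show ?thesis using *[of u v t' t] *[of v u t t'] assms by (cases "t \<ge> t'") auto
qed

lemma norm_flow_le_iff: "p \<noteq> 0 \<Longrightarrow> norm (flow Y s p) \<le> norm (flow Y t p) \<longleftrightarrow> s \<le> t"
  using norm_flow_less_iff[OF Y, of p t s] by (simp add: not_less[symmetric])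

lemma on_sphere_left:
  assumes "u > 0" "r \<ge> u"
  obtains t where "t \<ge> 0" "on_sphere Y (axis_point (- u)) r = flow Y t (axis_point (- u))" "t = 0 \<longleftrightarrow> r = u"
proof -
  obtain t where t: "on_sphere Y (axis_point (- u)) r = flow Y t (axis_point (- u))" "norm (flow Y t (axis_point (- u))) = r"
    using on_sphere_obtain[OF Y, of "axis_point (- u)" r] assms by auto
  have "t \<ge> 0" using norm_flow_le_iff[of "axis_point (- u)" 0 t] t assms by simp
  moreover have "t = 0 \<longleftrightarrow> r = u" using norm_flow_eq_iff[OF Y, of "axis_point (- u)" t 0] t assms by auto
  ultimately show ?thesis using t by (intro that[of t])
qed

lemma on_sphere_right:
  assumes "u > 0" "0 < r" "r \<le> u"
  obtains t where "t \<le> 0" "on_sphere Y (axis_point u) r = flow Y t (axis_point u)" "t = 0 \<longleftrightarrow> r = u"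
proof -
  obtain t where t: "on_sphere Y (axis_point u) r = flow Y t (axis_point u)" "norm (flow Y t (axis_point u)) = r"
    using on_sphere_obtain[OF Y, of "axis_point u" r] assms by auto
  have "t \<le> 0" using norm_flow_le_iff[of "axis_point u" t 0] t assms by simp
  moreover have "t = 0 \<longleftrightarrow> r = u" using norm_flow_eq_iff[OF Y, of "axis_point u" t 0] t assms by auto
  ultimately show ?thesis using t by (intro that[of t])
qed

text \<open>The third quadrant is invariant, so the unit circle point of an orbit that enters inside
  the closed unit disc determines the entry \<open>u\<close>; hence \<open>injective_to_edge\<close>
  applies.\<close>

lemma left_edge:
  defines "f \<equiv> \<lambda>u. on_sphere Y (axis_point (- u)) 1 $ 1"
  shows "\<And>u. u \<in> {0<..1} \<Longrightarrow> f u < left_edge Y"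
    "\<And>y. -1 \<le> y \<Longrightarrow> y < left_edge Y \<Longrightarrow> \<exists>u\<in>{0<..1}. f u = y"
    "continuous_on {0..1} (\<lambda>u. if u = 0 then left_edge Y else f u)"
    "\<And>u. u \<in> {0<..1} \<Longrightarrow> on_sphere Y (axis_point (- u)) 1 = semicircle (f u)"
    "-1 < left_edge Y" "left_edge Y \<le> 0"
proof -
  have c: "continuous_on {0<..1} f" unfolding f_def
    by (intro continuous_intros continuous_on_on_sphere[OF Y]) auto
  have pt: "on_sphere Y (axis_point (- u)) 1 = semicircle (f u) \<and> f u < 0 \<and> -1 \<le> f u" if u: "u \<in> {0<..1}" for u
  proof -
    obtain t where "t \<ge> 0" "on_sphere Y (axis_point (- u)) 1 = flow Y t (axis_point (- u))"
      using on_sphere_left[of u 1] u by auto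
    then have q: "on_sphere Y (axis_point (- u)) 1 $ 1 < 0" "on_sphere Y (axis_point (- u)) 1 $ 2 \<le> 0"
      using left_orbit u by auto
    have n: "norm (on_sphere Y (axis_point (- u)) 1) = 1" using norm_on_sphere[OF Y] u by simp
    then show ?thesis using q eq_semicircle[OF n q(2)] norm_1_component[OF n, of 1] by (simp add: f_def)
  qed
  have inj: "inj_on f {0<..1}"
  proof (rule inj_onI)
    fix u v assume uv: "u \<in> {0<..1}" "v \<in> {0<..1}" "f u = f v"
    then have "on_sphere Y (axis_point (- u)) 1 = on_sphere Y (axis_point (- v)) 1" using pt by simp
    moreover obtain t where "t \<ge> 0" "on_sphere Y (axis_point (- u)) 1 = flow Y t (axis_point (- u))"
      using on_sphere_left[of u 1] uv by auto
    moreover obtain t' where "t' \<ge> 0" "on_sphere Y (axis_point (- v)) 1 = flow Y t' (axis_point (- v))"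
      using on_sphere_left[of v 1] uv by auto
    ultimately show "u = v" using left_orbit_inj[of u v t t'] uv by auto
  qed
  have f1: "f 1 = -1" using on_sphere_self[OF Y, of "axis_point (- 1)"] by (simp add: f_def)
  have b: "-1 \<le> f u \<and> f u \<le> 0" if "u \<in> {0<..1}" for u using pt[OF that] by simp
  have e: "left_edge Y = Sup (f ` {0<..1})" by (simp add: left_edge_def f_def)
  note E = injective_to_edge[OF c inj f1 b, folded e]
  show "\<And>u. u \<in> {0<..1} \<Longrightarrow> f u < left_edge Y"
    "\<And>y. -1 \<le> y \<Longrightarrow> y < left_edge Y \<Longrightarrow> \<exists>u\<in>{0<..1}. f u = y"
    "continuous_on {0..1} (\<lambda>u. if u = 0 then left_edge Y else f u)"
    using E by blast+
  show "\<And>u. u \<in> {0<..1} \<Longrightarrow> on_sphere Y (axis_point (- u)) 1 = semicircle (f u)" using pt by blast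
  show "-1 < left_edge Y" using E(1)[of 1] f1 by simp
  show "left_edge Y \<le> 0" unfolding e using b by (intro cSUP_least) auto
qed

lemma right_edge:
  defines "f \<equiv> \<lambda>u. - on_sphere Y (axis_point (1 / u)) 1 $ 1"
  shows "\<And>u. u \<in> {0<..1} \<Longrightarrow> f u < - right_edge Y"
    "\<And>y. -1 \<le> y \<Longrightarrow> y < - right_edge Y \<Longrightarrow> \<exists>u\<in>{0<..1}. f u = y"
    "continuous_on {0..1} (\<lambda>u. if u = 0 then - right_edge Y else f u)"
    "\<And>u. u \<in> {0<..1} \<Longrightarrow> on_sphere Y (axis_point (1 / u)) 1 = semicircle (- f u)"
    "right_edge Y < 1" "0 < right_edge Y"
proof -
  have c: "continuous_on {0<..1} f" unfolding f_def
    by (intro continuous_intros continuous_on_on_sphere[OF Y]) auto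
  have pt: "on_sphere Y (axis_point (1 / u)) 1 = semicircle (- f u) \<and> f u < 0 \<and> -1 \<le> f u" if u: "u \<in> {0<..1}" for u
  proof -
    obtain t where "t \<le> 0" "on_sphere Y (axis_point (1 / u)) 1 = flow Y t (axis_point (1 / u))"
      using on_sphere_right[of "1 / u" 1] u by auto
    then have q: "on_sphere Y (axis_point (1 / u)) 1 $ 1 > 0" "on_sphere Y (axis_point (1 / u)) 1 $ 2 \<le> 0"
      using right_orbit[of "1 / u"] u by auto
    have n: "norm (on_sphere Y (axis_point (1 / u)) 1) = 1" using norm_on_sphere[OF Y] u by simp
    then show ?thesis using q eq_semicircle[OF n q(2)] norm_1_component[OF n, of 1] by (simp add: f_def)
  qed
  have inj: "inj_on f {0<..1}"
  proof (rule inj_onI)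
    fix u v assume uv: "u \<in> {0<..1}" "v \<in> {0<..1}" "f u = f v"
    then have "on_sphere Y (axis_point (1 / u)) 1 = on_sphere Y (axis_point (1 / v)) 1" using pt by simp
    moreover obtain t where "t \<le> 0" "on_sphere Y (axis_point (1 / u)) 1 = flow Y t (axis_point (1 / u))"
      using on_sphere_right[of "1 / u" 1] uv by auto
    moreover obtain t' where "t' \<le> 0" "on_sphere Y (axis_point (1 / v)) 1 = flow Y t' (axis_point (1 / v))"
      using on_sphere_right[of "1 / v" 1] uv by auto
    ultimately have "1 / u = 1 / v" using right_orbit_inj[of "1 / u" "1 / v" t t'] uv by auto
    then show "u = v" by simp
  qed
  have f1: "f 1 = -1" using on_sphere_self[OF Y, of "axis_point 1"] by (simp add: f_def)
  have b: "-1 \<le> f u \<and> f u \<le> 0" if "u \<in> {0<..1}" for u using pt[OF that] by simp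
  have e: "- right_edge Y = Sup (f ` {0<..1})" by (simp add: right_edge_def f_def)
  note E = injective_to_edge[OF c inj f1 b, folded e]
  show "\<And>u. u \<in> {0<..1} \<Longrightarrow> f u < - right_edge Y"
    "\<And>y. -1 \<le> y \<Longrightarrow> y < - right_edge Y \<Longrightarrow> \<exists>u\<in>{0<..1}. f u = y"
    "continuous_on {0..1} (\<lambda>u. if u = 0 then - right_edge Y else f u)"
    using E by blast+
  show "\<And>u. u \<in> {0<..1} \<Longrightarrow> on_sphere Y (axis_point (1 / u)) 1 = semicircle (- f u)" using pt by blast
  show "right_edge Y < 1" using E(1)[of 1] f1 by simp
  \<comment> \<open>The orbit through \<open>(0, -2)\<close> crosses the unit circle at a point with positive abscissa that lies on
    no orbit meeting the positive half axis.\<close>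
  define p :: "real^2" where "p = vector [0, - 2]"
  have p: "p $ 1 = 0" "p $ 2 = - 2" "p \<noteq> 0" by (simp_all add: p_def vector_2 eq_real2)
  have np: "norm p = 2" by (rule power2_eq_imp_eq) (simp_all add: norm_real2 p)
  obtain t where t: "on_sphere Y p 1 = flow Y t p" "norm (flow Y t p) = 1"
    using on_sphere_obtain[OF Y p(3), of 1] by auto
  have "t < 0" using norm_flow_less_iff[OF Y p(3), of t 0] t np by simp
  let ?q = "flow Y t p"
  have q: "?q $ 1 > 0" "?q $ 2 < 0" using fourth_quadrant_invariant[OF src_lc p(3) _ _ \<open>t < 0\<close>] p by auto
  have "- right_edge Y \<le> - ?q $ 1"
  proof (rule ccontr)
    assume "\<not> ?thesis"
    then have "- ?q $ 1 < - right_edge Y" by simp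
    moreover have "-1 \<le> - ?q $ 1" using norm_1_component[OF t(2), of 1] by auto
    ultimately obtain u where u: "u \<in> {0<..1}" "f u = - ?q $ 1" using E(2) by blast
    then have "on_sphere Y (axis_point (1 / u)) 1 = ?q"
      using pt[OF u(1)] eq_semicircle[OF t(2)] q by simp
    then have "on_sphere Y ?q 2 = on_sphere Y (axis_point (1 / u)) 2"
      using on_sphere_on_sphere[OF Y, of "axis_point (1 / u)" 1 2] u by simp
    moreover have "on_sphere Y ?q 2 = p"
      using on_sphere_of_flow[OF Y p(3), of 2 t] on_sphere_self[OF Y p(3)] np by simp
    ultimately obtain s where s: "p = flow Y s (axis_point (1 / u))"
      using on_sphere_obtain[OF Y, of "axis_point (1 / u)" 2] u by auto
    show False
    proof (cases "s \<le> 0")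
      case True
      then show False using right_orbit(1)[of "1 / u" s] u p s by simp
    next
      case False
      have "axis_point (1 / u) = flow Y (- s) p" using s flow_minus_cancel[OF src_lip] by simp
      then have "flow Y (- s) p $ 2 = 0" by (metis axis_point_nth(2))
      then show False using fourth_quadrant_invariant[OF src_lc p(3), of "- s"] p False by simp
    qed
  qed
  then show "0 < right_edge Y" using q by simp
qed

text \<open>As the norm increases, the orbit could meet the line only later on the positive half
  axis at distance at least 1, or earlier on the negative half axis at distance at most 1. Its unit
  circle point would then lie strictly beyond one of the edges.\<close>

lemma mid_orbit:
  assumes x: "left_edge Y \<le> x" "x \<le> right_edge Y"
  shows "flow Y t (semicircle x) $ 2 < 0"
proof -
  have x1: "\<bar>x\<bar> < 1" using x left_edge(5) right_edge(5) by auto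
  then have n: "norm (semicircle x) = 1" by (intro norm_semicircle) simp
  have x2: "x\<^sup>2 < 1" using x1 by (simp add: abs_square_less_1)
  then have neg: "semicircle x $ 2 < 0" by simp
  have nz: "semicircle x \<noteq> 0" using n by auto
  have sph: "on_sphere Y (flow Y s (semicircle x)) 1 = semicircle x" for s
    using on_sphere_of_flow[OF Y nz, of 1 s] on_sphere_self[OF Y nz] n by simp
  show ?thesis
  proof (rule ccontr)
    assume "\<not> ?thesis"
    then have nn: "flow Y t (semicircle x) $ 2 \<ge> 0" by simp
    show False
    proof (cases "t \<ge> 0")
      case True
      obtain u where u: "0 < u" "flow Y u (semicircle x) $ 2 = 0" "flow Y u (semicircle x) $ 1 > 0"
        using first_hit_right[OF src_lc neg True nn] by metis
      let ?s = "flow Y u (semicircle x) $ 1"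
      have a: "flow Y u (semicircle x) = axis_point ?s" by (rule eq_axis_pointI[OF u(2)])
      have "norm (flow Y u (semicircle x)) \<ge> 1" using norm_flow_le_iff[OF nz, of 0 u] u n by simp
      then have s: "?s \<ge> 1" using u(3) by (subst (asm) a) simp
      have "on_sphere Y (axis_point (1 / (1 / ?s))) 1 = semicircle x" using sph[of u] a by simp
      then have "- x < - right_edge Y" using right_edge(1)[of "1 / ?s"] s by simp
      then show False using x by simp
    next
      case False
      then obtain u where u: "0 < u" "flow Y (- u) (semicircle x) $ 2 = 0" "flow Y (- u) (semicircle x) $ 1 < 0"
        using first_hit_left_backward[OF src_lc neg, of "- t"] nn by (metis add.inverse_inverse le_cases neg_0_le_iff_le)
      let ?s = "- flow Y (- u) (semicircle x) $ 1"
      have a: "flow Y (- u) (semicircle x) = axis_point (- ?s)" using eq_axis_pointI[OF u(2)] by simp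
      have "norm (flow Y (- u) (semicircle x)) \<le> 1" using norm_flow_le_iff[OF nz, of "- u" 0] u n by simp
      then have s: "?s \<le> 1" using u(3) by (subst (asm) a) simp
      have "on_sphere Y (axis_point (- ?s)) 1 = semicircle x" using sph[of "- u"] a by simp
      then have "x < left_edge Y" using left_edge(1)[of ?s] s u(3) by simp
      then show False using x by simp
    qed
  qed
qed

lemma between_edges:
  assumes "0 \<le> l" "l \<le> 1"
  shows "left_edge Y \<le> left_edge Y + l * (right_edge Y - left_edge Y)"
    "left_edge Y + l * (right_edge Y - left_edge Y) \<le> right_edge Y"
proof -
  have w: "0 \<le> right_edge Y - left_edge Y" using left_edge(6) right_edge(6) by linarith
  have "0 \<le> l * (right_edge Y - left_edge Y)" using w assms by simp
  moreover have "l * (right_edge Y - left_edge Y) \<le> right_edge Y - left_edge Y"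
    by (rule mult_left_le_one_le[OF w assms])
  ultimately show "left_edge Y \<le> left_edge Y + l * (right_edge Y - left_edge Y)"
    "left_edge Y + l * (right_edge Y - left_edge Y) \<le> right_edge Y" by linarith+
qed

lemma orbit_rep_nz [simp]: "orbit_rep Y l \<noteq> 0"
proof (cases "0 \<le> l \<and> l \<le> 1")
  case True
  let ?q = "semicircle (left_edge Y + l * (right_edge Y - left_edge Y))"
  have "flow Y 0 ?q $ 2 < 0" using True by (intro mid_orbit between_edges) auto
  then have "?q \<noteq> 0" by (metis src_flow_0 zero_index less_irrefl)
  then show ?thesis using True by (simp add: orbit_rep_def)
next
  case False
  then have "norm (orbit_rep Y l) = 1"
    using norm_on_sphere[OF Y, of _ 1] by (auto simp: orbit_rep_def)
  then show ?thesis by auto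
qed

text \<open>Written in the variable \<open>- l\<close> to match the extended function whose
  continuity is \<open>left_edge(3)\<close>.\<close>

lemma orbit_rep_left: "-1 \<le> l \<Longrightarrow> l \<le> 0 \<Longrightarrow>
    orbit_rep Y l = semicircle (if - l = 0 then left_edge Y else on_sphere Y (axis_point (- (- l))) 1 $ 1)"
  using left_edge(4)[of "- l"] by (auto simp: orbit_rep_def)

lemma orbit_rep_right: "1 \<le> l \<Longrightarrow> l \<le> 2 \<Longrightarrow>
    orbit_rep Y l = semicircle (- (if l - 1 = 0 then - right_edge Y else - on_sphere Y (axis_point (1 / (l - 1))) 1 $ 1))"
  using right_edge(4)[of "l - 1"] by (auto simp: orbit_rep_def)

text \<open>Besides the changes of formula at 0 and 1 there are cuts at -1 and 2, since the edge
  lemmas only concern entries inside and exits outside the open unit disc, up to the circle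
  itself.\<close>

lemma continuous_orbit_rep: "continuous_on UNIV (orbit_rep Y)"
proof -
  have 1: "continuous_on {..-1} (orbit_rep Y)"
  proof -
    have "continuous_on {..-1} (\<lambda>l. on_sphere Y (axis_point l) 1)"
      by (intro continuous_intros continuous_on_on_sphere[OF Y]) auto
    then show ?thesis by (rule continuous_on_eq) (auto simp: orbit_rep_def)
  qed
  have 2: "continuous_on {-1..0} (orbit_rep Y)"
  proof -
    have "continuous_on {-1..0} (\<lambda>l. semicircle (if - l = 0 then left_edge Y else on_sphere Y (axis_point (- (- l))) 1 $ 1))"
      by (intro continuous_on_semicircle continuous_on_compose2[OF left_edge(3), of _ uminus] continuous_intros) auto
    then show ?thesis by (rule continuous_on_eq) (use orbit_rep_left in auto)
  qed
  have 3: "continuous_on {0..1} (orbit_rep Y)"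
  proof -
    have "continuous_on {0..1} (\<lambda>l. semicircle (left_edge Y + l * (right_edge Y - left_edge Y)))"
      by (intro continuous_intros)
    then show ?thesis by (rule continuous_on_eq) (auto simp: orbit_rep_def)
  qed
  have 4: "continuous_on {1..2} (orbit_rep Y)"
  proof -
    have "continuous_on {1..2} (\<lambda>l. semicircle (- (if l - 1 = 0 then - right_edge Y else - on_sphere Y (axis_point (1 / (l - 1))) 1 $ 1)))"
      by (intro continuous_on_semicircle continuous_on_minus continuous_on_compose2[OF right_edge(3), of _ "\<lambda>l. l - 1"] continuous_intros) auto
    then show ?thesis by (rule continuous_on_eq) (use orbit_rep_right in auto)
  qed
  have 5: "continuous_on {2..} (orbit_rep Y)"
  proof -
    have "continuous_on {2..} (\<lambda>l. on_sphere Y (axis_point (1 / (l - 1))) 1)"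
      by (intro continuous_intros continuous_on_on_sphere[OF Y]) auto
    then show ?thesis by (rule continuous_on_eq) (auto simp: orbit_rep_def)
  qed
  have "continuous_on ({..-1} \<union> ({-1..0} \<union> ({0..1} \<union> ({1..2} \<union> {2..})))) (orbit_rep Y)"
    by (intro continuous_on_closed_Un closed_Un 1 2 3 4 5) auto
  moreover have "{..-1} \<union> ({-1..0} \<union> ({0..1} \<union> ({1..2} \<union> {2..}))) = (UNIV :: real set)" by auto
  ultimately show ?thesis by simp
qed

lemma continuous_on_chart_point [continuous_intros]:
  assumes "continuous_on A f" "continuous_on A g" "\<And>x. x \<in> A \<Longrightarrow> g x > 0"
  shows "continuous_on A (\<lambda>x. chart_point Y (f x) (g x))"
  unfolding chart_point_def
  by (intro continuous_on_on_sphere[OF Y] continuous_on_compose2[OF continuous_orbit_rep] assms) auto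

lemma norm_chart_point [simp]: "r > 0 \<Longrightarrow> norm (chart_point Y l r) = r"
  by (simp add: chart_point_def norm_on_sphere[OF Y])

lemma chart_point_left:
  "u > 0 \<Longrightarrow> r > 0 \<Longrightarrow> chart_point Y (- u) r = on_sphere Y (axis_point (- u)) r"
  by (simp add: chart_point_def orbit_rep_def on_sphere_on_sphere[OF Y])

lemma chart_point_right:
  "l > 1 \<Longrightarrow> r > 0 \<Longrightarrow> chart_point Y l r = on_sphere Y (axis_point (1 / (l - 1))) r"
  by (simp add: chart_point_def orbit_rep_def on_sphere_on_sphere[OF Y])

lemma chart_point_cases:
  assumes "chart_dom l r"
  obtains (left) t where "l < 0" "t \<ge> 0" "chart_point Y l r = flow Y t (axis_point l)" "t = 0 \<longleftrightarrow> r = - l"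
  | (right) t where "l > 1" "t \<le> 0" "chart_point Y l r = flow Y t (axis_point (1 / (l - 1)))" "t = 0 \<longleftrightarrow> r * (l - 1) = 1"
  | (mid) "0 \<le> l" "l \<le> 1" "\<And>t. flow Y t (chart_point Y l r) $ 2 < 0"
      "on_sphere Y (chart_point Y l r) 1 = semicircle (left_edge Y + l * (right_edge Y - left_edge Y))"
proof -
  have r: "r > 0" "- l \<le> r" "r * (l - 1) \<le> 1" using assms by (auto simp: chart_dom_def)
  consider "l < 0" | "l > 1" | "0 \<le> l" "l \<le> 1" by linarith
  then show ?thesis
  proof cases
    case 1
    obtain t where "t \<ge> 0" "on_sphere Y (axis_point (- (- l))) r = flow Y t (axis_point (- (- l)))" "t = 0 \<longleftrightarrow> r = - l"
      using on_sphere_left[of "- l" r] 1 r by auto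
    then show ?thesis using 1 chart_point_left[of "- l" r] r by (intro left[of t]) auto
  next
    case 2
    then have "r \<le> 1 / (l - 1)" using r by (simp add: le_divide_eq)
    then obtain t where "t \<le> 0" "on_sphere Y (axis_point (1 / (l - 1))) r = flow Y t (axis_point (1 / (l - 1)))" "t = 0 \<longleftrightarrow> r = 1 / (l - 1)"
      using on_sphere_right[of "1 / (l - 1)" r] 2 r by auto
    then show ?thesis using 2 chart_point_right[of l r] r
      by (intro right[of t]) (auto simp: eq_divide_eq)
  next
    case 3
    let ?x = "left_edge Y + l * (right_edge Y - left_edge Y)"
    have x: "left_edge Y \<le> ?x" "?x \<le> right_edge Y"
      by (rule between_edges[OF 3])+
    have rep: "orbit_rep Y l = semicircle ?x" using 3 by (simp add: orbit_rep_def)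
    have "\<bar>?x\<bar> \<le> 1" using x left_edge(5) right_edge(5) by auto
    then have n: "norm (semicircle ?x) = 1" by (rule norm_semicircle)
    have nz: "semicircle ?x \<noteq> 0" using n by auto
    obtain s where s: "chart_point Y l r = flow Y s (semicircle ?x)"
      using on_sphere_obtain[OF Y nz r(1)] unfolding chart_point_def rep by metis
    have "on_sphere Y (chart_point Y l r) 1 = semicircle ?x"
      unfolding chart_point_def rep using on_sphere_on_sphere[OF Y nz r(1), of 1] on_sphere_self[OF Y nz] n by simp
    moreover have "flow Y t (chart_point Y l r) $ 2 < 0" for t
      unfolding s src_flow_add[symmetric] by (rule mid_orbit[OF x])
    ultimately show ?thesis using 3 by (intro mid)
  qed
qed

lemma chart_point_lower:
  assumes "chart_dom l r"
  shows "chart_point Y l r \<noteq> 0" "chart_point Y l r $ 2 \<le> 0"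
    "chart_point Y l r $ 2 = 0 \<longleftrightarrow> r = - l \<or> r * (l - 1) = 1"
proof -
  have r: "r > 0" using assms by (simp add: chart_dom_def)
  then show "chart_point Y l r \<noteq> 0" by (metis norm_chart_point norm_zero less_irrefl)
  from assms show "chart_point Y l r $ 2 \<le> 0" "chart_point Y l r $ 2 = 0 \<longleftrightarrow> r = - l \<or> r * (l - 1) = 1"
  proof (atomize (full), cases rule: chart_point_cases)
    case (left t)
    have "r * (l - 1) < 0" using left r by (simp add: mult_pos_neg)
    then show "chart_point Y l r $ 2 \<le> 0 \<and> (chart_point Y l r $ 2 = 0) = (r = - l \<or> r * (l - 1) = 1)"
      using left left_orbit[of "- l" t] by auto
  next
    case (right t)
    then show "chart_point Y l r $ 2 \<le> 0 \<and> (chart_point Y l r $ 2 = 0) = (r = - l \<or> r * (l - 1) = 1)"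
      using right_orbit[of "1 / (l - 1)" t] r by auto
  next
    case mid
    have "r * (l - 1) \<le> 0" using mid r by (simp add: mult_nonneg_nonpos)
    then show "chart_point Y l r $ 2 \<le> 0 \<and> (chart_point Y l r $ 2 = 0) = (r = - l \<or> r * (l - 1) = 1)"
      using mid(1,2) mid(3)[of 0] r by auto
  qed
qed

text \<open>The norm yields the radius. The three kinds of orbits are told apart by the sign of the
  abscissa and by whether the line is met; within a kind they are separated by their axis points or
  by their unit circle points.\<close>

lemma chart_point_inj:
  assumes d: "chart_dom l r" "chart_dom l' r'" and eq: "chart_point Y l r = chart_point Y l' r'"
  shows "l = l' \<and> r = r'"
proof -
  have "r = r'" using arg_cong[OF eq, of norm] d by (simp add: chart_dom_def)
  \<comment> \<open>Flowing back by \<open>t\<close> would bring a trapped orbit to the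
    line.\<close>
  have no_left: False if "l < 0" "t \<ge> 0" "p = flow Y t (axis_point l)" "\<And>t. flow Y t p $ 2 < 0" for l t p
    using that(3) that(4)[of "- t"] flow_minus_cancel[OF src_lip] by simp
  have no_right: False if "p = flow Y t (axis_point s)" "\<And>t. flow Y t p $ 2 < 0" for s t p
    using that(1) that(2)[of "- t"] flow_minus_cancel[OF src_lip] by simp
  have ww: "right_edge Y - left_edge Y \<noteq> 0" using left_edge(6) right_edge(6) by simp
  from d(1) have "l = l'"
  proof (cases rule: chart_point_cases)
    case (left t)
    from d(2) show ?thesis
    proof (cases rule: chart_point_cases)
      case (left t')
      then show ?thesis using left_orbit_inj[of "- l" "- l'" t t'] \<open>l < 0\<close> \<open>t \<ge> 0\<close> eq
          \<open>chart_point Y l r = flow Y t (axis_point l)\<close> by simp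
    next
      case (right t')
      then have "chart_point Y l' r' $ 1 > 0" using right_orbit(1)[of "1 / (l' - 1)" t'] by simp
      moreover have "chart_point Y l r $ 1 < 0" using left left_orbit(1)[of "- l" t] by simp
      ultimately show ?thesis using eq by simp
    next
      case mid
      then show ?thesis using no_left[OF left(1-3)] eq by simp
    qed
  next
    case (right t)
    from d(2) show ?thesis
    proof (cases rule: chart_point_cases)
      case (left t')
      then have "chart_point Y l' r' $ 1 < 0" using left_orbit(1)[of "- l'" t'] by simp
      moreover have "chart_point Y l r $ 1 > 0" using right right_orbit(1)[of "1 / (l - 1)" t] by simp
      ultimately show ?thesis using eq by simp
    next
      case r: (right t')
      then have "1 / (l - 1) = 1 / (l' - 1)"
        using right_orbit_inj[of "1 / (l - 1)" "1 / (l' - 1)" t t'] right eq by simp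
      then show ?thesis by simp
    next
      case mid
      then show ?thesis using no_right[OF right(3)] eq by simp
    qed
  next
    case mid
    from d(2) show ?thesis
    proof (cases rule: chart_point_cases)
      case (left t')
      then show ?thesis using no_left[OF left(1-3)] mid(3) eq by simp
    next
      case (right t')
      then show ?thesis using no_right[OF right(3)] mid(3) eq by simp
    next
      case m: mid
      have "semicircle (left_edge Y + l * (right_edge Y - left_edge Y)) $ 1 =
          semicircle (left_edge Y + l' * (right_edge Y - left_edge Y)) $ 1"
        using mid(4) m(4) eq by metis
      then show ?thesis using ww by simp
    qed
  qed
  with \<open>r = r'\<close> show ?thesis by blast
qed

text \<open>An orbit that meets the closed upper half plane does so later through the positive half
  axis or earlier through the negative one, and the axis point gives the label. Otherwise its unit
  circle point lies between the edges.\<close>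

lemma chart_point_surj:
  assumes p: "p \<noteq> 0" "p $ 2 \<le> 0"
  shows "\<exists>l. chart_dom l (norm p) \<and> chart_point Y l (norm p) = p"
proof -
  have np: "norm p > 0" using p by simp
  have self: "on_sphere Y q (norm p) = p" if "q = flow Y t p" for q t
    using on_sphere_of_flow[OF Y p(1) np, of t] on_sphere_self[OF Y p(1)] that by simp
  have L: ?thesis if t: "t \<ge> 0" and q: "flow Y (- t) p = axis_point (- u)" and u: "u > 0" for t u
  proof (intro exI[of _ "- u"] conjI)
    have "norm (flow Y (- t) p) \<le> norm (flow Y 0 p)" using norm_flow_le_iff[OF p(1), of "- t" 0] t by simp
    then have "u \<le> norm p" unfolding q using u by simp
    moreover have "norm p * (- u - 1) \<le> 0" using u by (intro mult_nonneg_nonpos) auto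
    ultimately show "chart_dom (- u) (norm p)" using u np by (simp add: chart_dom_def)
    show "chart_point Y (- u) (norm p) = p" using chart_point_left[OF u np] self[OF q[symmetric]] by simp
  qed
  have R: ?thesis if t: "t \<ge> 0" and q: "flow Y t p = axis_point s" and s: "s > 0" for t s
  proof (intro exI[of _ "1 + 1 / s"] conjI)
    have "norm (flow Y 0 p) \<le> norm (flow Y t p)" using norm_flow_le_iff[OF p(1), of 0 t] t by simp
    then have "norm p \<le> s" unfolding q using s by simp
    then have "norm p * (1 + 1 / s - 1) \<le> 1" using s by (simp add: divide_le_eq)
    moreover have "0 < 1 / s" using s by simp
    then have "- (1 + 1 / s) \<le> norm p" using np by linarith
    ultimately show "chart_dom (1 + 1 / s) (norm p)" using np unfolding chart_dom_def by blast
    show "chart_point Y (1 + 1 / s) (norm p) = p"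
      using chart_point_right[of "1 + 1 / s" "norm p"] self[OF q[symmetric]] s np by simp
  qed
  show ?thesis
  proof (cases "\<exists>t. flow Y t p $ 2 \<ge> 0")
    case True
    then obtain t where t: "flow Y t p $ 2 \<ge> 0" by blast
    consider "p $ 2 = 0" "p $ 1 > 0" | "p $ 2 = 0" "p $ 1 < 0" | "p $ 2 < 0" "t \<ge> 0" | "p $ 2 < 0" "t < 0"
      using p by (fastforce simp: eq_real2)
    then show ?thesis
    proof cases
      case 1
      then show ?thesis using R[of 0 "p $ 1"] eq_axis_pointI[of p] by simp
    next
      case 2
      then show ?thesis using L[of 0 "- p $ 1"] eq_axis_pointI[of p] by simp
    next
      case 3
      obtain u where "0 < u" "flow Y u p $ 2 = 0" "flow Y u p $ 1 > 0"
        using first_hit_right[OF src_lc 3 t] by metis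
      then show ?thesis using R[of u "flow Y u p $ 1"] eq_axis_pointI by simp
    next
      case 4
      obtain u where "0 < u" "flow Y (- u) p $ 2 = 0" "flow Y (- u) p $ 1 < 0"
        using first_hit_left_backward[OF src_lc 4(1), of "- t"] t 4 by (metis add.inverse_inverse less_imp_le neg_0_le_iff_le)
      then show ?thesis using L[of u "- flow Y (- u) p $ 1"] eq_axis_pointI[of "flow Y (- u) p"] by simp
    qed
  next
    case False
    then have neg: "flow Y t p $ 2 < 0" for t by (simp add: not_le)
    let ?q = "on_sphere Y p 1"
    obtain t where t: "?q = flow Y t p" using on_sphere_obtain[OF Y p(1), of 1] by auto
    have n: "norm ?q = 1" using norm_on_sphere[OF Y p(1)] by simp
    have q: "?q = semicircle (?q $ 1)" by (rule eq_semicircle[OF n]) (use neg[of t] t in simp)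
    define x where "x = ?q $ 1"
    have qx: "?q = semicircle x" using q by (simp add: x_def)
    \<comment> \<open>Points beyond an edge belong to orbits through the axis, which the present
      orbit never meets.\<close>
    have off: False if e: "on_sphere Y (axis_point s) 1 = ?q" and nz: "s \<noteq> 0" for s
    proof -
      obtain t' where "?q = flow Y t' (axis_point s)" using on_sphere_obtain[OF Y, of "axis_point s" 1] e nz by auto
      then have "axis_point s = flow Y (- t' + t) p" using t flow_minus_cancel[OF src_lip] src_flow_add by metis
      then show False using neg[of "- t' + t"] by (metis axis_point_nth(2) less_irrefl)
    qed
    have x1: "\<bar>x\<bar> \<le> 1" using norm_1_component[OF n, of 1] by (simp add: x_def)
    have xl: "left_edge Y \<le> x"
    proof (rule ccontr)
      assume "\<not> left_edge Y \<le> x"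
      then obtain u where u: "u \<in> {0<..1}" "on_sphere Y (axis_point (- u)) 1 $ 1 = x"
        using left_edge(2)[of x] x1 by (metis abs_le_D2 minus_le_iff not_le)
      then show False using off[of "- u"] left_edge(4)[OF u(1)] qx by simp
    qed
    have xr: "x \<le> right_edge Y"
    proof (rule ccontr)
      assume "\<not> x \<le> right_edge Y"
      then obtain u where u: "u \<in> {0<..1}" "- on_sphere Y (axis_point (1 / u)) 1 $ 1 = - x"
        using right_edge(2)[of "- x"] x1 by (metis abs_le_D1 neg_le_iff_le neg_less_iff_less not_le)
      then show False using off[of "1 / u"] right_edge(4)[OF u(1)] qx by simp
    qed
    define l where "l = (x - left_edge Y) / (right_edge Y - left_edge Y)"
    have w: "right_edge Y - left_edge Y > 0" using left_edge(6) right_edge(6) by simp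
    have l: "0 \<le> l" "l \<le> 1" "left_edge Y + l * (right_edge Y - left_edge Y) = x"
      using xl xr w by (simp_all add: l_def)
    have "norm p * (l - 1) \<le> 0" using l by (intro mult_nonneg_nonpos) auto
    moreover have "- l \<le> norm p" using l(1) np by linarith
    ultimately have "chart_dom l (norm p)" using np by (simp add: chart_dom_def)
    moreover have "orbit_rep Y l = ?q" using l qx by (simp add: orbit_rep_def)
    then have "chart_point Y l (norm p) = p" unfolding chart_point_def using self[OF t] by simp
    ultimately show ?thesis by blast
  qed
qed

end

section \<open>The label as a continuous function of the point\<close>

definition label :: "vfield \<Rightarrow> real^2 \<Rightarrow> real" where
  "label Y p = (THE l. chart_dom l (norm p) \<and> chart_point Y l (norm p) = p)"

context
  fixes Y :: vfield
  assumes Y: "source Y"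
begin

lemma label_props:
  assumes "p \<noteq> 0" "p $ 2 \<le> 0"
  shows "chart_dom (label Y p) (norm p)" "chart_point Y (label Y p) (norm p) = p"
proof -
  have "\<exists>!l. chart_dom l (norm p) \<and> chart_point Y l (norm p) = p"
  proof (rule ex_ex1I)
    show "\<exists>l. chart_dom l (norm p) \<and> chart_point Y l (norm p) = p"
      by (rule chart_point_surj[OF Y assms])
    fix l l' assume "chart_dom l (norm p) \<and> chart_point Y l (norm p) = p"
      "chart_dom l' (norm p) \<and> chart_point Y l' (norm p) = p"
    then show "l = l'" using chart_point_inj[OF Y, of l "norm p" l' "norm p"] by simp
  qed
  from theI'[OF this] show "chart_dom (label Y p) (norm p)" "chart_point Y (label Y p) (norm p) = p"
    unfolding label_def by blast+
qed

lemma label_chart_point: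
  assumes "chart_dom l r"
  shows "label Y (chart_point Y l r) = l"
proof -
  have r: "r > 0" using assms by (simp add: chart_dom_def)
  have n: "norm (chart_point Y l r) = r" using norm_chart_point[OF Y r] .
  let ?p = "chart_point Y l r"
  have "?p \<noteq> 0" "?p $ 2 \<le> 0" using chart_point_lower[OF Y assms] by auto
  from label_props[OF this] have "chart_dom (label Y ?p) r" "chart_point Y (label Y ?p) r = ?p"
    unfolding n by auto
  then show ?thesis using chart_point_inj[OF Y _ assms] by blast
qed

lemma chart_dom_bounds: "chart_dom l r \<Longrightarrow> - r \<le> l \<and> l \<le> 1 + 1 / r"
  unfolding chart_dom_def by (auto simp: field_simps)

text \<open>The condition \<open>chart_dom\<close> bounds the label in terms of the radius and is
  closed where the radius is positive; injectivity of the chart then identifies the limit.\<close>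

lemma continuous_label: "continuous_on {p. p \<noteq> 0 \<and> p $ 2 \<le> 0} (label Y)"
proof (rule closed_graph_continuous_on)
  fix u :: "nat \<Rightarrow> real^2" and p
  assume u: "\<And>n. u n \<in> {p. p \<noteq> 0 \<and> p $ 2 \<le> 0}" and p: "p \<in> {p. p \<noteq> 0 \<and> p $ 2 \<le> 0}" and up: "u \<longlonglongrightarrow> p"
  have d: "chart_dom (label Y (u n)) (norm (u n))" "chart_point Y (label Y (u n)) (norm (u n)) = u n" for n
    using label_props u[of n] by auto
  have n: "(\<lambda>n. norm (u n)) \<longlonglongrightarrow> norm p" by (intro tendsto_intros up)
  have "(\<lambda>n. norm (u n) + 1 + 1 / norm (u n)) \<longlonglongrightarrow> norm p + 1 + 1 / norm p"
    using p by (intro tendsto_intros n) auto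
  then have "bounded (range (\<lambda>n. norm (u n) + 1 + 1 / norm (u n)))" by (rule convergent_imp_bounded)
  then obtain B where B: "\<And>n. \<bar>norm (u n) + 1 + 1 / norm (u n)\<bar> \<le> B" unfolding bounded_iff by auto
  have "\<bar>label Y (u n)\<bar> \<le> B" for n
  proof -
    have "1 / norm (u n) \<ge> 0" "norm (u n) \<ge> 0" by simp_all
    then show ?thesis using chart_dom_bounds[OF d(1)[of n]] B[of n] by linarith
  qed
  then show "bounded (range (\<lambda>n. label Y (u n)))" unfolding bounded_iff by auto
  fix l assume l: "(\<lambda>n. label Y (u n)) \<longlonglongrightarrow> l"
  have "chart_dom l (norm p)" unfolding chart_dom_def
  proof (intro conjI)
    show "0 < norm p" using p by simp
    show "- l \<le> norm p" by (rule LIMSEQ_le[OF tendsto_minus[OF l] n]) (use d in \<open>auto simp: chart_dom_def\<close>)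
    have "(\<lambda>n. norm (u n) * (label Y (u n) - 1)) \<longlonglongrightarrow> norm p * (l - 1)" by (intro tendsto_intros n l)
    then show "norm p * (l - 1) \<le> 1" by (rule LIMSEQ_le_const2) (use d in \<open>auto simp: chart_dom_def\<close>)
  qed
  moreover have "chart_point Y l (norm p) = p"
  proof -
    have "continuous_on {z. snd z > 0} (\<lambda>z. chart_point Y (fst z) (snd z))"
      by (intro continuous_on_chart_point[OF Y] continuous_intros) auto
    then have "continuous_on ({z :: real \<times> real. snd z > 0}) (\<lambda>z. chart_point Y (fst z) (snd z))" .
    moreover have "open {z :: real \<times> real. snd z > 0}" by (intro open_Collect_less continuous_intros)
    ultimately have "isCont (\<lambda>z. chart_point Y (fst z) (snd z)) (l, norm p)"
      using p by (auto simp: continuous_on_eq_continuous_at)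
    from isCont_tendsto_compose[OF this tendsto_Pair[OF l n]]
    have "u \<longlonglongrightarrow> chart_point Y l (norm p)" using d(2) by simp
    then show ?thesis using up LIMSEQ_unique by blast
  qed
  ultimately show "l = label Y p" using label_chart_point by metis
qed

lemma label_left:
  assumes "u > 0" "t \<ge> 0"
  shows "label Y (flow Y t (axis_point (- u))) = - u"
proof -
  let ?q = "flow Y t (axis_point (- u))"
  have nz: "axis_point (- u) \<noteq> 0" using assms by simp
  have "norm (flow Y 0 (axis_point (- u))) \<le> norm ?q" using norm_flow_le_iff[OF Y nz] assms by simp
  then have n: "u \<le> norm ?q" using assms by (simp add: src_flow_0[OF Y])
  have "norm ?q * (- u - 1) \<le> 0" using assms by (intro mult_nonneg_nonpos) auto
  moreover have nq: "norm ?q > 0" using n assms by linarith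
  ultimately have "chart_dom (- u) (norm ?q)" using n by (simp add: chart_dom_def)
  moreover have "chart_point Y (- u) (norm ?q) = ?q"
    using chart_point_left[OF Y assms(1) nq] on_sphere_flow[OF Y nz, of t] by simp
  ultimately show ?thesis using label_chart_point by metis
qed

lemma label_right:
  assumes "s > 0" "t \<le> 0"
  shows "label Y (flow Y t (axis_point s)) = 1 + 1 / s"
proof -
  let ?q = "flow Y t (axis_point s)"
  have nz: "axis_point s \<noteq> 0" using assms by simp
  have q: "norm ?q > 0" using nz by (simp add: src_flow_eq_0[OF Y])
  have "norm ?q \<le> norm (flow Y 0 (axis_point s))" using norm_flow_le_iff[OF Y nz] assms by simp
  then have n: "norm ?q \<le> s" using assms by (simp add: src_flow_0[OF Y])
  have "norm ?q * (1 + 1 / s - 1) \<le> 1" using n assms by (simp add: divide_le_eq)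
  moreover have "0 < 1 / s" using assms by simp
  then have "- (1 + 1 / s) \<le> norm ?q" using q by linarith
  ultimately have "chart_dom (1 + 1 / s) (norm ?q)" using q unfolding chart_dom_def by blast
  moreover have "chart_point Y (1 + 1 / s) (norm ?q) = ?q"
    using chart_point_right[OF Y _ q, of "1 + 1 / s"] on_sphere_flow[OF Y nz, of t] assms by simp
  ultimately show ?thesis using label_chart_point by metis
qed

lemma label_mid:
  assumes neg: "\<And>t. flow Y t p $ 2 < 0"
  shows "0 \<le> label Y p" "label Y p \<le> 1" "label Y (flow Y t p) = label Y p"
proof -
  have p2: "p $ 2 < 0" using neg[of 0] by (simp add: src_flow_0[OF Y])
  then have p: "p \<noteq> 0" "p $ 2 \<le> 0" by auto
  note l = label_props[OF p]
  have np: "norm p > 0" using p by simp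
  have off: False if "p = flow Y t (axis_point s)" for t s
    using neg[of "- t"] that by (simp add: flow_minus_cancel[OF src_lip[OF Y]])
  have l01: "0 \<le> label Y p \<and> label Y p \<le> 1" using l(1)
  proof (cases rule: chart_point_cases[OF Y, consumes 1, case_names left right mid])
    case (left t) then show ?thesis using off l(2) by metis
  next
    case (right t) then show ?thesis using off l(2) by metis
  qed auto
  then show "0 \<le> label Y p" "label Y p \<le> 1" by auto
  have q: "norm (flow Y t p) > 0" using p by (simp add: src_flow_eq_0[OF Y])
  have "norm (flow Y t p) * (label Y p - 1) \<le> 0" using l01 by (intro mult_nonneg_nonpos) auto
  then have d: "chart_dom (label Y p) (norm (flow Y t p))" using l01 q
    unfolding chart_dom_def by linarith
  have "chart_point Y (label Y p) (norm (flow Y t p)) = on_sphere Y p (norm (flow Y t p))"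
    using on_sphere_on_sphere[OF Y orbit_rep_nz[OF Y] np q, of "label Y p"] l(2) by (simp add: chart_point_def)
  also have "\<dots> = flow Y t p" by (rule on_sphere_flow[OF Y p(1)])
  finally show "label Y (flow Y t p) = label Y p" using label_chart_point[OF d] by simp
qed

end

section \<open>The equivalence below the line\<close>

text \<open>The norm serves as a common clock: \<open>h t\<close> is the time at which the target
  orbit has radius \<open>norm (flow Y t p) + a\<close>. The set \<open>R\<close> collects the radii
  of the target piece, and \<open>x > a\<close> guarantees a positive radius on the source
  orbit.\<close>

lemma radius_reparam:
  assumes Y: "source Y" "source Y'" and p: "p \<noteq> 0" "q \<noteq> 0"
    and I: "\<And>t. t \<in> I \<longleftrightarrow> norm (flow Y t p) + a \<in> R" and I': "\<And>t. t \<in> I' \<longleftrightarrow> norm (flow Y' t q) \<in> R"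
    and R: "\<And>x. x \<in> R \<Longrightarrow> x > 0 \<and> x > a"
    and G: "\<And>t. t \<in> I \<Longrightarrow> G (flow Y t p) = on_sphere Y' q (norm (flow Y t p) + a)"
  shows "carries_onto G I (\<lambda>t. flow Y t p) I' (\<lambda>t. flow Y' t q)"
proof -
  define h where "h t = (THE t'. norm (flow Y' t' q) = norm (flow Y t p) + a)" for t
  have h: "norm (flow Y' (h t) q) = norm (flow Y t p) + a" if "t \<in> I" for t
    unfolding h_def using I[of t] R that by (intro theI'[OF radius_attained[OF Y(2) p(2)]]) auto
  show ?thesis unfolding carries_onto_def
  proof (intro exI[of _ h] conjI)
    show "strict_mono_on I h"
    proof (rule strict_mono_onI)
      fix s t assume st: "s \<in> I" "t \<in> I" "s < t"
      have "norm (flow Y' (h s) q) < norm (flow Y' (h t) q)"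
        using h[OF st(1)] h[OF st(2)] norm_flow_strict_mono[OF Y(1) p(1) st(3)] by simp
      then show "h s < h t" using norm_flow_less_iff[OF Y(2) p(2)] by simp
    qed
    show "h ` I = I'"
    proof (intro equalityI subsetI)
      fix x assume "x \<in> h ` I"
      then obtain t where "t \<in> I" "x = h t" by blast
      then show "x \<in> I'" using h[of t] I[of t] I'[of x] by simp
    next
      fix x assume x: "x \<in> I'"
      then have r: "norm (flow Y' x q) \<in> R" using I' by blast
      then have "norm (flow Y' x q) - a > 0" using R by force
      then obtain t where t: "norm (flow Y t p) = norm (flow Y' x q) - a"
        using radius_attained[OF Y(1) p(1)] by blast
      then have tI: "t \<in> I" using I r by simp
      moreover have "h t = x" using h[OF tI] t norm_flow_eq_iff[OF Y(2) p(2)] by simp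
      ultimately show "x \<in> h ` I" by blast
    qed
    show "\<forall>t\<in>I. G (flow Y t p) = flow Y' (h t) q"
      using G h on_sphere_flow[OF Y(2) p(2)] by metis
  qed
qed

text \<open>In the chart, an orbit entering through the left half axis at \<open>-u\<close> is sent to the one entering at
  \<open>-\<eta> u\<close>, and radii along it are shifted by \<open>\<eta> u - u\<close>. All other labels and radii are preserved.\<close>

definition lower_map :: "vfield \<Rightarrow> vfield \<Rightarrow> (real \<Rightarrow> real) \<Rightarrow> real^2 \<Rightarrow> real^2" where
  "lower_map Y Y' \<eta> p = (let l = label Y p; m = max (- l) 0 in
     chart_point Y' (max l 0 - \<eta> m) (norm p - m + \<eta> m))"

text \<open>Such an \<open>\<eta>\<close> prescribes where the points of the negative half axis go;
  it will be dictated by the upper half of the equivalence.\<close>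

definition axis_scaling :: "(real \<Rightarrow> real) \<Rightarrow> bool" where
  "axis_scaling \<eta> \<longleftrightarrow> continuous_on {0..} \<eta> \<and> \<eta> 0 = 0 \<and> (\<forall>u>0. \<eta> u > 0) \<and> inj_on \<eta> {0<..}"

context
  fixes Y Y' :: vfield and \<eta> :: "real \<Rightarrow> real"
  assumes Y: "source Y" and Y': "source Y'"
    and scaling: "axis_scaling \<eta>"
begin

lemma axis_scalingD:
  "continuous_on {0..} \<eta>" "\<eta> 0 = 0" "u > 0 \<Longrightarrow> \<eta> u > 0" "inj_on \<eta> {0<..}"
  using scaling unfolding axis_scaling_def by blast+

text \<open>For negative \<open>l\<close> the shift preserves the excess \<open>r + l\<close> over
  the entry radius.\<close>

lemma lower_map_dom:
  assumes "chart_dom l r"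
  shows "chart_dom (max l 0 - \<eta> (max (- l) 0)) (r - max (- l) 0 + \<eta> (max (- l) 0))"
proof (cases "l < 0")
  case True
  then have e: "\<eta> (- l) > 0" using axis_scalingD(3) by simp
  have r: "r + l \<ge> 0" using assms by (simp add: chart_dom_def)
  have "(r + l + \<eta> (- l)) * (- \<eta> (- l) - 1) \<le> 0" using e r by (intro mult_nonneg_nonpos) auto
  then show ?thesis using True e r by (simp add: chart_dom_def max_def)
next
  case False
  then show ?thesis using assms axis_scalingD(2) by (simp add: max_def)
qed

text \<open>Points of the line are those with equality in one of the two bounds of
  \<open>chart_dom\<close>, and the shift of label and radius preserves these equalities.\<close>

lemma lower_map_props:
  assumes p: "p \<noteq> 0" "p $ 2 \<le> 0"
  defines "l \<equiv> label Y p" and "m \<equiv> max (- label Y p) 0"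
  shows "norm (lower_map Y Y' \<eta> p) = norm p - m + \<eta> m" "label Y' (lower_map Y Y' \<eta> p) = max l 0 - \<eta> m"
    "lower_map Y Y' \<eta> p \<noteq> 0" "lower_map Y Y' \<eta> p $ 2 \<le> 0" "lower_map Y Y' \<eta> p $ 2 = 0 \<longleftrightarrow> p $ 2 = 0"
    "0 \<le> m" "m \<le> norm p"
proof -
  let ?l' = "max l 0 - \<eta> m" and ?r' = "norm p - m + \<eta> m"
  note lp = label_props[OF Y p, folded l_def]
  have eq: "lower_map Y Y' \<eta> p = chart_point Y' ?l' ?r'"
    by (simp add: lower_map_def Let_def l_def m_def)
  have d: "chart_dom ?l' ?r'" using lower_map_dom[OF lp(1)] by (simp add: l_def m_def)
  show "norm (lower_map Y Y' \<eta> p) = ?r'" "label Y' (lower_map Y Y' \<eta> p) = ?l'"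
    "lower_map Y Y' \<eta> p \<noteq> 0" "lower_map Y Y' \<eta> p $ 2 \<le> 0"
    unfolding eq using d norm_chart_point[OF Y'] label_chart_point[OF Y' d] chart_point_lower[OF Y' d]
    by (auto simp: chart_dom_def)
  have "p $ 2 = 0 \<longleftrightarrow> norm p = - l \<or> norm p * (l - 1) = 1"
    using chart_point_lower(3)[OF Y lp(1)] lp(2) by simp
  also have "\<dots> \<longleftrightarrow> ?r' = - ?l' \<or> ?r' * (?l' - 1) = 1"
  proof (cases "l < 0")
    case True
    then have ml: "m = - l" "max l 0 = 0" by (auto simp: m_def l_def)
    have e: "\<eta> m > 0" using axis_scalingD(3) True ml by simp
    have "norm p * (l - 1) \<le> 0" using True by (intro mult_nonneg_nonpos) auto
    moreover have "?r' * (?l' - 1) \<le> 0" using d e ml by (intro mult_nonneg_nonpos) (auto simp: chart_dom_def)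
    ultimately show ?thesis using ml by auto
  next
    case False
    then have "m = 0" "max l 0 = l" by (auto simp: m_def l_def)
    then show ?thesis using axis_scalingD(2) by simp
  qed
  also have "\<dots> \<longleftrightarrow> lower_map Y Y' \<eta> p $ 2 = 0"
    unfolding eq using chart_point_lower(3)[OF Y' d] by simp
  finally show "lower_map Y Y' \<eta> p $ 2 = 0 \<longleftrightarrow> p $ 2 = 0" by simp
  show "0 \<le> m" "m \<le> norm p" using lp(1) by (auto simp: m_def l_def chart_dom_def)
qed

lemma lower_map_inj:
  assumes p: "p \<noteq> 0" "p $ 2 \<le> 0" and q: "q \<noteq> 0" "q $ 2 \<le> 0"
    and eq: "lower_map Y Y' \<eta> p = lower_map Y Y' \<eta> q"
  shows "p = q"
proof -
  let ?m = "\<lambda>p. max (- label Y p) 0"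
  note P = lower_map_props[OF p] and Q = lower_map_props[OF q]
  have l: "max (label Y p) 0 - \<eta> (?m p) = max (label Y q) 0 - \<eta> (?m q)" using P(2) Q(2) eq by simp
  have r: "norm p - ?m p + \<eta> (?m p) = norm q - ?m q + \<eta> (?m q)" using P(1) Q(1) eq by simp
  have neg: "max (label Y x) 0 - \<eta> (?m x) = (if label Y x < 0 then - \<eta> (- label Y x) else label Y x)" for x
    using axis_scalingD(2) by (simp add: max_def)
  have "label Y p = label Y q"
  proof (cases "label Y p < 0 \<and> label Y q < 0")
    case True
    then have "\<eta> (- label Y p) = \<eta> (- label Y q)" using l unfolding neg by simp
    then show ?thesis using inj_onD[OF axis_scalingD(4), of "- label Y p" "- label Y q"] True by simp
  next
    case False
    then show ?thesis using l axis_scalingD(3)[of "- label Y p"] axis_scalingD(3)[of "- label Y q"] unfolding neg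
      by (auto split: if_splits)
  qed
  moreover from this r have "norm p = norm q" by simp
  ultimately show ?thesis using label_props(2)[OF Y p] label_props(2)[OF Y q] by metis
qed

lemma continuous_lower_map: "continuous_on {p. p \<noteq> 0 \<and> p $ 2 \<le> 0} (lower_map Y Y' \<eta>)"
proof -
  let ?S = "{p :: real^2. p \<noteq> 0 \<and> p $ 2 \<le> 0}"
  have m: "continuous_on ?S (\<lambda>p. max (- label Y p) 0)"
    by (intro continuous_intros continuous_label[OF Y])
  have e: "continuous_on ?S (\<lambda>p. \<eta> (max (- label Y p) 0))"
    by (rule continuous_on_compose2[OF axis_scalingD(1) m]) auto
  show ?thesis unfolding lower_map_def Let_def
  proof (intro continuous_on_chart_point[OF Y'] continuous_intros continuous_label[OF Y] e)
    fix p :: "real^2" assume "p \<in> ?S"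
    then have "chart_dom (label Y p) (norm p)" using label_props[OF Y] by blast
    from lower_map_dom[OF this] show "0 < norm p - max (- label Y p) 0 + \<eta> (max (- label Y p) 0)"
      by (simp add: chart_dom_def)
  qed
qed

lemma lower_map_left:
  assumes "u > 0" "t \<ge> 0"
  shows "lower_map Y Y' \<eta> (flow Y t (axis_point (- u))) =
    on_sphere Y' (axis_point (- \<eta> u)) (norm (flow Y t (axis_point (- u))) + (\<eta> u - u))"
proof -
  let ?q = "flow Y t (axis_point (- u))"
  have q: "?q \<noteq> 0" "?q $ 2 \<le> 0" using left_orbit[OF Y assms] assms by (auto simp: src_flow_eq_0[OF Y])
  have "norm (lower_map Y Y' \<eta> ?q) > 0" using lower_map_props(3)[OF q] by simp
  then have "norm ?q - u + \<eta> u > 0" using lower_map_props(1)[OF q] label_left[OF Y assms] assms by (simp add: max_def)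
  then show ?thesis unfolding lower_map_def Let_def label_left[OF Y assms]
    using assms chart_point_left[OF Y' axis_scalingD(3)[OF assms(1)], of "norm ?q - u + \<eta> u"] by (simp add: max_def algebra_simps)
qed

lemma lower_map_right:
  assumes "s > 0" "t \<le> 0"
  shows "lower_map Y Y' \<eta> (flow Y t (axis_point s)) = on_sphere Y' (axis_point s) (norm (flow Y t (axis_point s)) + 0)"
proof -
  let ?q = "flow Y t (axis_point s)"
  have q: "norm ?q > 0" using assms by (simp add: src_flow_eq_0[OF Y])
  have "0 < 1 / s" using assms by simp
  then have "max (1 + 1 / s) 0 = 1 + 1 / s" "max (- (1 + 1 / s)) 0 = 0" by linarith+
  then show ?thesis unfolding lower_map_def Let_def label_right[OF Y assms]
    using axis_scalingD(2) chart_point_right[OF Y' _ q, of "1 + 1 / s"] assms by simp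
qed

lemma lower_map_mid:
  assumes neg: "\<And>t. flow Y t p $ 2 < 0"
  shows "lower_map Y Y' \<eta> (flow Y t p) = on_sphere Y' (lower_map Y Y' \<eta> p) (norm (flow Y t p) + 0)"
proof -
  have "p $ 2 < 0" using neg[of 0] by (simp add: src_flow_0[OF Y])
  then have p: "p \<noteq> 0" by auto
  then have n: "norm p > 0" "norm (flow Y t p) > 0" by (simp_all add: src_flow_eq_0[OF Y])
  note l = label_mid[OF Y neg]
  have "max (label Y p) 0 = label Y p" "max (- label Y p) 0 = 0" using l(1) by simp_all
  then show ?thesis unfolding lower_map_def Let_def l(3)
    using axis_scalingD(2) on_sphere_on_sphere[OF Y' orbit_rep_nz[OF Y'] n] by (simp add: chart_point_def)
qed

lemma lower_map_axis:
  "s > 0 \<Longrightarrow> lower_map Y Y' \<eta> (axis_point s) = axis_point s"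
  "u > 0 \<Longrightarrow> lower_map Y Y' \<eta> (axis_point (- u)) = axis_point (- \<eta> u)"
proof -
  show "s > 0 \<Longrightarrow> lower_map Y Y' \<eta> (axis_point s) = axis_point s"
    using lower_map_right[of s 0] on_sphere_self[OF Y', of "axis_point s"] by (simp add: src_flow_0[OF Y])
  show "u > 0 \<Longrightarrow> lower_map Y Y' \<eta> (axis_point (- u)) = axis_point (- \<eta> u)"
    using lower_map_left[of u 0] on_sphere_self[OF Y', of "axis_point (- \<eta> u)"] axis_scalingD(3)[of u]
    by (simp add: src_flow_0[OF Y])
qed

text \<open>The shift \<open>\<eta> u - u\<close> takes entry radius to entry radius, and from there
  on the target orbit runs through all larger radii.\<close>

lemma carries_left:
  assumes u: "u > 0"
  shows "carries_onto (lower_map Y Y' \<eta>) {0..} (\<lambda>t. flow Y t (axis_point (- u))) {0..} (\<lambda>t. flow Y' t (axis_point (- \<eta> u)))"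
proof (rule radius_reparam[OF Y Y', where R = "{\<eta> u..}"])
  have e: "\<eta> u > 0" using u axis_scalingD(3) by blast
  have nz: "axis_point (- u) \<noteq> 0" "axis_point (- \<eta> u) \<noteq> 0" using u e by auto
  then show "axis_point (- u) \<noteq> 0" "axis_point (- \<eta> u) \<noteq> 0" .
  show "t \<in> {0..} \<longleftrightarrow> norm (flow Y t (axis_point (- u))) + (\<eta> u - u) \<in> {\<eta> u..}" for t
    using norm_flow_le_iff[OF Y nz(1), of 0 t] u by (auto simp: src_flow_0[OF Y])
  show "t \<in> {0..} \<longleftrightarrow> norm (flow Y' t (axis_point (- \<eta> u))) \<in> {\<eta> u..}" for t
    using norm_flow_le_iff[OF Y' nz(2), of 0 t] e by (auto simp: src_flow_0[OF Y'])
  show "x > 0 \<and> x > \<eta> u - u" if "x \<in> {\<eta> u..}" for x using that e u by auto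
qed (use lower_map_left[OF u] in simp)

lemma carries_right:
  assumes s: "s > 0"
  shows "carries_onto (lower_map Y Y' \<eta>) {..0} (\<lambda>t. flow Y t (axis_point s)) {..0} (\<lambda>t. flow Y' t (axis_point s))"
proof (rule radius_reparam[OF Y Y', where R = "{0<..s}"])
  have nz: "axis_point s \<noteq> 0" using s by auto
  show "axis_point s \<noteq> 0" "axis_point s \<noteq> 0" using s by auto
  show "t \<in> {..0} \<longleftrightarrow> norm (flow Y t (axis_point s)) + 0 \<in> {0<..s}" for t
    using norm_flow_le_iff[OF Y nz, of t 0] s by (auto simp: src_flow_0[OF Y] src_flow_eq_0[OF Y])
  show "t \<in> {..0} \<longleftrightarrow> norm (flow Y' t (axis_point s)) \<in> {0<..s}" for t
    using norm_flow_le_iff[OF Y' nz, of t 0] s by (auto simp: src_flow_0[OF Y'] src_flow_eq_0[OF Y'])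
qed (use lower_map_right[OF s] in simp_all)

lemma carries_mid:
  assumes neg: "\<And>t. flow Y t p $ 2 < 0"
  shows "carries_onto (lower_map Y Y' \<eta>) UNIV (\<lambda>t. flow Y t p) UNIV (\<lambda>t. flow Y' t (lower_map Y Y' \<eta> p))"
proof (rule radius_reparam[OF Y Y', where R = "{0<..}"])
  have "p $ 2 < 0" using neg[of 0] by (simp add: src_flow_0[OF Y])
  then have p: "p \<noteq> 0" "p $ 2 \<le> 0" by auto
  then show "p \<noteq> 0" by simp
  show q: "lower_map Y Y' \<eta> p \<noteq> 0" by (rule lower_map_props(3)[OF p])
  show "t \<in> UNIV \<longleftrightarrow> norm (flow Y t p) + 0 \<in> {0<..}" for t using p by (simp add: src_flow_eq_0[OF Y])
  show "t \<in> UNIV \<longleftrightarrow> norm (flow Y' t (lower_map Y Y' \<eta> p)) \<in> {0<..}" for t using q by (simp add: src_flow_eq_0[OF Y'])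
qed (use lower_map_mid[OF neg] in simp_all)

end

section \<open>The equivalence with the model\<close>

lemma continuous_on_at_origin:
  fixes f :: "'a::real_normed_vector \<Rightarrow> 'b::real_normed_vector"
  assumes c: "continuous_on (S - {0}) f" and f0: "f 0 = 0" and b: "\<And>p. p \<in> S \<Longrightarrow> norm (f p) \<le> K * norm p"
  shows "continuous_on S f"
  unfolding continuous_on_def
proof
  fix p assume p: "p \<in> S"
  show "(f \<longlongrightarrow> f p) (at p within S)"
  proof (cases "p = 0")
    case True
    have "((\<lambda>q. K * norm q) \<longlongrightarrow> K * norm (0::'a)) (at 0 within S)" by (intro tendsto_intros)
    then have "((\<lambda>q. K * norm q) \<longlongrightarrow> 0) (at 0 within S)" by simp
    moreover have "\<forall>\<^sub>F q in at 0 within S. norm (f q) \<le> K * norm q"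
      unfolding eventually_at_filter using b by (intro always_eventually) auto
    ultimately have "(f \<longlongrightarrow> 0) (at 0 within S)" by (rule Lim_null_comparison[rotated])
    then show ?thesis using True f0 by simp
  next
    case False
    then have "(f \<longlongrightarrow> f p) (at p within (S - {0}))" using c p unfolding continuous_on_def by blast
    moreover have "at p within (S - {0}) = at p within S"
      by (rule at_within_nhd[of _ "- {0}"]) (use False in auto)
    ultimately show ?thesis by simp
  qed
qed

section \<open>Gluing the two halves along the line\<close>

text \<open>The scaling forced on the negative half axis: the upper half of the equivalence keeps
  directions and takes the \<open>foot\<close> as norm, so it moves \<open>axis_point (- u)\<close>
  to minus its foot. The value at 0 is the continuous one.\<close>

definition left_shift :: "vfield \<Rightarrow> real \<Rightarrow> real" where
  "left_shift X u = (if u = 0 then 0 else foot X (axis_point (- u)))"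

definition glue_map :: "vfield \<Rightarrow> vfield \<Rightarrow> vfield \<Rightarrow> real^2 \<Rightarrow> real^2" where
  "glue_map X Y Y' p = (if p = 0 then 0
     else if p $ 2 \<ge> 0 then (foot X p / norm p) *\<^sub>R p
     else lower_map Y Y' (left_shift X) p)"

text \<open>On the negative half axis \<open>exit_foot X\<close> is a left inverse of the foot,
  which gives injectivity; \<open>foot_bound\<close> gives continuity at 0.\<close>

lemma
  assumes X: "rotating X"
  shows axis_scaling_left_shift: "axis_scaling (left_shift X)" and left_shift_bound: "\<exists>C\<ge>0. \<forall>u\<ge>0. left_shift X u \<le> C * u"
proof -
  have 0: "left_shift X 0 = 0" by (simp add: left_shift_def)
  have pos: "left_shift X u > 0" if "u > 0" for u
    using foot_props(1)[OF X, of "axis_point (- u)"] that by (simp add: left_shift_def)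
  obtain C where C: "C > 0" "\<And>p. p \<noteq> 0 \<and> p $ 2 \<ge> 0 \<Longrightarrow> foot X p \<le> C * norm p"
    using foot_bound[OF X] by blast
  have b: "left_shift X u \<le> C * u" if "u \<ge> 0" for u
    using C(2)[of "axis_point (- u)"] that by (simp add: left_shift_def)
  then show "\<exists>C\<ge>0. \<forall>u\<ge>0. left_shift X u \<le> C * u" using C(1) by (intro exI[of _ C]) auto
  have inj: "inj_on (left_shift X) {0<..}"
  proof (rule inj_onI)
    fix u v :: real assume "u \<in> {0<..}" "v \<in> {0<..}" "left_shift X u = left_shift X v"
    then have "u > 0" "v > 0" "foot X (axis_point (- u)) = foot X (axis_point (- v))"
      by (simp_all add: left_shift_def)
    then show "u = v" using foot_left_axis[OF X, of u] foot_left_axis[OF X, of v] by metis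
  qed
  have "continuous_on {0..} (left_shift X)"
  proof (rule continuous_on_at_origin[where f = "left_shift X" and K = C, OF _ 0])
    have "continuous_on ({0..} - {0}) (\<lambda>u. foot X (axis_point (- u)))"
      by (rule continuous_on_compose2[OF continuous_foot[OF X]]) (auto intro!: continuous_intros)
    then show "continuous_on ({0..} - {0}) (left_shift X)"
      by (rule continuous_on_eq) (simp add: left_shift_def)
    show "norm (left_shift X u) \<le> C * norm u" if "u \<in> {0..}" for u
      using b[of u] pos[of u] 0 that by (cases "u = 0") auto
  qed
  with 0 pos inj show "axis_scaling (left_shift X)" unfolding axis_scaling_def by blast
qed

lemma carries_onto_cong:
  assumes "carries_onto H I g J k" "\<And>t. t \<in> I \<Longrightarrow> H' (g' t) = H (g t)" "\<And>t. t \<in> J \<Longrightarrow> k' t = k t"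
  shows "carries_onto H' I g' J k'"
proof -
  obtain h where "strict_mono_on I h" "h ` I = J" "\<forall>t\<in>I. H (g t) = k (h t)"
    using assms(1) unfolding carries_onto_def by blast
  with assms(2,3) show ?thesis unfolding carries_onto_def by (intro exI[of _ h]) auto
qed

lemma carries_onto_shift:
  assumes "carries_onto H {0..} g {0..} k"
  shows "carries_onto H {a..} (\<lambda>t. g (t - a)) {b..} (\<lambda>t. k (t - b))"
proof -
  obtain h where h: "strict_mono_on {0..} h" "h ` {0..} = {0..}" "\<forall>t\<in>{0..}. H (g t) = k (h t)"
    using assms unfolding carries_onto_def by blast
  show ?thesis unfolding carries_onto_def
  proof (intro exI[of _ "\<lambda>t. h (t - a) + b"] conjI)
    show "strict_mono_on {a..} (\<lambda>t. h (t - a) + b)" using h(1) unfolding strict_mono_on_def by auto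
    have "{a..} = (\<lambda>t. t + a) ` {0..}" by (auto intro!: image_eqI[of _ _ "_ - a"])
    then have "(\<lambda>t. h (t - a) + b) ` {a..} = (\<lambda>t. t + b) ` h ` {0..}" by (simp add: image_image)
    also have "\<dots> = {b..}" unfolding h(2) by (auto intro!: image_eqI[of _ _ "_ - b"])
    finally show "(\<lambda>t. h (t - a) + b) ` {a..} = {b..}" .
  qed (use h(3) in auto)
qed

text \<open>Strictly increasing bijections match last times with last times and first times with
  first times, so the two time changes agree at the junction.\<close>

lemma carries_onto_glue:
  fixes m m' :: real
  assumes A: "carries_onto H A g A' k" and B: "carries_onto H B g B' k"
    and m: "m \<in> A" "m \<in> B" "A \<subseteq> {..m}" "B \<subseteq> {m..}"
    and m': "m' \<in> A'" "m' \<in> B'" "A' \<subseteq> {..m'}" "B' \<subseteq> {m'..}"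
  shows "carries_onto H (A \<union> B) g (A' \<union> B') k"
proof -
  obtain h1 where h1: "strict_mono_on A h1" "h1 ` A = A'" "\<forall>t\<in>A. H (g t) = k (h1 t)"
    using A unfolding carries_onto_def by blast
  obtain h2 where h2: "strict_mono_on B h2" "h2 ` B = B'" "\<forall>t\<in>B. H (g t) = k (h2 t)"
    using B unfolding carries_onto_def by blast
  have e1: "h1 m = m'"
  proof -
    obtain a where a: "a \<in> A" "h1 a = m'" using h1(2) m'(1) by (metis imageE)
    have "h1 a \<le> h1 m"
      using strict_mono_onD[OF h1(1) a(1) m(1)] a(1) m(3) by (cases "a = m") auto
    moreover have "h1 m \<in> {..m'}" using h1(2) m(1) m'(3) by blast
    ultimately show ?thesis using a by simp
  qed
  have e2: "h2 m = m'"
  proof -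
    obtain a where a: "a \<in> B" "h2 a = m'" using h2(2) m'(2) by (metis imageE)
    have "h2 m \<le> h2 a"
      using strict_mono_onD[OF h2(1) m(2) a(1)] a(1) m(4) by (cases "a = m") auto
    moreover have "h2 m \<in> {m'..}" using h2(2) m(2) m'(4) by blast
    ultimately show ?thesis using a by simp
  qed
  define h where "h t = (if t \<le> m then h1 t else h2 t)" for t
  have hA: "h t = h1 t" if "t \<in> A" for t using that m(3) by (auto simp: h_def)
  have hB: "h t = h2 t" if "t \<in> B" for t using that m(4) e1 e2 by (cases "t = m") (auto simp: h_def)
  have "strict_mono_on (A \<union> B) h"
  proof (rule strict_mono_onI)
    fix r s assume rs: "r \<in> A \<union> B" "s \<in> A \<union> B" "r < s"
    consider "r \<in> A" "s \<in> A" | "r \<in> B" "s \<in> B" | "r \<in> A" "s \<in> B" "r < m \<or> m < s" | "s = m" "r = m"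
      using rs m(3,4) by fastforce
    then show "h r < h s"
    proof cases
      case 1
      then show ?thesis using strict_mono_onD[OF h1(1)] rs(3) hA by simp
    next
      case 2
      then show ?thesis using strict_mono_onD[OF h2(1)] rs(3) hB by simp
    next
      case 3
      have "h1 r \<le> m'" "m' \<le> h2 s" using 3 h1(2) h2(2) m'(3,4) by blast+
      moreover have "h1 r < m' \<or> m' < h2 s"
        using 3(3) strict_mono_onD[OF h1(1) 3(1) m(1)] strict_mono_onD[OF h2(1) m(2) 3(2)] e1 e2 by auto
      ultimately show ?thesis using 3 hA hB by auto
    next
      case 4
      then show ?thesis using rs by simp
    qed
  qed
  moreover have "h ` (A \<union> B) = A' \<union> B'"
    using h1(2) h2(2) hA hB by (simp add: image_Un cong: image_cong)
  moreover have "\<forall>t\<in>A \<union> B. H (g t) = k (h t)" using h1(3) h2(3) hA hB by auto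
  ultimately show ?thesis unfolding carries_onto_def by blast
qed

section \<open>Complete orbits that cross the line\<close>

text \<open>The complete orbit through \<open>axis_point s\<close>, timed so that it enters the
  upper half plane at time 0 and leaves it at time \<open>upper_time X s\<close>.\<close>

definition crossing_curve :: "vfield \<Rightarrow> vfield \<Rightarrow> real \<Rightarrow> real \<Rightarrow> real^2" where
  "crossing_curve X Y s t = (if t \<le> 0 then flow Y t (axis_point s)
     else if t \<le> upper_time X s then flow X t (axis_point s)
     else flow Y (t - upper_time X s) (axis_point (- exit_foot X s)))"

lemma crossing_curve_pieces:
  assumes X: "rotating X" and Y: "source Y" and s: "s > 0"
  shows "t \<le> 0 \<Longrightarrow> crossing_curve X Y s t = flow Y t (axis_point s)"
    "0 \<le> t \<Longrightarrow> t \<le> upper_time X s \<Longrightarrow> crossing_curve X Y s t = flow X t (axis_point s)"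
    "upper_time X s \<le> t \<Longrightarrow> crossing_curve X Y s t = flow Y (t - upper_time X s) (axis_point (- exit_foot X s))"
proof -
  note U = upper_arc(1,2)[OF X s]
  show "t \<le> 0 \<Longrightarrow> crossing_curve X Y s t = flow Y t (axis_point s)"
    by (simp add: crossing_curve_def)
  show "0 \<le> t \<Longrightarrow> t \<le> upper_time X s \<Longrightarrow> crossing_curve X Y s t = flow X t (axis_point s)"
    by (cases "t = 0") (simp_all add: crossing_curve_def rot_flow_0[OF X] src_flow_0[OF Y])
  show "upper_time X s \<le> t \<Longrightarrow> crossing_curve X Y s t = flow Y (t - upper_time X s) (axis_point (- exit_foot X s))"
    using U by (cases "t = upper_time X s") (simp_all add: crossing_curve_def src_flow_0[OF Y])
qed

lemma solution_arc_transform: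
  assumes "\<And>t. (x has_vector_derivative F (x t)) (at t)" "\<And>t. t \<in> {a<..<b} \<Longrightarrow> x t \<in> R"
    "\<And>t. t \<in> {a<..<b} \<Longrightarrow> g t = x t"
  shows "solution_arc F R {a<..<b} g"
  unfolding solution_arc_def
proof
  fix t assume t: "t \<in> {a<..<b}"
  have "(g has_vector_derivative F (x t)) (at t)"
    by (rule has_vector_derivative_transform_within_open[OF assms(1) open_greaterThanLessThan t])
      (use assms(3) in simp)
  then show "g t \<in> R \<and> (g has_vector_derivative F (g t)) (at t)" using assms(2,3)[OF t] by simp
qed

lemma cross_traj_crossing_curve:
  assumes X: "rotating X" and Y: "source Y" and s: "s > 0"
  shows "cross_traj X Y UNIV UNIV (crossing_curve X Y s)"
  unfolding cross_traj_def
proof (intro conjI exI[of _ "{0, upper_time X s}"] allI impI)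
  let ?T = "upper_time X s" and ?c = "crossing_curve X Y s" and ?u = "exit_foot X s"
  note P = crossing_curve_pieces[OF X Y s] and U = upper_arc[OF X s]
  have dY: "((\<lambda>t. flow Y (t - a) p) has_vector_derivative Y (flow Y (t - a) p)) (at t)" for a p t
  proof -
    have "((\<lambda>t. t - a) has_vector_derivative 1) (at t)" by (auto intro!: derivative_eq_intros)
    from vector_diff_chain_at[OF this flow_deriv[OF src_lip[OF Y], of p "t - a"]] show ?thesis by (simp add: o_def)
  qed
  have 1: "continuous_on {..0} ?c"
    by (rule continuous_on_eq[of _ "\<lambda>t. flow Y t (axis_point s)"])
      (auto simp: P intro: flow_continuous_time[OF src_lip[OF Y]])
  have 2: "continuous_on {0..?T} ?c"
    by (rule continuous_on_eq[of _ "\<lambda>t. flow X t (axis_point s)"])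
      (auto simp: P intro: flow_continuous_time[OF rotating_lip[OF X]])
  have 3: "continuous_on {?T..} ?c"
    by (rule continuous_on_eq[of _ "\<lambda>t. flow Y (t - ?T) (axis_point (- ?u))"])
      (auto simp: P intro!: solution_continuous dY)
  have "continuous_on ({..0} \<union> ({0..?T} \<union> {?T..})) ?c"
    by (intro continuous_on_closed_Un closed_Un 1 2 3) auto
  moreover have "{..0} \<union> ({0..?T} \<union> {?T..}) = UNIV" using U(1) by auto
  ultimately show "continuous_on UNIV ?c" by simp
  show "traj_arc X Y {a<..<b} ?c" if ab: "{a<..<b} \<subseteq> UNIV \<and> {a<..<b} \<inter> {0, ?T} = {}" for a b
  proof -
    consider "b \<le> 0" | "0 \<le> a" "b \<le> ?T" | "?T \<le> a" | "b \<le> a"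
      using ab by (auto simp: disjoint_iff) (metis leI)+
    then show ?thesis
    proof cases
      case 1
      have "solution_arc Y {p. p $ 2 < 0} {a<..<b} ?c"
        by (rule solution_arc_transform[where x = "\<lambda>t. flow Y t (axis_point s)"])
          (use 1 fourth_quadrant_invariant[OF src_lc[OF Y], of "axis_point s"] s P in
            \<open>auto intro: flow_deriv[OF src_lip[OF Y]]\<close>)
      then show ?thesis by (simp add: traj_arc_def)
    next
      case 2
      have "solution_arc X {p. p $ 2 > 0} {a<..<b} ?c"
        by (rule solution_arc_transform[where x = "\<lambda>t. flow X t (axis_point s)"])
          (use 2 U P in \<open>auto intro: flow_deriv[OF rotating_lip[OF X]]\<close>)
      then show ?thesis by (simp add: traj_arc_def)
    next
      case 3
      have "solution_arc Y {p. p $ 2 < 0} {a<..<b} ?c"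
        by (rule solution_arc_transform[where x = "\<lambda>t. flow Y (t - ?T) (axis_point (- ?u))", OF dY])
          (use 3 third_quadrant_invariant[OF src_lc[OF Y], of "axis_point (- ?u)"] U(3) P in auto)
      then show ?thesis by (simp add: traj_arc_def)
    next
      case 4
      then show ?thesis by (simp add: traj_arc_def solution_arc_def)
    qed
  qed
qed auto

section \<open>The model above the line\<close>

lemma X_fn_nth [simp]: "X_fn p $ 1 = - p $ 2" "X_fn p $ 2 = p $ 1"
  by (simp_all add: X_fn_def vector_2)

lemma rotating_X_fn: "rotating X_fn"
proof -
  have "norm (X_fn u - X_fn v) \<le> 1 * norm (u - v)" for u v
    by (rule power2_le_imp_le) (simp_all add: norm_real2 power2_commute)
  then have "globally_lipschitz X_fn" by (rule globally_lipschitzI)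
  moreover have "1 * (norm p)\<^sup>2 \<le> p $ 1 * X_fn p $ 2 - p $ 2 * X_fn p $ 1" for p
    by (simp add: norm_real2[unfolded power2_eq_square] power2_eq_square)
  ultimately show ?thesis unfolding rotating_def
    by (intro conjI exI[of _ 1]) (simp_all add: eq_real2)
qed

definition circle_point :: "real \<Rightarrow> real \<Rightarrow> real^2" where
  "circle_point s t = vector [s * cos t, s * sin t]"

lemma circle_point_nth [simp]: "circle_point s t $ 1 = s * cos t" "circle_point s t $ 2 = s * sin t"
  by (simp_all add: circle_point_def vector_2)

lemma flow_X_fn: "flow X_fn t (axis_point s) = circle_point s t"
proof -
  have e: "circle_point s t = cos t *\<^sub>R axis_point s + sin t *\<^sub>R X_fn (axis_point s)" for t
    by (simp add: eq_real2)
  have "((\<lambda>t. cos t *\<^sub>R axis_point s + sin t *\<^sub>R X_fn (axis_point s)) has_vector_derivative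
      - sin t *\<^sub>R axis_point s + cos t *\<^sub>R X_fn (axis_point s)) (at t)" for t
    by (auto intro!: derivative_eq_intros simp flip: has_real_derivative_iff_has_vector_derivative)
  moreover have "- sin t *\<^sub>R axis_point s + cos t *\<^sub>R X_fn (axis_point s) = X_fn (circle_point s t)" for t
    by (simp add: eq_real2)
  ultimately have "(circle_point s has_vector_derivative X_fn (circle_point s t)) (at t)" for t
    unfolding e[abs_def] by simp
  from flow_unique[OF rotating_lip[OF rotating_X_fn] this, of t 0]
  show ?thesis by (simp add: circle_point_def axis_point_def)
qed

lemma upper_time_X_fn:
  assumes "s > 0"
  shows "upper_time X_fn s = pi" "exit_foot X_fn s = s"
proof -
  have "hits_left X_fn (axis_point s) pi"
    unfolding hits_left_def[OF rotating_X_fn] flow_X_fn using assms by (auto simp: sin_ge_zero)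
  then show t: "upper_time X_fn s = pi"
    unfolding upper_time_def by (rule time_left_eq[OF rotating_X_fn])
  have "circle_point s pi = axis_point (- s)" by (simp add: eq_real2)
  then show "exit_foot X_fn s = s" unfolding exit_foot_def t flow_X_fn using assms by simp
qed

context
  fixes X Y Y' :: vfield
  assumes X: "rotating X" and Y: "source Y" and Y': "source Y'"
begin

lemmas lower_props = lower_map_props[OF Y Y' axis_scaling_left_shift[OF X]]

lemma glue_map_0 [simp]: "glue_map X Y Y' 0 = 0"
  by (simp add: glue_map_def)

lemma glue_map_upper:
  assumes p: "p \<noteq> 0" "p $ 2 \<ge> 0"
  shows "glue_map X Y Y' p = (foot X p / norm p) *\<^sub>R p" "norm (glue_map X Y Y' p) = foot X p"
    "glue_map X Y Y' p \<noteq> 0" "glue_map X Y Y' p $ 2 \<ge> 0" "glue_map X Y Y' p $ 2 = 0 \<longleftrightarrow> p $ 2 = 0"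
proof -
  have f: "foot X p > 0" using foot_props(1)[OF X p] .
  show e: "glue_map X Y Y' p = (foot X p / norm p) *\<^sub>R p" using p by (simp add: glue_map_def)
  show "norm (glue_map X Y Y' p) = foot X p" using f p by (simp add: e)
  show "glue_map X Y Y' p \<noteq> 0" "glue_map X Y Y' p $ 2 \<ge> 0" "glue_map X Y Y' p $ 2 = 0 \<longleftrightarrow> p $ 2 = 0"
    using f p by (auto simp: e)
qed

text \<open>Only points of the line need an argument. On the positive half axis the foot is the
  abscissa and \<open>lower_map\<close> is the identity; on the negative one both formulas use the
  scaling \<open>left_shift X\<close>.\<close>

lemma glue_map_lower:
  assumes p: "p \<noteq> 0" "p $ 2 \<le> 0"
  shows "glue_map X Y Y' p = lower_map Y Y' (left_shift X) p"
proof (cases "p $ 2 < 0")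
  case True
  then show ?thesis using p by (simp add: glue_map_def)
next
  case False
  then have p2: "p $ 2 = 0" using p by simp
  define s where "s = p $ 1"
  have ps: "p = axis_point s" using eq_axis_pointI[OF p2] by (simp add: s_def)
  have "s \<noteq> 0" using p ps by simp
  then consider "s > 0" | "s < 0" by linarith
  then show ?thesis
  proof cases
    case 1
    then have "glue_map X Y Y' p = axis_point s"
      using glue_map_upper(1)[of p] ps foot_axis_point(1)[OF X 1] by simp
    then show ?thesis using lower_map_axis(1)[OF Y Y' axis_scaling_left_shift[OF X] 1] ps by simp
  next
    case 2
    then have u: "- s > 0" by simp
    have "(foot X p / norm p) *\<^sub>R p = axis_point (- left_shift X (- s))"
      unfolding ps using 2 by (simp add: left_shift_def eq_real2)
    then have "glue_map X Y Y' p = axis_point (- left_shift X (- s))"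
      using glue_map_upper(1)[of p] p p2 by simp
    then show ?thesis using lower_map_axis(2)[OF Y Y' axis_scaling_left_shift[OF X] u] ps by simp
  qed
qed

lemma glue_map_lower_props:
  assumes p: "p \<noteq> 0" "p $ 2 \<le> 0"
  shows "glue_map X Y Y' p \<noteq> 0" "glue_map X Y Y' p $ 2 \<le> 0" "glue_map X Y Y' p $ 2 = 0 \<longleftrightarrow> p $ 2 = 0"
  unfolding glue_map_lower[OF p] by (rule lower_props[OF p])+

lemma glue_map_axis: "glue_map X Y Y' p $ 2 = 0 \<longleftrightarrow> p $ 2 = 0"
  using glue_map_upper(5)[of p] glue_map_lower_props(3)[of p] by (cases "p = 0"; cases "p $ 2 \<ge> 0") auto

lemma glue_map_eq_0: "glue_map X Y Y' p = 0 \<longleftrightarrow> p = 0"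
  using glue_map_upper(3)[of p] glue_map_lower_props(1)[of p] by (cases "p = 0"; cases "p $ 2 \<ge> 0") auto

text \<open>Both formulas are continuous on the closed half planes without the origin and agree on
  the line. At the origin linear bounds in the norm suffice: \<open>foot_bound\<close> above, and
  the factor \<open>1 + C\<close> for the shifted radius below.\<close>

lemma continuous_glue_map: "continuous_on UNIV (glue_map X Y Y')"
proof -
  obtain C where C: "C \<ge> 0" "\<And>u. u \<ge> 0 \<Longrightarrow> left_shift X u \<le> C * u" using left_shift_bound[OF X] by blast
  obtain C' where C': "C' > 0" "\<And>p. p \<noteq> 0 \<and> p $ 2 \<ge> 0 \<Longrightarrow> foot X p \<le> C' * norm p" using foot_bound[OF X] by blast
  have 1: "continuous_on {p. p $ 2 \<ge> 0} (glue_map X Y Y')"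
  proof (rule continuous_on_at_origin[where f = "glue_map X Y Y'" and K = C', OF _ glue_map_0])
    have "{p :: real^2. p $ 2 \<ge> 0} - {0} = {p. p \<noteq> 0 \<and> p $ 2 \<ge> 0}" by auto
    moreover have "continuous_on {p. p \<noteq> 0 \<and> p $ 2 \<ge> 0} (\<lambda>p. (foot X p / norm p) *\<^sub>R p)"
      by (intro continuous_intros continuous_foot[OF X]) auto
    ultimately show "continuous_on ({p. p $ 2 \<ge> 0} - {0}) (glue_map X Y Y')"
      by (simp only:) (rule continuous_on_eq, assumption, use glue_map_upper(1) in auto)
    show "norm (glue_map X Y Y' p) \<le> C' * norm p" if "p \<in> {p. p $ 2 \<ge> 0}" for p
      using C'(2)[of p] glue_map_upper(2)[of p] that by (cases "p = 0") auto
  qed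
  have 2: "continuous_on {p. p $ 2 \<le> 0} (glue_map X Y Y')"
  proof (rule continuous_on_at_origin[where f = "glue_map X Y Y'" and K = "1 + C", OF _ glue_map_0])
    have "{p :: real^2. p $ 2 \<le> 0} - {0} = {p. p \<noteq> 0 \<and> p $ 2 \<le> 0}" by auto
    moreover have "continuous_on {p. p \<noteq> 0 \<and> p $ 2 \<le> 0} (lower_map Y Y' (left_shift X))"
      by (rule continuous_lower_map[OF Y Y' axis_scaling_left_shift[OF X]])
    ultimately show "continuous_on ({p. p $ 2 \<le> 0} - {0}) (glue_map X Y Y')"
      by (simp only:) (rule continuous_on_eq, assumption, use glue_map_lower in auto)
    show "norm (glue_map X Y Y' p) \<le> (1 + C) * norm p" if "p \<in> {p. p $ 2 \<le> 0}" for p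
    proof (cases "p = 0")
      case False
      then have p: "p \<noteq> 0" "p $ 2 \<le> 0" using that by auto
      let ?m = "max (- label Y p) 0"
      have m: "0 \<le> ?m" "?m \<le> norm p" using lower_props(6,7)[OF p] by auto
      have "norm (glue_map X Y Y' p) = norm p - ?m + left_shift X ?m"
        unfolding glue_map_lower[OF p] by (rule lower_props(1)[OF p])
      also have "\<dots> \<le> norm p + C * ?m" using C(2)[OF m(1)] m by linarith
      also have "\<dots> \<le> norm p + C * norm p" using m C(1) by (intro add_left_mono mult_left_mono) auto
      finally show ?thesis by (simp add: algebra_simps)
    qed simp
  qed
  have "closed {p :: real^2. p $ 2 \<ge> 0}" "closed {p :: real^2. p $ 2 \<le> 0}"
    by (intro closed_Collect_le continuous_intros)+
  from continuous_on_closed_Un[OF this 1 2]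
  have "continuous_on ({p. p $ 2 \<ge> 0} \<union> {p. p $ 2 \<le> 0}) (glue_map X Y Y')" .
  moreover have "{p :: real^2. p $ 2 \<ge> 0} \<union> {p. p $ 2 \<le> 0} = UNIV" by auto
  ultimately show ?thesis by simp
qed

text \<open>Equal norms of the images mean equal feet, hence the same upper arc; equal directions
  mean equal values of \<open>turn\<close>, which is strictly decreasing along the arc.\<close>

lemma glue_map_inj_upper:
  assumes p: "p \<noteq> 0" "p $ 2 \<ge> 0" and q: "q \<noteq> 0" "q $ 2 \<ge> 0" and eq: "glue_map X Y Y' p = glue_map X Y Y' q"
  shows "p = q"
proof -
  let ?s = "foot X p"
  have s: "?s > 0" "foot X q = ?s" using foot_props(1)[OF X p] glue_map_upper(2)[OF p] glue_map_upper(2)[OF q] eq by auto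
  obtain t where t: "t \<in> {0..upper_time X ?s}" "p = flow X t (axis_point ?s)"
    using foot_props(2)[OF X p] by blast
  obtain t' where t': "t' \<in> {0..upper_time X ?s}" "q = flow X t' (axis_point ?s)"
    using foot_props(2)[OF X q] s(2) by auto
  have "(?s / norm p) *\<^sub>R p = (?s / norm q) *\<^sub>R q"
    using eq glue_map_upper(1)[OF p] glue_map_upper(1)[OF q] s(2) by simp
  then have "((?s / norm p) *\<^sub>R p) $ 1 = ((?s / norm q) *\<^sub>R q) $ 1" by simp
  then have "?s * (p $ 1 / norm p) = ?s * (q $ 1 / norm q)" by simp
  moreover have "?s \<noteq> 0" using s(1) by simp
  ultimately have "p $ 1 / norm p = q $ 1 / norm q"
    using mult_left_cancel[of ?s "p $ 1 / norm p" "q $ 1 / norm q"] by blast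
  then have "turn X ?s t = turn X ?s t'" unfolding turn_def[OF X] using t(2) t'(2) by simp
  then have "t = t'"
    using turn_decreasing[OF X s(1), of t t'] turn_decreasing[OF X s(1), of t' t] t(1) t'(1)
    by (cases t t' rule: linorder_cases) auto
  then show ?thesis using t(2) t'(2) by simp
qed

lemma glue_map_sign: "glue_map X Y Y' p $ 2 < 0 \<longleftrightarrow> p $ 2 < 0"
proof (cases "p = 0")
  case False
  then show ?thesis
    using glue_map_upper(4)[OF False] glue_map_lower_props(2)[OF False] glue_map_axis[of p]
    by (cases "p $ 2 \<ge> 0") (auto simp: order_less_le)
qed simp

lemma inj_glue_map: "inj (glue_map X Y Y')"
proof (rule injI)
  fix p q assume eq: "glue_map X Y Y' p = glue_map X Y Y' q"
  show "p = q"
  proof (cases "p = 0 \<or> q = 0")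
    case True
    then show ?thesis using eq glue_map_eq_0 by metis
  next
    case False
    have "p $ 2 < 0 \<longleftrightarrow> q $ 2 < 0" using eq glue_map_sign by metis
    then consider "p $ 2 < 0" "q $ 2 < 0" | "p $ 2 \<ge> 0" "q $ 2 \<ge> 0" by linarith
    then show ?thesis
    proof cases
      case 1
      then have p: "p \<noteq> 0" "p $ 2 \<le> 0" and q: "q \<noteq> 0" "q $ 2 \<le> 0" using False by simp_all
      show ?thesis
        using lower_map_inj[OF Y Y' axis_scaling_left_shift[OF X] p q] eq
        unfolding glue_map_lower[OF p] glue_map_lower[OF q] by blast
    next
      case 2
      then show ?thesis using glue_map_inj_upper False eq by blast
    qed
  qed
qed

text \<open>The foot is constant along the arc, so the image lies on the circle of radius
  \<open>s\<close>; directions being kept, its angle is the arccosine of \<open>turn\<close>. This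
  angle is also the time of the model on that circle.\<close>

lemma glue_map_on_upper_arc:
  assumes s: "s > 0" and t: "t \<in> {0..upper_time X s}"
  shows "glue_map X Y Y' (flow X t (axis_point s)) = circle_point s (arccos (turn X s t))"
    "\<bar>turn X s t\<bar> \<le> 1"
proof -
  let ?p = "flow X t (axis_point s)"
  have p: "?p \<noteq> 0" "?p $ 2 \<ge> 0" using upper_arc(5)[OF X s t] s by (auto simp: rot_flow_eq_0[OF X])
  have np: "norm ?p > 0" using p by simp
  have f: "foot X ?p = s"
    by (rule foot_eq[OF X s]) (use t upper_arc(5)[OF X s] in auto)
  have tn: "turn X s t = ?p $ 1 / norm ?p" by (rule turn_def[OF X])
  show le: "\<bar>turn X s t\<bar> \<le> 1" unfolding tn using component_le_norm_cart[of ?p 1] np by simp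
  have "(?p $ 1 / norm ?p)\<^sup>2 + (?p $ 2 / norm ?p)\<^sup>2 = 1"
    unfolding power_divide add_divide_distrib[symmetric] norm_real2[symmetric] using np by simp
  then have "(?p $ 2 / norm ?p)\<^sup>2 = 1 - (turn X s t)\<^sup>2" by (simp add: tn)
  then have p2: "?p $ 2 / norm ?p = sqrt (1 - (turn X s t)\<^sup>2)"
    using p np by (intro real_sqrt_unique[symmetric]) auto
  have c: "cos (arccos (turn X s t)) = turn X s t" "sin (arccos (turn X s t)) = sqrt (1 - (turn X s t)\<^sup>2)"
    using le by (auto intro: cos_arccos_abs sin_arccos)
  have "glue_map X Y Y' ?p = (s / norm ?p) *\<^sub>R ?p" using glue_map_upper(1)[OF p] f by simp
  then have "glue_map X Y Y' ?p $ 1 = s * (?p $ 1 / norm ?p)" "glue_map X Y Y' ?p $ 2 = s * (?p $ 2 / norm ?p)"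
    by simp_all
  then show "glue_map X Y Y' ?p = circle_point s (arccos (turn X s t))"
    unfolding eq_real2 circle_point_nth c[unfolded p2[symmetric]] by (simp add: tn)
qed

lemma carries_upper:
  assumes s: "s > 0"
  shows "carries_onto (glue_map X Y Y') {0..upper_time X s} (\<lambda>t. flow X t (axis_point s)) {0..pi} (\<lambda>t. flow X_fn t (axis_point s))"
  unfolding carries_onto_def
proof (intro exI[of _ "\<lambda>t. arccos (turn X s t)"] conjI)
  let ?T = "upper_time X s"
  note le = glue_map_on_upper_arc(2)[OF s] and U = upper_arc[OF X s]
  show "strict_mono_on {0..?T} (\<lambda>t. arccos (turn X s t))"
  proof (rule strict_mono_onI)
    fix t u assume "t \<in> {0..?T}" "u \<in> {0..?T}" "t < u"
    then show "arccos (turn X s t) < arccos (turn X s u)"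
      using turn_decreasing[OF X s, of t u] le by (subst arccos_less_mono) auto
  qed
  show "(\<lambda>t. arccos (turn X s t)) ` {0..?T} = {0..pi}"
  proof (intro equalityI subsetI)
    fix x assume "x \<in> (\<lambda>t. arccos (turn X s t)) ` {0..?T}"
    then show "x \<in> {0..pi}" using le by (auto simp: abs_le_iff intro!: arccos_lbound arccos_ubound)
  next
    fix x assume x: "x \<in> {0..pi}"
    have "turn X s 0 = 1" using s by (simp add: turn_def[OF X] rot_flow_0[OF X])
    moreover have "turn X s ?T = -1" using U by (simp add: turn_def[OF X])
    moreover have "continuous_on {0..?T} (turn X s)"
    proof -
      have "continuous_on {0..?T} (\<lambda>t. flow X t (axis_point s) $ 1 / norm (flow X t (axis_point s)))"
        by (intro continuous_intros flow_continuous_time[OF rotating_lip[OF X]])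
          (use s in \<open>simp add: rot_flow_eq_0[OF X]\<close>)
      then show ?thesis by (simp add: turn_def[OF X])
    qed
    ultimately obtain t where "t \<in> {0..?T}" "turn X s t = cos x"
      using IVT2'[of "turn X s" ?T "cos x" 0] U(1) by auto
    then show "x \<in> (\<lambda>t. arccos (turn X s t)) ` {0..?T}"
      using x by (intro image_eqI[of _ _ t]) (auto simp: arccos_cos)
  qed
  show "\<forall>t\<in>{0..?T}. glue_map X Y Y' (flow X t (axis_point s)) = flow X_fn (arccos (turn X s t)) (axis_point s)"
    using glue_map_on_upper_arc(1)[OF s] by (simp add: flow_X_fn)
qed

text \<open>The three pieces meet at times 0 and \<open>upper_time X s\<close> on the given orbit,
  and at times 0 and \<open>pi\<close> on the orbit of the model.\<close>

lemma carries_crossing_curve: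
  assumes s: "s > 0"
  shows "carries_onto (glue_map X Y Y') UNIV (crossing_curve X Y s) UNIV (crossing_curve X_fn Y' s)"
proof -
  let ?T = "upper_time X s" and ?u = "exit_foot X s" and ?H = "glue_map X Y Y'"
  note P = crossing_curve_pieces[OF X Y s] and P' = crossing_curve_pieces[OF rotating_X_fn Y' s, unfolded upper_time_X_fn[OF s]]
  note U = upper_arc[OF X s]
  note LS = axis_scaling_left_shift[OF X]
  have 1: "carries_onto ?H {..0} (crossing_curve X Y s) {..0} (crossing_curve X_fn Y' s)"
  proof (rule carries_onto_cong[OF carries_right[OF Y Y' LS s]])
    fix t :: real assume "t \<in> {..0}"
    then have t: "t \<le> 0" by simp
    have "flow Y t (axis_point s) \<noteq> 0" "flow Y t (axis_point s) $ 2 \<le> 0"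
      using right_orbit(1,2)[OF Y s t] by auto
    then show "?H (crossing_curve X Y s t) = lower_map Y Y' (left_shift X) (flow Y t (axis_point s))"
      using glue_map_lower P(1)[OF t] by simp
  qed (use P' in simp)
  have 2: "carries_onto ?H {0..?T} (crossing_curve X Y s) {0..pi} (crossing_curve X_fn Y' s)"
    by (rule carries_onto_cong[OF carries_upper[OF s]]) (use P P' in simp_all)
  \<comment> \<open>The exit point is thus sent to \<open>axis_point (- s)\<close>, where the
    semicircle of the model ends.\<close>
  have e: "left_shift X ?u = s" using U(3) foot_axis_point(2)[OF X s] by (simp add: left_shift_def)
  have 3: "carries_onto ?H {?T..} (crossing_curve X Y s) {pi..} (crossing_curve X_fn Y' s)"
  proof (rule carries_onto_cong[OF carries_onto_shift[OF carries_left[OF Y Y' LS U(3), unfolded e]]])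
    fix t assume "t \<in> {?T..}"
    then have t: "t - ?T \<ge> 0" by simp
    have "flow Y (t - ?T) (axis_point (- ?u)) \<noteq> 0" "flow Y (t - ?T) (axis_point (- ?u)) $ 2 \<le> 0"
      using left_orbit(1,2)[OF Y U(3) t] by auto
    then show "?H (crossing_curve X Y s t) = lower_map Y Y' (left_shift X) (flow Y (t - ?T) (axis_point (- ?u)))"
      using glue_map_lower P(3)[of t] t by simp
  qed (use P' in simp)
  have 23: "carries_onto ?H ({0..?T} \<union> {?T..}) (crossing_curve X Y s) ({0..pi} \<union> {pi..}) (crossing_curve X_fn Y' s)"
    by (rule carries_onto_glue[OF 2 3, of ?T pi]) (use U(1) in auto)
  have u: "{0..?T} \<union> {?T..} = {0..}" "{0..pi} \<union> {pi..} = {0..}" using U(1) by (auto intro: order_trans[OF pi_ge_zero])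
  have "carries_onto ?H ({..0} \<union> {0..}) (crossing_curve X Y s) ({..0} \<union> {0..}) (crossing_curve X_fn Y' s)"
    by (rule carries_onto_glue[OF 1 23[unfolded u], of 0 0]) auto
  moreover have "{..0} \<union> {0..} = (UNIV :: real set)" by auto
  ultimately show ?thesis by simp
qed

lemma on_crossing_curve_or_mid:
  assumes "p \<noteq> 0"
  shows "(\<exists>s>0. \<exists>t. p = crossing_curve X Y s t) \<or> (\<forall>t. flow Y t p $ 2 < 0)"
proof (cases "p $ 2 \<ge> 0")
  case True
  let ?s = "foot X p"
  have s: "?s > 0" by (rule foot_props(1)[OF X assms True])
  obtain t where "t \<in> {0..upper_time X ?s}" "p = flow X t (axis_point ?s)"
    using foot_props(2)[OF X assms True] by blast
  then have "p = crossing_curve X Y ?s t" using crossing_curve_pieces(2)[OF X Y s, of t] by simp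
  then show ?thesis using s by blast
next
  case False
  then have p: "p \<noteq> 0" "p $ 2 \<le> 0" using assms by auto
  note l = label_props[OF Y p]
  from l(1) show ?thesis
  proof (cases rule: chart_point_cases[OF Y, consumes 1, case_names left right mid])
    case (left t)
    let ?u = "- label Y p"
    let ?s = "foot X (axis_point (- ?u))"
    have u: "?u > 0" using left by simp
    have s: "?s > 0" using foot_props(1)[OF X, of "axis_point (- ?u)"] u by simp
    have e: "exit_foot X ?s = ?u" by (rule foot_left_axis[OF X u])
    have "p = crossing_curve X Y ?s (upper_time X ?s + t)"
      using crossing_curve_pieces(3)[OF X Y s, of "upper_time X ?s + t"] left l(2) e by simp
    then show ?thesis using s by blast
  next
    case (right t)
    let ?s = "1 / (label Y p - 1)"
    have s: "?s > 0" using right by simp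
    have "p = crossing_curve X Y ?s t"
      using crossing_curve_pieces(1)[OF X Y s, of t] right l(2) by simp
    then show ?thesis using s by blast
  next
    case mid
    then show ?thesis using l(2) by simp
  qed
qed

lemma cross_traj_lower_flow:
  assumes Z: "source Z" and neg: "\<And>t. flow Z t p $ 2 < 0"
  shows "cross_traj W Z UNIV UNIV (\<lambda>t. flow Z t p)"
  unfolding cross_traj_def
proof (intro conjI exI[of _ "{}"] allI impI)
  fix a b :: real
  have "solution_arc Z {p. p $ 2 < 0} {a<..<b} (\<lambda>t. flow Z t p)"
    unfolding solution_arc_def using neg flow_deriv[OF src_lip[OF Z]] by blast
  then show "traj_arc W Z {a<..<b} (\<lambda>t. flow Z t p)" by (simp add: traj_arc_def)
qed (auto intro: flow_continuous_time[OF src_lip[OF Z]])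

text \<open>The time change is onto, so every point of the target orbit is the image of a point of
  the trapped orbit, and \<open>glue_map\<close> preserves the sign of the second
  coordinate.\<close>

lemma lower_flow_mid:
  assumes neg: "\<And>t. flow Y t p $ 2 < 0"
  shows "flow Y' t (glue_map X Y Y' p) $ 2 < 0"
proof -
  have inv: "q \<noteq> 0 \<and> q $ 2 < 0" if "q = flow Y r p" for q r using neg[of r] that by auto
  have "p \<noteq> 0 \<and> p $ 2 < 0" using inv[of p 0] by (simp add: src_flow_0[OF Y])
  then have p: "p \<noteq> 0" "p $ 2 \<le> 0" by auto
  obtain h where h: "h ` UNIV = UNIV" "\<forall>t. lower_map Y Y' (left_shift X) (flow Y t p) = flow Y' (h t) (lower_map Y Y' (left_shift X) p)"
    using carries_mid[OF Y Y' axis_scaling_left_shift[OF X] neg] unfolding carries_onto_def by auto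
  obtain r where "t = h r" using h(1) by blast
  then have "flow Y' t (glue_map X Y Y' p) = glue_map X Y Y' (flow Y r p)"
    using h(2) glue_map_lower[OF p] glue_map_lower[of "flow Y r p"] inv[of "flow Y r p" r] by auto
  then show ?thesis using glue_map_sign neg by metis
qed

lemma crossing_rotating_source:
  assumes "rotating V" "source W"
  shows "crossing V W"
  unfolding crossing_def
  using rotating_lip[OF assms(1)] rotating_0[OF assms(1)] rotating_axis[OF assms(1)]
    src_lip[OF assms(2)] lc_0[OF src_lc[OF assms(2)]] lc_axis[OF src_lc[OF assms(2)]] by blast

theorem orbit_equiv_glue_map: "orbit_equiv X Y X_fn Y' (glue_map X Y Y')"
proof (rule orbit_equiv_curves[OF crossing_rotating_source[OF X Y] crossing_rotating_source[OF rotating_X_fn Y']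
      continuous_glue_map inj_glue_map glue_map_0 glue_map_axis])
  let ?H = "glue_map X Y Y'"
  have from_carries: "\<exists>h. strict_mono h \<and> surj h \<and> (\<forall>t. ?H (c t) = c' (h t))"
    if "carries_onto ?H UNIV c UNIV c'" for c c'
    using that unfolding carries_onto_def by auto
  fix p :: "real^2"
  show "\<exists>c c' h. cross_traj X Y UNIV UNIV c \<and> c 0 = p \<and> cross_traj X_fn Y' UNIV UNIV c' \<and>
      strict_mono h \<and> surj (h :: real \<Rightarrow> real) \<and> (\<forall>t. ?H (c t) = c' (h t))"
  proof (cases "p = 0")
    case True
    have "cross_traj V W UNIV UNIV (\<lambda>_. 0)" for V W
      unfolding cross_traj_def traj_arc_def solution_arc_def by (auto intro!: exI[of _ "{}"])
    then show ?thesis using True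
      by (intro exI[of _ "\<lambda>_. 0"] exI[of _ "\<lambda>t. t"]) (auto simp: strict_mono_def)
  next
    case False
    then consider s t where "s > 0" "p = crossing_curve X Y s t" | "\<And>t. flow Y t p $ 2 < 0"
      using on_crossing_curve_or_mid by blast
    then show ?thesis
    proof cases
      case 1
      obtain h where h: "strict_mono h" "surj h" "\<And>t. ?H (crossing_curve X Y s t) = crossing_curve X_fn Y' s (h t)"
        using from_carries[OF carries_crossing_curve[OF 1(1)]] by blast
      have "cross_traj X Y UNIV UNIV (\<lambda>r. crossing_curve X Y s (r + t))"
        using cross_traj_shift[OF cross_traj_crossing_curve[OF X Y 1(1)], of t] by simp
      moreover have "strict_mono (\<lambda>r. h (r + t))" using h(1) by (simp add: strict_mono_def)
      moreover have "surj (\<lambda>r. h (r + t))"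
      proof (rule surjI)
        show "h ((inv h x - t) + t) = x" for x using surj_f_inv_f[OF h(2)] by simp
      qed
      ultimately show ?thesis
        using cross_traj_crossing_curve[OF rotating_X_fn Y' 1(1)] h(3) 1(2)
        by (intro exI[of _ "\<lambda>r. crossing_curve X Y s (r + t)"] exI[of _ "crossing_curve X_fn Y' s"]
            exI[of _ "\<lambda>r. h (r + t)"]) simp
    next
      case 2
      have p: "p $ 2 \<le> 0" using 2[of 0] by (simp add: src_flow_0[OF Y])
      have "carries_onto ?H UNIV (\<lambda>t. flow Y t p) UNIV (\<lambda>t. flow Y' t (?H p))"
      proof (rule carries_onto_cong)
        show "carries_onto (lower_map Y Y' (left_shift X)) UNIV (\<lambda>t. flow Y t p) UNIV (\<lambda>t. flow Y' t (?H p))"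
          unfolding glue_map_lower[OF False p] by (rule carries_mid[OF Y Y' axis_scaling_left_shift[OF X] 2])
        fix t
        have "flow Y t p \<noteq> 0" "flow Y t p $ 2 \<le> 0" using 2[of t] by auto
        then show "?H (flow Y t p) = lower_map Y Y' (left_shift X) (flow Y t p)" by (rule glue_map_lower)
      qed simp
      from from_carries[OF this] obtain h where
        h: "strict_mono h" "surj h" "\<And>t. ?H (flow Y t p) = flow Y' (h t) (?H p)" by blast
      show ?thesis
        using cross_traj_lower_flow[OF Y 2] cross_traj_lower_flow[OF Y' lower_flow_mid[OF 2]] h
        by (intro exI[of _ "\<lambda>t. flow Y t p"] exI[of _ "\<lambda>t. flow Y' t (?H p)"] exI[of _ h])
          (simp add: src_flow_0[OF Y])
    qed
  qed
qed

end

section \<open>Reduction to the normal form\<close>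

definition near_linear :: "real \<Rightarrow> real^2^2 \<Rightarrow> vfield \<Rightarrow> bool" where
  "near_linear \<delta> A F \<longleftrightarrow> globally_lipschitz F \<and> (\<forall>p. norm (F p - A *v p) \<le> \<delta> * norm p)"

lemma near_linear_mono: "near_linear \<delta> A F \<Longrightarrow> \<delta> \<le> \<delta>' \<Longrightarrow> near_linear \<delta>' A F"
  unfolding near_linear_def by (meson mult_right_mono norm_ge_zero order_trans)

text \<open>By the mean value inequality the deviation from the linear part has a small Lipschitz
  constant near the origin. Composing it with the nearest point projection onto a small ball extends
  it to the plane with the same constant.\<close>

lemma C1_extension:
  assumes X: "X \<in> C1_fields D" and D: "open D" "0 \<in> D" and X0: "X 0 = 0" and "\<delta> > 0"
  obtains F e where "e > 0" "ball 0 e \<subseteq> D" "\<And>p. p \<in> ball 0 e \<Longrightarrow> F p = X p" "near_linear \<delta> (jacobian X (at 0)) F"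
proof -
  let ?A = "jacobian X (at 0)"
  have diff: "X differentiable (at p)" if "p \<in> D" for p using X that unfolding C1_fields_def by blast
  have cont: "continuous_on D (\<lambda>p. jacobian X (at p))" using X unfolding C1_fields_def by blast
  then have "isCont (\<lambda>p. jacobian X (at p)) 0" using D by (simp add: continuous_on_eq_continuous_at)
  \<comment> \<open>The operator norm is bounded by four times the largest entry, hence the
    quarter.\<close>
  then obtain d where d: "d > 0" "\<And>p. dist p 0 < d \<Longrightarrow> dist (jacobian X (at p)) ?A < \<delta> / 4"
    unfolding continuous_at_eps_delta using \<open>\<delta> > 0\<close> by (metis dist_commute zero_less_divide_iff zero_less_numeral)
  obtain e0 where e0: "e0 > 0" "cball 0 e0 \<subseteq> D" using D open_contains_cball by blast
  define r where "r = min e0 (d / 2)"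
  have r: "r > 0" "cball 0 r \<subseteq> D" "\<And>p. p \<in> cball 0 r \<Longrightarrow> dist (jacobian X (at p)) ?A < \<delta> / 4"
    using d e0 by (auto simp: r_def)
  define N where "N p = X p - ?A *v p" for p
  have der: "(N has_derivative (\<lambda>h. (jacobian X (at p) - ?A) *v h)) (at p within cball 0 r)" if "p \<in> cball 0 r" for p
  proof -
    have "(X has_derivative (\<lambda>h. jacobian X (at p) *v h)) (at p)"
      using diff that r(2) by (auto simp: jacobian_works)
    moreover have "((\<lambda>p. ?A *v p) has_derivative (\<lambda>h. ?A *v h)) (at p)"
      by (rule bounded_linear_imp_has_derivative) (rule matrix_vector_mul_bounded_linear)
    ultimately have "(N has_derivative (\<lambda>h. jacobian X (at p) *v h - ?A *v h)) (at p)"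
      unfolding N_def by (rule has_derivative_diff)
    then show ?thesis by (simp add: matrix_vector_mult_diff_rdistrib has_derivative_at_withinI)
  qed
  have on: "onorm (\<lambda>h. (jacobian X (at p) - ?A) *v h) \<le> \<delta>" if "p \<in> cball 0 r" for p
  proof -
    have "\<bar>(jacobian X (at p) - ?A) $ i $ j\<bar> \<le> \<delta> / 4" for i j
    proof -
      have "\<bar>(jacobian X (at p) - ?A) $ i $ j\<bar> \<le> norm ((jacobian X (at p) - ?A) $ i)"
        by (rule component_le_norm_cart)
      also have "\<dots> \<le> norm (jacobian X (at p) - ?A)" by (rule Finite_Cartesian_Product.norm_nth_le)
      also have "\<dots> \<le> \<delta> / 4" using r(3)[OF that] by (simp add: dist_norm)
      finally show ?thesis .
    qed
    from onorm_le_matrix_component[OF this] show ?thesis by simp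
  qed
  have lipN: "norm (N p - N q) \<le> \<delta> * norm (p - q)" if "p \<in> cball 0 r" "q \<in> cball 0 r" for p q
    by (rule differentiable_bound[OF convex_cball der on that])
  define c where "c = closest_point (cball (0::real^2) r)"
  have c: "c p \<in> cball 0 r" "dist (c p) (c q) \<le> dist p q" for p q
    unfolding c_def using r(1)
    by (intro closest_point_in_set closest_point_lipschitz closed_cball convex_cball; simp)+
  have c_self: "c p = p" if "p \<in> cball 0 r" for p unfolding c_def by (rule closest_point_self[OF that])
  define F where "F p = ?A *v p + N (c p)" for p
  obtain K where K: "\<And>p. norm (?A *v p) \<le> norm p * K"
    using bounded_linear.bounded[OF matrix_vector_mul_bounded_linear[of ?A]] by blast
  have lipNc: "norm (N (c p) - N (c q)) \<le> \<delta> * norm (p - q)" for p q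
  proof -
    have "norm (N (c p) - N (c q)) \<le> \<delta> * norm (c p - c q)" by (rule lipN[OF c(1) c(1)])
    also have "\<dots> \<le> \<delta> * norm (p - q)" using c(2)[of p q] \<open>\<delta> > 0\<close> by (simp add: dist_norm)
    finally show ?thesis .
  qed
  have "globally_lipschitz F"
  proof (rule globally_lipschitzI)
    fix u v
    have "F u - F v = ?A *v (u - v) + (N (c u) - N (c v))"
      by (simp add: F_def matrix_vector_mult_diff_distrib)
    then have "norm (F u - F v) \<le> norm (?A *v (u - v)) + norm (N (c u) - N (c v))"
      by (simp only: norm_triangle_ineq)
    also have "\<dots> \<le> norm (u - v) * K + \<delta> * norm (u - v)" by (intro add_mono K lipNc)
    finally show "norm (F u - F v) \<le> (K + \<delta>) * norm (u - v)" by (simp add: algebra_simps)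
  qed
  moreover have "norm (F p - ?A *v p) \<le> \<delta> * norm p" for p
    using lipNc[of p 0] c_self[of 0] r(1) X0 by (simp add: F_def N_def)
  ultimately have "near_linear \<delta> ?A F" unfolding near_linear_def by blast
  moreover have "F p = X p" if "p \<in> ball 0 r" for p
    using c_self[of p] that by (simp add: F_def N_def)
  moreover have "ball 0 r \<subseteq> D" using r(2) by auto
  ultimately show ?thesis using r(1) by (intro that[of r F])
qed

section \<open>Linear normal forms\<close>

text \<open>The discriminant of the characteristic polynomial, that is, the square of the difference
  of the eigenvalues.\<close>

definition det_gap :: "real^2^2 \<Rightarrow> real" where
  "det_gap A = (A $ 1 $ 1 + A $ 2 $ 2)\<^sup>2 - 4 * det A"

lemma det_gap_eq: "det_gap A = (A $ 1 $ 1 - A $ 2 $ 2)\<^sup>2 + 4 * A $ 1 $ 2 * A $ 2 $ 1"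
  by (simp add: det_gap_def det_2 power2_eq_square algebra_simps)

text \<open>The shear and scaling below turn a matrix with nonzero lower left entry into one with equal diagonal
  entries and off-diagonal entries of equal absolute value.\<close>

definition shear_skew :: "real^2^2 \<Rightarrow> real" where
  "shear_skew A = (A $ 2 $ 2 - A $ 1 $ 1) / (2 * A $ 2 $ 1)"

definition shear_scale :: "real^2^2 \<Rightarrow> real" where
  "shear_scale A = sqrt \<bar>det_gap A\<bar> / (2 * \<bar>A $ 2 $ 1\<bar>)"

text \<open>The factor \<open>k\<close> will be the sign of the lower left entry of
  \<open>A\<close>; \<open>k = -1\<close> reflects the abscissa, so that this entry becomes
  positive.\<close>

definition shear :: "real \<Rightarrow> real^2^2 \<Rightarrow> real^2 \<Rightarrow> real^2" where
  "shear k A p = vector [k * p $ 1 + k * shear_skew A * p $ 2, shear_scale A * p $ 2]"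

definition unshear :: "real \<Rightarrow> real^2^2 \<Rightarrow> real^2 \<Rightarrow> real^2" where
  "unshear k A p = vector [k * p $ 1 - shear_skew A * (p $ 2 / shear_scale A), p $ 2 / shear_scale A]"

lemma shear_nth [simp]:
  "shear k A p $ 1 = k * p $ 1 + k * shear_skew A * p $ 2" "shear k A p $ 2 = shear_scale A * p $ 2"
  by (simp_all add: shear_def vector_2)

lemma unshear_nth [simp]:
  "unshear k A p $ 1 = k * p $ 1 - shear_skew A * (p $ 2 / shear_scale A)" "unshear k A p $ 2 = p $ 2 / shear_scale A"
  by (simp_all add: unshear_def vector_2)

lemma linear_real2_bounded:
  fixes f :: "real^2 \<Rightarrow> real^2"
  assumes "\<And>p. f p $ 1 = a * p $ 1 + b * p $ 2" "\<And>p. f p $ 2 = c * p $ 1 + d * p $ 2"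
  shows "bounded_linear f"
  unfolding linear_conv_bounded_linear[symmetric]
  by (rule linearI) (simp_all add: eq_real2 assms algebra_simps)

context
  fixes k :: real and A :: "real^2^2"
  assumes k: "k = 1 \<or> k = -1" and c: "k * A $ 2 $ 1 > 0" and gap: "det_gap A \<noteq> 0"
begin

lemma lower_left_nz: "A $ 2 $ 1 \<noteq> 0"
  using c by auto

lemma shear_scale_pos: "shear_scale A > 0"
  unfolding shear_scale_def using lower_left_nz gap by (intro divide_pos_pos) auto

lemma kk: "k * (k * x) = x" "k * k = 1"
  using k by auto

lemma unshear_shear: "unshear k A (shear k A p) = p" and shear_unshear: "shear k A (unshear k A p) = p"
  using shear_scale_pos k by (auto simp: eq_real2)

lemma bounded_linear_shear: "bounded_linear (shear k A)"
  by (rule linear_real2_bounded[of _ k "k * shear_skew A" 0 "shear_scale A"]) simp_all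

lemma bounded_linear_unshear: "bounded_linear (unshear k A)"
  by (rule linear_real2_bounded[of _ k "- (shear_skew A / shear_scale A)" 0 "1 / shear_scale A"]) simp_all

text \<open>On the switching line the shear is multiplication by \<open>k\<close> whatever the
  matrix. This is why the shears of two different matrices can be glued along the line.\<close>

lemma shear_sign: "shear k A p $ 2 > 0 \<longleftrightarrow> p $ 2 > 0" "shear k A p $ 2 < 0 \<longleftrightarrow> p $ 2 < 0"
    "p $ 2 = 0 \<Longrightarrow> shear k A p = k *\<^sub>R p"
    "unshear k A p $ 2 > 0 \<longleftrightarrow> p $ 2 > 0" "unshear k A p $ 2 < 0 \<longleftrightarrow> p $ 2 < 0"
    "p $ 2 = 0 \<Longrightarrow> unshear k A p = k *\<^sub>R p"
  using shear_scale_pos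
  by (auto simp: eq_real2 zero_less_mult_iff mult_less_0_iff zero_less_divide_iff divide_less_0_iff)

text \<open>For negative discriminant the result is a scaled rotation, with \<open>m\<close> as real
  part and \<open>w\<close> as modulus of the imaginary part of the eigenvalues; for positive
  discriminant it is symmetric with eigenvalues \<open>m + w\<close> and
  \<open>m - w\<close>.\<close>

lemma shear_normal_form:
  defines "m \<equiv> (A $ 1 $ 1 + A $ 2 $ 2) / 2" and "w \<equiv> sqrt \<bar>det_gap A\<bar> / 2"
  shows "shear k A (A *v unshear k A q) $ 1 = m * q $ 1 + sgn (det_gap A) * w * q $ 2"
    "shear k A (A *v unshear k A q) $ 2 = w * q $ 1 + m * q $ 2"
proof -
  let ?a = "A $ 1 $ 1" and ?b = "A $ 1 $ 2" and ?c = "A $ 2 $ 1" and ?d = "A $ 2 $ 2"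
  define z where "z = shear_skew A"
  define g where "g = shear_scale A"
  have g: "g > 0" unfolding g_def by (rule shear_scale_pos)
  have cz: "2 * (?c * z) = ?d - ?a" using lower_left_nz by (simp add: z_def shear_skew_def)
  have kc: "k * ?c = \<bar>?c\<bar>" using k c by auto
  have w: "w = g * (k * ?c)" using lower_left_nz by (simp add: kc w_def g_def shear_scale_def)
  have gg: "4 * (g * g) * (?c * ?c) = \<bar>det_gap A\<bar>"
  proof -
    have "4 * (g * g) * (?c * ?c) = (sqrt \<bar>det_gap A\<bar>)\<^sup>2"
      using lower_left_nz by (simp add: g_def shear_scale_def power2_eq_square field_simps flip: abs_mult)
    then show ?thesis by simp
  qed
  have x: "(A *v p) $ 1 = ?a * p $ 1 + ?b * p $ 2" "(A *v p) $ 2 = ?c * p $ 1 + ?d * p $ 2" for p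
    by (simp_all add: matrix_vector_mult_def sum_2)
  define y where "y = q $ 2 / g"
  have y: "q $ 2 = g * y" using g by (simp add: y_def)
  have S: "shear k A p $ 1 = k * p $ 1 + k * z * p $ 2" "shear k A p $ 2 = g * p $ 2" for p
    by (simp_all add: z_def g_def)
  have U: "unshear k A q $ 1 = k * q $ 1 - z * y" "unshear k A q $ 2 = y"
    by (simp_all add: z_def g_def y_def)
  have m: "?a + ?c * z = m" "?d - ?c * z = m" using cz by (simp_all add: m_def)
  show "shear k A (A *v unshear k A q) $ 2 = w * q $ 1 + m * q $ 2"
    unfolding S x U w m(2)[symmetric] y by (simp add: algebra_simps)
  \<comment> \<open>Once the skew has made the diagonal entries equal, the discriminant is four
    times the product of the off-diagonal entries, and the shear leaves the lower left one
    unchanged.\<close>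
  have key: "k * (?b - ?a * z + z * (?d - ?c * z)) = sgn (det_gap A) * w * g"
  proof -
    have "4 * ?c * (?b - ?a * z + z * (?d - ?c * z)) = 4 * ?b * ?c + 2 * (2 * (?c * z)) * (?d - ?a) - (2 * (?c * z)) * (2 * (?c * z))"
      by (simp add: algebra_simps)
    also have "\<dots> = det_gap A" unfolding cz det_gap_eq by (simp add: power2_eq_square algebra_simps)
    also have "\<dots> = sgn (det_gap A) * \<bar>det_gap A\<bar>" by (simp add: sgn_mult_abs)
    also have "\<dots> = 4 * ?c * (sgn (det_gap A) * (g * g * ?c))" unfolding gg[symmetric] by (simp add: mult_ac)
    finally have "?b - ?a * z + z * (?d - ?c * z) = sgn (det_gap A) * (g * g * ?c)"
      using lower_left_nz by simp
    then show ?thesis unfolding w by (simp add: mult_ac)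
  qed
  have "shear k A (A *v unshear k A q) $ 1 =
      (k * k) * (?a + ?c * z) * q $ 1 + k * (?b - ?a * z + z * (?d - ?c * z)) * y"
    unfolding S x U by (simp add: algebra_simps)
  then show "shear k A (A *v unshear k A q) $ 1 = m * q $ 1 + sgn (det_gap A) * w * q $ 2"
    unfolding key m(1) kk(2) y by (simp add: mult_ac del: shear_nth)
qed

text \<open>The constant depends on \<open>k\<close> and \<open>A\<close> only, so that
  \<open>\<delta>\<close> can be chosen after it.\<close>

lemma shear_near_linear:
  "\<exists>K>0. \<forall>\<delta> F. near_linear \<delta> A F \<longrightarrow> globally_lipschitz (\<lambda>q. shear k A (F (unshear k A q))) \<and>
    (0 \<le> \<delta> \<longrightarrow> (\<forall>q. norm (shear k A (F (unshear k A q)) - shear k A (A *v unshear k A q)) \<le> K * \<delta> * norm q))"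
proof -
  obtain K1 where K1: "K1 > 0" "\<And>p. norm (shear k A p) \<le> norm p * K1"
    using bounded_linear.pos_bounded[OF bounded_linear_shear] by blast
  obtain K2 where K2: "K2 > 0" "\<And>p. norm (unshear k A p) \<le> norm p * K2"
    using bounded_linear.pos_bounded[OF bounded_linear_unshear] by blast
  have S: "shear k A u - shear k A v = shear k A (u - v)" for u v
    by (rule linear_diff[OF bounded_linear.linear[OF bounded_linear_shear], symmetric])
  have U: "unshear k A u - unshear k A v = unshear k A (u - v)" for u v
    by (rule linear_diff[OF bounded_linear.linear[OF bounded_linear_unshear], symmetric])
  show ?thesis
  proof (intro exI[of _ "K1 * K2"] conjI allI impI)
    show "K1 * K2 > 0" using K1 K2 by simp
    fix \<delta> F assume F: "near_linear \<delta> A F"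
    show "norm (shear k A (F (unshear k A q)) - shear k A (A *v unshear k A q)) \<le> K1 * K2 * \<delta> * norm q"
      if \<delta>: "0 \<le> \<delta>" for q
    proof -
      have "norm (shear k A (F (unshear k A q) - A *v unshear k A q)) \<le> norm (F (unshear k A q) - A *v unshear k A q) * K1"
        by (rule K1)
      also have "\<dots> \<le> (\<delta> * norm (unshear k A q)) * K1"
        using F K1(1) unfolding near_linear_def by (intro mult_right_mono) auto
      also have "\<dots> \<le> (\<delta> * (norm q * K2)) * K1"
        using K1(1) K2(2) \<delta> by (intro mult_right_mono mult_left_mono) auto
      finally show ?thesis unfolding S by (simp add: mult_ac)
    qed
    show "globally_lipschitz (\<lambda>q. shear k A (F (unshear k A q)))"
    proof -
      obtain L where L: "L > 0" "\<And>u v. norm (F u - F v) \<le> L * norm (u - v)"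
        using globally_lipschitzE[of F] F unfolding near_linear_def by metis
      show ?thesis
      proof (rule globally_lipschitzI)
        fix u v
        have "norm (shear k A (F (unshear k A u) - F (unshear k A v))) \<le> norm (F (unshear k A u) - F (unshear k A v)) * K1"
          by (rule K1)
        also have "\<dots> \<le> (L * norm (unshear k A (u - v))) * K1"
          using L(2)[of "unshear k A u" "unshear k A v"] K1(1) unfolding U by (intro mult_right_mono) auto
        also have "\<dots> \<le> (L * (norm (u - v) * K2)) * K1"
          using K1(1) K2(2) L(1) by (intro mult_right_mono mult_left_mono) auto
        finally show "norm (shear k A (F (unshear k A u)) - shear k A (F (unshear k A v))) \<le> (L * K1 * K2) * norm (u - v)"
          unfolding S by (simp add: mult_ac)
      qed
    qed
  qed
qed

end

lemma norm_mult_self_real2: "norm p * norm p = p $ 1 * p $ 1 + p $ 2 * p $ 2" for p :: "real^2"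
  using norm_real2[of p] by (simp add: power2_eq_square)

section \<open>Perturbation of the normal forms\<close>

text \<open>For the linear part the angular momentum is exactly \<open>w\<close> times the squared
  norm; the perturbation takes away at most half of it.\<close>

lemma rotating_perturbation:
  assumes G: "globally_lipschitz G" and w: "w > 0"
    and B: "\<And>q. B q $ 1 = m * q $ 1 - w * q $ 2" "\<And>q. B q $ 2 = w * q $ 1 + m * q $ 2"
    and near: "\<And>q. norm (G q - B q) \<le> w / 2 * norm q"
  shows "rotating G"
  unfolding rotating_def
proof (intro conjI exI[of _ "w / 2"] allI)
  show "globally_lipschitz G" "w / 2 > 0" using G w by auto
  have "B 0 = 0" by (simp add: eq_real2 B)
  then show "G 0 = 0" using near[of 0] by simp
  fix p :: "real^2"
  define e where "e = G p - B p"
  define p' :: "real^2" where "p' = vector [- p $ 2, p $ 1]"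
  have n: "norm p' = norm p" by (rule power2_eq_imp_eq) (simp_all add: norm_real2 p'_def vector_2)
  have "\<bar>p' \<bullet> e\<bar> \<le> norm p * norm e" using Cauchy_Schwarz_ineq2[of p' e] n by simp
  also have "\<dots> \<le> norm p * (w / 2 * norm p)" using near[of p] by (intro mult_left_mono) (auto simp: e_def)
  finally have "p' \<bullet> e \<ge> - (w / 2 * (norm p)\<^sup>2)" by (simp add: power2_eq_square mult_ac)
  moreover have "p $ 1 * G p $ 2 - p $ 2 * G p $ 1 = w * (norm p)\<^sup>2 + p' \<bullet> e"
    by (simp add: inner_real2 e_def p'_def vector_2 B norm_mult_self_real2 algebra_simps power2_eq_square)
  ultimately show "w / 2 * (norm p)\<^sup>2 \<le> p $ 1 * G p $ 2 - p $ 2 * G p $ 1" by linarith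
qed

text \<open>The radial bound of the linear part is its smaller eigenvalue \<open>m - w\<close>, and
  its sign conditions on the axes come from the off-diagonal entry \<open>w\<close>. The error
  \<open>\<mu>\<close> stays below both margins.\<close>

lemma source_perturbation:
  assumes G: "globally_lipschitz G" and w: "w > 0" "w < m"
    and B: "\<And>q. B q $ 1 = m * q $ 1 + w * q $ 2" "\<And>q. B q $ 2 = w * q $ 1 + m * q $ 2"
    and near: "\<And>q. norm (G q - B q) \<le> \<mu> * norm q" and \<mu>: "\<mu> < w" "\<mu> < m - w"
  shows "source G"
proof -
  have "B 0 = 0" by (simp add: eq_real2 B)
  then have G0: "G 0 = 0" using near[of 0] by simp
  have comp: "\<bar>G q $ i - B q $ i\<bar> \<le> \<mu> * norm q" for q i
    using component_le_norm_cart[of "G q - B q" i] near[of q] by simp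
  have sign: "x * g > 0" if x: "x \<noteq> 0" and g: "\<bar>g - w * x\<bar> \<le> \<mu> * \<bar>x\<bar>" for x g :: real
  proof -
    have "\<bar>x * (g - w * x)\<bar> \<le> \<bar>x\<bar> * (\<mu> * \<bar>x\<bar>)" unfolding abs_mult using g by (intro mult_left_mono) auto
    moreover have "\<bar>x\<bar> * (\<mu> * \<bar>x\<bar>) = \<mu> * x\<^sup>2" by (simp add: power2_eq_square mult.left_commute)
    ultimately have "x * (g - w * x) \<ge> - (\<mu> * x\<^sup>2)" by linarith
    then have "x * g \<ge> (w - \<mu>) * x\<^sup>2" by (simp add: algebra_simps power2_eq_square)
    moreover have "(w - \<mu>) * x\<^sup>2 > 0" using \<mu> x by simp
    ultimately show ?thesis by linarith
  qed
  have 1: "p $ 1 * G p $ 2 > 0" if p: "p $ 2 = 0" "p $ 1 \<noteq> 0" for p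
  proof (rule sign[OF p(2)])
    have "norm p = \<bar>p $ 1\<bar>" using p(1) by (metis eq_axis_pointI norm_axis_point)
    then show "\<bar>G p $ 2 - w * p $ 1\<bar> \<le> \<mu> * \<bar>p $ 1\<bar>" using comp[of p 2] p(1) by (simp add: B)
  qed
  have 2: "p $ 2 * G p $ 1 > 0" if p: "p $ 1 = 0" "p $ 2 \<noteq> 0" for p
  proof (rule sign[OF p(2)])
    have "norm p = \<bar>p $ 2\<bar>" by (rule power2_eq_imp_eq) (simp_all add: norm_real2 p)
    then show "\<bar>G p $ 1 - w * p $ 2\<bar> \<le> \<mu> * \<bar>p $ 2\<bar>" using comp[of p 1] p(1) by (simp add: B)
  qed
  have 3: "(m - w - \<mu>) * (norm p)\<^sup>2 \<le> p \<bullet> G p" for p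
  proof -
    have "\<bar>p \<bullet> (G p - B p)\<bar> \<le> norm p * (\<mu> * norm p)"
      using Cauchy_Schwarz_ineq2[of p "G p - B p"] mult_left_mono[OF near[of p] norm_ge_zero[of p]] by linarith
    then have e: "p \<bullet> (G p - B p) \<ge> - (\<mu> * (norm p)\<^sup>2)" by (simp add: power2_eq_square mult_ac)
    have "0 \<le> w * (p $ 1 + p $ 2)\<^sup>2" using w by simp
    then have "(m - w) * (norm p)\<^sup>2 \<le> p \<bullet> B p"
      by (simp add: inner_real2 B norm_mult_self_real2 algebra_simps power2_eq_square)
    with e show ?thesis by (simp add: inner_diff_right algebra_simps)
  qed
  show ?thesis unfolding source_def lower_crossing_def
    using G G0 1 2 3 \<mu> by (intro conjI exI[of _ "m - w - \<mu>"]) auto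
qed

lemma Y_fn_nth [simp]: "Y_fn b p $ 1 = 2 * b * p $ 1 + p $ 2" "Y_fn b p $ 2 = p $ 1 + 2 * b * p $ 2"
  by (simp_all add: Y_fn_def vector_2)

lemma globally_lipschitz_bounded_linear: "bounded_linear F \<Longrightarrow> globally_lipschitz F"
proof -
  assume F: "bounded_linear F"
  obtain K where K: "\<And>x. norm (F x) \<le> norm x * K" using bounded_linear.bounded[OF F] by blast
  show ?thesis
    by (rule globally_lipschitzI[of _ K])
      (use K in \<open>simp add: linear_diff[OF bounded_linear.linear[OF F], symmetric] mult.commute\<close>)
qed

lemma bounded_linear_X_fn: "bounded_linear X_fn"
  by (rule linear_real2_bounded[of _ 0 "-1" 1 0]) simp_all

lemma bounded_linear_Y_fn: "bounded_linear (Y_fn b)"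
  by (rule linear_real2_bounded[of _ "2 * b" 1 1 "2 * b"]) simp_all

lemma source_Y_fn: "source (Y_fn 1)"
  by (rule source_perturbation[where B = "Y_fn 1" and m = 2 and w = 1 and \<mu> = "0"])
    (auto intro: globally_lipschitz_bounded_linear bounded_linear_Y_fn)

lemma orbit_equiv_shear:
  assumes k: "k = 1 \<or> k = -1"
    and A: "k * A $ 2 $ 1 > 0" "det_gap A \<noteq> 0" and B: "k * B $ 2 $ 1 > 0" "det_gap B \<noteq> 0"
  defines "\<Lambda> \<equiv> \<lambda>p. if p $ 2 \<ge> 0 then shear k A p else shear k B p"
  shows "orbit_equiv X Y (\<lambda>q. shear k A (X (unshear k A q))) (\<lambda>q. shear k B (Y (unshear k B q))) \<Lambda>"
proof -
  let ?X = "\<lambda>q. shear k A (X (unshear k A q))" and ?Y = "\<lambda>q. shear k B (Y (unshear k B q))"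
  let ?M = "\<lambda>p. if p $ 2 \<ge> 0 then unshear k A p else unshear k B p"
  note SA = shear_sign[OF k A] and SB = shear_sign[OF k B]
  have cont: "continuous_on UNIV (\<lambda>p :: real^2. if p $ 2 \<ge> 0 then f p else g p)"
    if fg: "bounded_linear f" "bounded_linear g" and eq: "\<And>p. p $ 2 = 0 \<Longrightarrow> f p = g p" for f g :: "real^2 \<Rightarrow> real^2"
  proof -
    have "closed {p :: real^2. p $ 2 \<ge> 0}" "closed {p :: real^2. p $ 2 \<le> 0}"
      by (intro closed_Collect_le continuous_intros)+
    then have "continuous_on ({p. p $ 2 \<ge> 0} \<union> {p. p $ 2 \<le> 0}) (\<lambda>p :: real^2. if p $ 2 \<ge> 0 then f p else g p)"
      by (intro continuous_on_If linear_continuous_on fg) (use eq in \<open>auto simp: order_antisym\<close>)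
    moreover have "{p :: real^2. p $ 2 \<ge> 0} \<union> {p. p $ 2 \<le> 0} = UNIV" by auto
    ultimately show ?thesis by simp
  qed
  have c1: "continuous_on UNIV \<Lambda>" unfolding \<Lambda>_def
    by (rule cont[OF bounded_linear_shear[OF k A] bounded_linear_shear[OF k B]]) (simp add: SA(3) SB(3))
  have c2: "continuous_on UNIV ?M"
    by (rule cont[OF bounded_linear_unshear[OF k A] bounded_linear_unshear[OF k B]]) (simp add: SA(6) SB(6))
  have sgA: "shear k A p $ 2 \<ge> 0 \<longleftrightarrow> p $ 2 \<ge> 0" "unshear k A p $ 2 \<ge> 0 \<longleftrightarrow> p $ 2 \<ge> 0" for p
    using SA(2)[of p] SA(5)[of p] by linarith+
  have sgB: "shear k B p $ 2 \<ge> 0 \<longleftrightarrow> p $ 2 \<ge> 0" "unshear k B p $ 2 \<ge> 0 \<longleftrightarrow> p $ 2 \<ge> 0" for p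
    using SB(2)[of p] SB(5)[of p] by linarith+
  show ?thesis
  proof (rule orbit_equiv_bij[OF c1])
    show "\<Lambda> 0 = 0" "?M (\<Lambda> p) = p" "\<Lambda> (?M p) = p" for p
      using SA(3)[of 0] unshear_shear[OF k A] unshear_shear[OF k B] shear_unshear[OF k A] shear_unshear[OF k B] sgA sgB
      by (auto simp: \<Lambda>_def simp del: shear_nth unshear_nth)
    show "\<Lambda> p $ 2 = 0 \<longleftrightarrow> p $ 2 = 0" for p
      using SA(1,2)[of p] SB(1,2)[of p] unfolding \<Lambda>_def by (auto simp del: shear_nth simp: linorder_neq_iff)
    show "cross_traj ?X ?Y (\<Lambda> ` U) I (\<lambda>t. \<Lambda> (g t))" if "cross_traj X Y U I g" for U I g
    proof -
      have "cross_traj ?X ?Y (\<Lambda> ` U) ((\<lambda>t. 1 * t + 0) -` I) (\<lambda>t. \<Lambda> (g (1 * t + 0)))"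
        by (rule cross_traj_conj[OF that _ c1 _ bounded_linear_shear[OF k A] bounded_linear_shear[OF k B]])
          (use SA(1,3) SB(2) unshear_shear[OF k A] unshear_shear[OF k B] in
            \<open>simp_all add: \<Lambda>_def del: shear_nth unshear_nth\<close>)
      then show ?thesis by (simp only: mult_1 add_0_right vimage_ident)
    qed
    show "cross_traj X Y (?M ` U) I (\<lambda>t. ?M (g t))" if "cross_traj ?X ?Y U I g" for U I g
    proof -
      have "cross_traj X Y (?M ` U) ((\<lambda>t. 1 * t + 0) -` I) (\<lambda>t. ?M (g (1 * t + 0)))"
        by (rule cross_traj_conj[OF that _ c2 _ bounded_linear_unshear[OF k A] bounded_linear_unshear[OF k B]])
          (use SA(4,6) SB(5) unshear_shear[OF k A] unshear_shear[OF k B] in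
            \<open>simp_all del: shear_nth unshear_nth\<close>)
      then show ?thesis by (simp only: mult_1 add_0_right vimage_ident)
    qed
  qed
qed

lemma sgn_cases:
  assumes "(x::real) \<noteq> 0"
  shows "sgn x = 1 \<or> sgn x = -1" "sgn x * x > 0"
  using assms by (auto simp: sgn_real_def)

text \<open>Positive determinant and positive trace make both real eigenvalues
  \<open>mB + wB\<close> and \<open>mB - wB\<close> positive, which is the condition
  \<open>wB < mB\<close> of \<open>source_perturbation\<close>.\<close>

lemma orbit_equiv_focus_source:
  assumes cc: "A $ 2 $ 1 * B $ 2 $ 1 > 0" and A: "det_gap A < 0"
    and B: "det_gap B > 0" "det B > 0" "B $ 1 $ 1 + B $ 2 $ 2 > 0"
  shows "\<exists>\<delta>>0. \<forall>X Y. near_linear \<delta> A X \<and> near_linear \<delta> B Y \<longrightarrow> (\<exists>H. orbit_equiv X Y X_fn (Y_fn 1) H)"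
proof -
  define k where "k = sgn (A $ 2 $ 1)"
  have "A $ 2 $ 1 \<noteq> 0" "B $ 2 $ 1 \<noteq> 0" using cc by auto
  have k: "k = 1 \<or> k = -1" "k * A $ 2 $ 1 > 0"
    unfolding k_def using sgn_cases[OF \<open>A $ 2 $ 1 \<noteq> 0\<close>] by auto
  have kB: "k * B $ 2 $ 1 > 0"
    using cc unfolding k_def by (auto simp: sgn_real_def zero_less_mult_iff)
  have gA: "det_gap A \<noteq> 0" and gB: "det_gap B \<noteq> 0" using A B by auto
  define wA where "wA = sqrt \<bar>det_gap A\<bar> / 2"
  define wB where "wB = sqrt \<bar>det_gap B\<bar> / 2"
  define mA where "mA = (A $ 1 $ 1 + A $ 2 $ 2) / 2"
  define mB where "mB = (B $ 1 $ 1 + B $ 2 $ 2) / 2"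
  have w: "wA > 0" "wB > 0" using gA gB by (auto simp: wA_def wB_def)
  have "wB < mB"
  proof -
    have "\<bar>det_gap B\<bar> < (B $ 1 $ 1 + B $ 2 $ 2)\<^sup>2" using B(1,2) by (simp add: det_gap_def)
    then have "sqrt \<bar>det_gap B\<bar> < B $ 1 $ 1 + B $ 2 $ 2" using B(3) by (intro real_less_lsqrt) auto
    then show ?thesis by (simp add: wB_def mB_def)
  qed
  obtain KA where "KA > 0" and KA': "\<forall>\<delta> F. near_linear \<delta> A F \<longrightarrow>
      globally_lipschitz (\<lambda>q. shear k A (F (unshear k A q))) \<and>
      (0 \<le> \<delta> \<longrightarrow> (\<forall>q. norm (shear k A (F (unshear k A q)) - shear k A (A *v unshear k A q)) \<le> KA * \<delta> * norm q))"
    using shear_near_linear[OF k gA] by blast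
  have KA: "KA > 0" "\<And>\<delta> F q. near_linear \<delta> A F \<Longrightarrow> 0 \<le> \<delta> \<Longrightarrow>
      norm (shear k A (F (unshear k A q)) - shear k A (A *v unshear k A q)) \<le> KA * \<delta> * norm q"
      "\<And>\<delta> F. near_linear \<delta> A F \<Longrightarrow> globally_lipschitz (\<lambda>q. shear k A (F (unshear k A q)))"
    using \<open>KA > 0\<close> KA' by blast+
  obtain KB where "KB > 0" and KB': "\<forall>\<delta> F. near_linear \<delta> B F \<longrightarrow>
      globally_lipschitz (\<lambda>q. shear k B (F (unshear k B q))) \<and>
      (0 \<le> \<delta> \<longrightarrow> (\<forall>q. norm (shear k B (F (unshear k B q)) - shear k B (B *v unshear k B q)) \<le> KB * \<delta> * norm q))"
    using shear_near_linear[OF k(1) kB gB] by blast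
  have KB: "KB > 0" "\<And>\<delta> F q. near_linear \<delta> B F \<Longrightarrow> 0 \<le> \<delta> \<Longrightarrow>
      norm (shear k B (F (unshear k B q)) - shear k B (B *v unshear k B q)) \<le> KB * \<delta> * norm q"
      "\<And>\<delta> F. near_linear \<delta> B F \<Longrightarrow> globally_lipschitz (\<lambda>q. shear k B (F (unshear k B q)))"
    using \<open>KB > 0\<close> KB' by blast+
  define \<mu> where "\<mu> = min (wB / 2) ((mB - wB) / 2)"
  have \<mu>: "\<mu> > 0" "\<mu> < wB" "\<mu> < mB - wB" using w \<open>wB < mB\<close> by (auto simp: \<mu>_def min_def)
  \<comment> \<open>Conjugation by the shears multiplies the errors by at most \<open>KA\<close> and
    \<open>KB\<close>.\<close>
  define \<delta> where "\<delta> = min (wA / 2 / KA) (\<mu> / KB)"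
  have \<delta>: "\<delta> > 0" "KA * \<delta> \<le> wA / 2" "KB * \<delta> \<le> \<mu>"
  proof -
    show "\<delta> > 0" using w \<mu>(1) KA(1) KB(1) by (auto simp: \<delta>_def)
    have "\<delta> \<le> wA / 2 / KA" "\<delta> \<le> \<mu> / KB" by (auto simp: \<delta>_def)
    then show "KA * \<delta> \<le> wA / 2" "KB * \<delta> \<le> \<mu>"
      using KA(1) KB(1) by (simp_all add: pos_le_divide_eq mult_ac)
  qed
  have "\<exists>H. orbit_equiv X Y X_fn (Y_fn 1) H" if X: "near_linear \<delta> A X" and Y: "near_linear \<delta> B Y" for X Y
  proof -
    let ?X = "\<lambda>q. shear k A (X (unshear k A q))" and ?Y = "\<lambda>q. shear k B (Y (unshear k B q))"
    have rX: "rotating ?X"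
    proof (rule rotating_perturbation[where B = "\<lambda>q. shear k A (A *v unshear k A q)" and m = mA and w = wA])
      show "globally_lipschitz ?X" by (rule KA(3)[OF X])
      show "norm (?X q - shear k A (A *v unshear k A q)) \<le> wA / 2 * norm q" for q
        by (rule order_trans[OF KA(2)[OF X less_imp_le[OF \<delta>(1)]] mult_right_mono[OF \<delta>(2) norm_ge_zero]])
    qed (use shear_normal_form[OF k gA, folded mA_def wA_def] A w in \<open>auto simp del: shear_nth unshear_nth\<close>)
    have sY: "source ?Y"
    proof (rule source_perturbation[where B = "\<lambda>q. shear k B (B *v unshear k B q)" and m = mB and w = wB and \<mu> = \<mu>])
      show "globally_lipschitz ?Y" by (rule KB(3)[OF Y])
      show "norm (?Y q - shear k B (B *v unshear k B q)) \<le> \<mu> * norm q" for q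
        by (rule order_trans[OF KB(2)[OF Y less_imp_le[OF \<delta>(1)]] mult_right_mono[OF \<delta>(3) norm_ge_zero]])
    qed (use shear_normal_form[OF k(1) kB gB, folded mB_def wB_def] B w \<mu> \<open>wB < mB\<close> in
        \<open>auto simp del: shear_nth unshear_nth\<close>)
    from orbit_equiv_trans[OF orbit_equiv_shear[OF k gA kB gB] orbit_equiv_glue_map[OF rX sY source_Y_fn]] show ?thesis by blast
  qed
  with \<delta>(1) show ?thesis by blast
qed

section \<open>The remaining cases by symmetry\<close>

lemma near_linear_uminus:
  assumes "near_linear \<delta> A F"
  shows "near_linear \<delta> (- A) (\<lambda>p. - F p)"
proof -
  obtain L where L: "\<And>u v. norm (F u - F v) \<le> L * norm (u - v)"
    using globally_lipschitzE[of F] assms unfolding near_linear_def by metis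
  have "norm (- F u - - F v) \<le> L * norm (u - v)" for u v
    using L[of u v] by (metis minus_diff_minus norm_minus_cancel)
  then have "globally_lipschitz (\<lambda>p. - F p)" by (rule globally_lipschitzI)
  moreover have "norm (- F p - - A *v p) \<le> \<delta> * norm p" for p
  proof -
    have "- F p - - A *v p = - (F p - A *v p)" by (simp add: eq_real2 matrix_vector_mult_def sum_2)
    then show ?thesis using assms unfolding near_linear_def by (metis norm_minus_cancel)
  qed
  ultimately show ?thesis unfolding near_linear_def by blast
qed

text \<open>Reversing time in the model with parameter -1 gives the reflected model with parameter
  1.\<close>

lemma orbit_equiv_mirror: "orbit_equiv X_fn (Y_fn 1) (\<lambda>p. - X_fn p) (\<lambda>p. - Y_fn (-1) p) mirror"
proof (rule orbit_equiv_bij[where \<Lambda>' = mirror])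
  have c: "continuous_on UNIV mirror" by (intro linear_continuous_on bounded_linear_mirror)
  then show "continuous_on UNIV mirror" .
  show "cross_traj (\<lambda>p. - X_fn p) (\<lambda>p. - Y_fn (-1) p) (mirror ` U) I (\<lambda>t. mirror (g t))" if "cross_traj X_fn (Y_fn 1) U I g" for U I g
  proof -
    have "cross_traj (\<lambda>p. - X_fn p) (\<lambda>p. - Y_fn (-1) p) (mirror ` U) ((\<lambda>t. 1 * t + 0) -` I) (\<lambda>t. mirror (g (1 * t + 0)))"
      by (rule cross_traj_conj[OF that _ c _ bounded_linear_mirror bounded_linear_mirror]) (simp_all add: eq_real2)
    then show ?thesis by simp
  qed
  show "cross_traj X_fn (Y_fn 1) (mirror ` U) I (\<lambda>t. mirror (g t))" if "cross_traj (\<lambda>p. - X_fn p) (\<lambda>p. - Y_fn (-1) p) U I g" for U I g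
  proof -
    have "cross_traj X_fn (Y_fn 1) (mirror ` U) ((\<lambda>t. 1 * t + 0) -` I) (\<lambda>t. mirror (g (1 * t + 0)))"
      by (rule cross_traj_conj[OF that _ c _ bounded_linear_mirror bounded_linear_mirror]) (simp_all add: eq_real2)
    then show ?thesis by simp
  qed
qed simp_all

text \<open>The trace cannot vanish, since discriminant and determinant are both positive. For
  negative trace time reversal turns the sink into a source, and the reflection of the model
  restores the reversed model with parameter -1.\<close>

lemma orbit_equiv_focus_node:
  assumes cc: "A $ 2 $ 1 * B $ 2 $ 1 > 0" and A: "det_gap A < 0"
    and B: "det_gap B > 0" "det B > 0" and b: "b = sgn (B $ 1 $ 1 + B $ 2 $ 2)"
  shows "\<exists>\<delta>>0. \<forall>X Y. near_linear \<delta> A X \<and> near_linear \<delta> B Y \<longrightarrow> (\<exists>H. orbit_equiv X Y X_fn (Y_fn b) H)"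
proof -
  have "B $ 1 $ 1 + B $ 2 $ 2 \<noteq> 0" using B by (auto simp: det_gap_def)
  then consider "B $ 1 $ 1 + B $ 2 $ 2 > 0" "b = 1" | "B $ 1 $ 1 + B $ 2 $ 2 < 0" "b = -1"
    using b by (cases "B $ 1 $ 1 + B $ 2 $ 2 > 0") auto
  then show ?thesis
  proof cases
    case 1
    then show ?thesis using orbit_equiv_focus_source[OF cc A B] by simp
  next
    case 2
    have "det_gap (- A) < 0" "det_gap (- B) > 0" "det (- B) > 0" "(- A) $ 2 $ 1 * (- B) $ 2 $ 1 > 0"
      "(- B) $ 1 $ 1 + (- B) $ 2 $ 2 > 0"
      using A B cc 2(1) by (simp_all add: det_gap_eq det_2 power2_commute)
    then obtain \<delta> where \<delta>: "\<delta> > 0"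
      "\<And>X Y. near_linear \<delta> (- A) X \<and> near_linear \<delta> (- B) Y \<Longrightarrow> \<exists>H. orbit_equiv X Y X_fn (Y_fn 1) H"
      using orbit_equiv_focus_source[of "- A" "- B"] by blast
    have "\<exists>H. orbit_equiv X Y X_fn (Y_fn b) H" if X: "near_linear \<delta> A X" and Y: "near_linear \<delta> B Y" for X Y
    proof -
      obtain H where "orbit_equiv (\<lambda>p. - X p) (\<lambda>p. - Y p) X_fn (Y_fn 1) H"
        using \<delta>(2) near_linear_uminus[OF X] near_linear_uminus[OF Y] by blast
      from orbit_equiv_reverse[OF orbit_equiv_trans[OF this orbit_equiv_mirror]] show ?thesis using 2(2) by blast
    qed
    with \<delta>(1) show ?thesis by blast
  qed
qed

lemma orbit_equiv_flip: "orbit_equiv X Y (\<lambda>p. - Y (- p)) (\<lambda>p. - X (- p)) uminus"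
proof (rule orbit_equiv_bij[where \<Lambda>' = uminus])
  show "continuous_on UNIV (uminus :: real^2 \<Rightarrow> _)" by (intro continuous_intros)
  show "cross_traj (\<lambda>p. - Y (- p)) (\<lambda>p. - X (- p)) (uminus ` U) I (\<lambda>t. - g t)" if "cross_traj X Y U I g" for U I g
    by (rule cross_traj_flip[OF that])
  show "cross_traj X Y (uminus ` U) I (\<lambda>t. - g t)" if "cross_traj (\<lambda>p. - Y (- p)) (\<lambda>p. - X (- p)) U I g" for U I g
    using cross_traj_flip[OF that] by simp
qed simp_all

lemma near_linear_flip:
  assumes "near_linear \<delta> A F"
  shows "near_linear \<delta> A (\<lambda>p. - F (- p))"
proof -
  obtain L where L: "\<And>u v. norm (F u - F v) \<le> L * norm (u - v)"
    using globally_lipschitzE[of F] assms unfolding near_linear_def by metis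
  have "norm (- F (- u) - - F (- v)) \<le> L * norm (u - v)" for u v
    using L[of "- v" "- u"] by (simp add: norm_minus_commute)
  then have "globally_lipschitz (\<lambda>p. - F (- p))" by (rule globally_lipschitzI)
  moreover have "norm (- F (- p) - A *v p) \<le> \<delta> * norm p" for p
  proof -
    have "- F (- p) - A *v p = - (F (- p) - A *v (- p))" by (simp add: eq_real2 matrix_vector_mult_def sum_2)
    then show ?thesis using assms unfolding near_linear_def by (metis norm_minus_cancel)
  qed
  ultimately show ?thesis unfolding near_linear_def by blast
qed

text \<open>The half turn exchanges the two half planes, so that the focus comes to lie above the
  line.\<close>

lemma orbit_equiv_node_focus:
  assumes cc: "A $ 2 $ 1 * B $ 2 $ 1 > 0" and B: "det_gap B < 0"
    and A: "det_gap A > 0" "det A > 0" and b: "b = sgn (A $ 1 $ 1 + A $ 2 $ 2)"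
  shows "\<exists>\<delta>>0. \<forall>X Y. near_linear \<delta> A X \<and> near_linear \<delta> B Y \<longrightarrow> (\<exists>H. orbit_equiv X Y X_fn (Y_fn b) H)"
proof -
  have "B $ 2 $ 1 * A $ 2 $ 1 > 0" using cc by (simp add: mult.commute)
  from orbit_equiv_focus_node[OF this B A b] obtain \<delta> where \<delta>: "\<delta> > 0"
    "\<And>X Y. near_linear \<delta> B X \<and> near_linear \<delta> A Y \<Longrightarrow> \<exists>H. orbit_equiv X Y X_fn (Y_fn b) H" by blast
  have "\<exists>H. orbit_equiv X Y X_fn (Y_fn b) H" if X: "near_linear \<delta> A X" and Y: "near_linear \<delta> B Y" for X Y
  proof -
    obtain H where "orbit_equiv (\<lambda>p. - Y (- p)) (\<lambda>p. - X (- p)) X_fn (Y_fn b) H"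
      using \<delta>(2) near_linear_flip[OF X] near_linear_flip[OF Y] by blast
    from orbit_equiv_trans[OF orbit_equiv_flip this] show ?thesis by blast
  qed
  with \<delta>(1) show ?thesis by blast
qed

section \<open>The eigenvalue conditions and the local equivalence\<close>

text \<open>The two monic quadratic polynomials are compared at \<open>z = 0\<close> and
  \<open>z = 1\<close>.\<close>

lemma eigenvalues_of_iff:
  "eigenvalues_of A l1 l2 \<longleftrightarrow>
    l1 + l2 = complex_of_real (A $ 1 $ 1 + A $ 2 $ 2) \<and> l1 * l2 = complex_of_real (det A)"
proof -
  let ?t = "complex_of_real (A $ 1 $ 1 + A $ 2 $ 2)" and ?d = "complex_of_real (det A)"
  have char: "det (mat z - (\<chi> i j. complex_of_real (A $ i $ j))) = z * z - ?t * z + ?d" for z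
    by (simp add: det_2 mat_def algebra_simps)
  show ?thesis
  proof
    assume "eigenvalues_of A l1 l2"
    then have *: "z * z - ?t * z + ?d = (z - l1) * (z - l2)" for z
      unfolding eigenvalues_of_def char by blast
    have d: "l1 * l2 = ?d" using *[of 0] by simp
    then have "l1 + l2 = ?t" using *[of 1] by (simp add: algebra_simps)
    with d show "l1 + l2 = ?t \<and> l1 * l2 = ?d" by blast
  next
    assume "l1 + l2 = ?t \<and> l1 * l2 = ?d"
    then have "z * z - ?t * z + ?d = z * z - (l1 + l2) * z + l1 * l2" for z by simp
    then show "eigenvalues_of A l1 l2" unfolding eigenvalues_of_def char by (simp add: algebra_simps)
  qed
qed

lemma eigenvalues_gap:
  assumes "eigenvalues_of A l1 l2"
  shows "(l1 - l2)\<^sup>2 = complex_of_real (det_gap A)"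
proof -
  have e: "l1 + l2 = complex_of_real (A $ 1 $ 1 + A $ 2 $ 2)" "l1 * l2 = complex_of_real (det A)"
    using assms unfolding eigenvalues_of_iff by auto
  have "(l1 - l2)\<^sup>2 = (l1 + l2)\<^sup>2 - 4 * (l1 * l2)" by (simp add: power2_eq_square algebra_simps)
  also have "\<dots> = complex_of_real (det_gap A)" unfolding e det_gap_def by simp
  finally show ?thesis .
qed

text \<open>The sum of the eigenvalues is real, so one is real exactly when the other is; the square
  of their difference is the nonzero real number \<open>det_gap A\<close>.\<close>

lemma real_eigenvalues_iff:
  assumes l: "eigenvalues_of A l1 l2" and ne: "l1 \<noteq> l2"
  shows "l1 \<in> \<real> \<and> l2 \<in> \<real> \<longleftrightarrow> det_gap A > 0" "l1 \<notin> \<real> \<and> l2 \<notin> \<real> \<longleftrightarrow> det_gap A < 0" "det_gap A \<noteq> 0"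
proof -
  note gap = eigenvalues_gap[OF l]
  show nz: "det_gap A \<noteq> 0" using gap ne by auto
  have sum: "l1 + l2 \<in> \<real>" using l unfolding eigenvalues_of_iff by simp
  have both: "l1 \<in> \<real> \<longleftrightarrow> l2 \<in> \<real>"
    using sum Reals_diff[OF sum, of l1] Reals_diff[OF sum, of l2] by auto
  have pos: "l1 \<in> \<real>" if "det_gap A > 0"
  proof -
    have "(l1 - l2)\<^sup>2 = (complex_of_real (sqrt (det_gap A)))\<^sup>2"
      unfolding gap using that by (simp flip: of_real_power)
    then have "l1 - l2 \<in> \<real>" unfolding power2_eq_iff by auto
    from Reals_add[OF sum this] have "2 * l1 \<in> \<real>" by (simp add: algebra_simps)
    then have "2 * l1 / 2 \<in> \<real>" by (intro Reals_divide) auto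
    then show ?thesis by simp
  qed
  have neg: "det_gap A > 0" if real: "l1 \<in> \<real>"
  proof -
    obtain x y where "l1 = complex_of_real x" "l2 = complex_of_real y" using real both by (auto elim!: Reals_cases)
    then have "complex_of_real (det_gap A) = complex_of_real ((x - y)\<^sup>2)" using gap by simp
    then have "det_gap A = (x - y)\<^sup>2" using of_real_eq_iff by blast
    then show ?thesis using nz by (metis zero_le_power2 less_le)
  qed
  show "l1 \<in> \<real> \<and> l2 \<in> \<real> \<longleftrightarrow> det_gap A > 0" using both pos neg by blast
  show "l1 \<notin> \<real> \<and> l2 \<notin> \<real> \<longleftrightarrow> det_gap A < 0" using both pos neg nz by (metis linorder_neqE_linordered_idom less_asym)
qed

lemma jacobian_linear:
  assumes "bounded_linear F"
  shows "jacobian F (at p) = matrix F" "F differentiable (at p)"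
proof -
  have d: "(F has_derivative F) (at p)" by (rule bounded_linear_imp_has_derivative[OF assms])
  then show "F differentiable (at p)" by (rule differentiableI)
  show "jacobian F (at p) = matrix F" unfolding jacobian_def frechet_derivative_at[OF d, symmetric] ..
qed

lemma matrix_nth: "matrix F $ i $ j = F (axis j 1) $ i"
  by (simp add: matrix_def)

lemma matrix_X_fn:
  "matrix X_fn $ 1 $ 1 = 0" "matrix X_fn $ 1 $ 2 = -1" "matrix X_fn $ 2 $ 1 = 1" "matrix X_fn $ 2 $ 2 = 0"
  by (simp_all add: matrix_nth axis_def)

lemma matrix_Y_fn:
  "matrix (Y_fn b) $ 1 $ 1 = 2 * b" "matrix (Y_fn b) $ 1 $ 2 = 1" "matrix (Y_fn b) $ 2 $ 1 = 1" "matrix (Y_fn b) $ 2 $ 2 = 2 * b"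
  by (simp_all add: matrix_nth axis_def)

text \<open>The eigenvalues are plus and minus the imaginary unit above, and
  \<open>2 * b + 1\<close> and \<open>2 * b - 1\<close> below, with product 3.\<close>

lemma model_in_Omega_fn:
  assumes b: "b = 1 \<or> b = -1"
  shows "(X_fn, Y_fn b) \<in> Omega_fn D"
proof -
  note lin = bounded_linear_X_fn bounded_linear_Y_fn[of b]
  have C1: "X_fn \<in> C1_fields D" "Y_fn b \<in> C1_fields D"
    using jacobian_linear[OF lin(1)] jacobian_linear[OF lin(2)] by (auto simp: C1_fields_def)
  have dX: "det (matrix X_fn) = 1" and dY: "det (matrix (Y_fn b)) = 3"
    using b by (auto simp: det_2 matrix_X_fn matrix_Y_fn)
  have eX: "eigenvalues_of (matrix X_fn) \<i> (- \<i>)"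
    unfolding eigenvalues_of_iff by (simp add: dX matrix_X_fn)
  have eY: "eigenvalues_of (matrix (Y_fn b)) (of_real (2 * b + 1)) (of_real (2 * b - 1))"
    unfolding eigenvalues_of_iff using b by (auto simp: dY matrix_Y_fn)
  have Om0: "(X_fn, Y_fn b) \<in> Omega0 D"
    unfolding Omega0_def Omega_def
    using C1 by (simp add: jacobian_linear lin dX dY matrix_X_fn matrix_Y_fn eq_real2)
  note jac = jacobian_linear(1)[OF lin(1)] jacobian_linear(1)[OF lin(2)]
  let ?p = "complex_of_real (2 * b + 1)" and ?q = "complex_of_real (2 * b - 1)"
  have "ell \<i> ?p \<noteq> 0" "\<i> \<noteq> - \<i>" "?p \<noteq> ?q"
    by (auto simp: ell_def complex_eq_iff)
  then have Om1: "(X_fn, Y_fn b) \<in> Omega1 D"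
    unfolding Omega1_def mem_Collect_eq prod.case jac using Om0 eX eY by blast
  have "Re (?p * ?q) > 0" using b by auto
  moreover have "\<i> \<notin> \<real>" "- \<i> \<notin> \<real>" by (auto simp: complex_is_Real_iff)
  ultimately show ?thesis
    unfolding Omega_fn_def mem_Collect_eq prod.case jac using Om1 eX eY Reals_of_real by blast
qed

section \<open>From Filippov trajectories to crossing trajectories\<close>

text \<open>At points of the line in \<open>U\<close> other than the origin the Filippov field has a
  nonzero second component, whereas along an arc inside the line the second coordinate has
  derivative zero. Only the rest at the origin remains.\<close>

lemma trajectory_in_iff_cross_traj:
  assumes U: "U \<subseteq> D" and XF: "\<And>p. p \<in> U \<Longrightarrow> F p = X p" "\<And>p. p \<in> U \<Longrightarrow> G p = Y p"
    and cross: "\<And>p. p \<in> U \<Longrightarrow> p $ 2 = 0 \<Longrightarrow> p \<noteq> 0 \<Longrightarrow> X p $ 2 * Y p $ 2 > 0"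
    and zero: "X 0 = 0" "Y 0 = 0" and D: "0 \<in> D"
  shows "trajectory_in D (X, Y) U I g \<longleftrightarrow> cross_traj F G U I g"
proof -
  let ?Z = "filippov_field D (X, Y)"
  have z0: "?Z 0 = 0"
    unfolding filippov_field_def Let_def crossing_set_def using zero by simp
  have Znz: "?Z p $ 2 \<noteq> 0" if "p \<in> U" "p $ 2 = 0" "p \<noteq> 0" for p
  proof -
    have c: "X p $ 2 * Y p $ 2 > 0" using cross that by blast
    then have "X p $ 2 \<noteq> 0" "Y p $ 2 \<noteq> 0" by auto
    moreover have "p \<in> crossing_set D (X, Y)"
      using c that U by (auto simp: crossing_set_def switching_line_def)
    ultimately show ?thesis unfolding filippov_field_def Let_def by simp
  qed
  have arcs: "(solution_arc X (upper_part D) {a<..<b} g \<or> solution_arc Y (lower_part D) {a<..<b} g \<or>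
      solution_arc ?Z (switching_line D) {a<..<b} g) \<longleftrightarrow> traj_arc F G {a<..<b} g"
    if g: "g ` {a<..<b} \<subseteq> U" for a b
  proof -
    have gU: "g t \<in> U" if "t \<in> {a<..<b}" for t using g that by blast
    have 1: "solution_arc X (upper_part D) {a<..<b} g \<longleftrightarrow> solution_arc F {p. p $ 2 > 0} {a<..<b} g"
      unfolding solution_arc_def upper_part_def using gU U XF(1) by auto
    have 2: "solution_arc Y (lower_part D) {a<..<b} g \<longleftrightarrow> solution_arc G {p. p $ 2 < 0} {a<..<b} g"
      unfolding solution_arc_def lower_part_def using gU U XF(2) by auto
    have 3: "solution_arc ?Z (switching_line D) {a<..<b} g \<longleftrightarrow> solution_arc (\<lambda>_. 0) {0} {a<..<b} g"
    proof
      assume "solution_arc (\<lambda>_. 0) {0} {a<..<b} g"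
      then show "solution_arc ?Z (switching_line D) {a<..<b} g"
        unfolding solution_arc_def using z0 D by (auto simp: switching_line_def)
    next
      assume s: "solution_arc ?Z (switching_line D) {a<..<b} g"
      have g0: "g t = 0" if t: "t \<in> {a<..<b}" for t
      proof (rule ccontr)
        assume "g t \<noteq> 0"
        have y: "g r $ 2 = 0" if "r \<in> {a<..<b}" for r
          using s that by (auto simp: solution_arc_def switching_line_def)
        have "(g has_vector_derivative ?Z (g t)) (at t)" using s t by (auto simp: solution_arc_def)
        from has_derivative_component[OF this, of 2]
        have "((\<lambda>_. 0) has_real_derivative ?Z (g t) $ 2) (at t)"
          by (rule has_field_derivative_transform_within_open[OF _ open_greaterThanLessThan t]) (simp add: y)
        then have "?Z (g t) $ 2 = 0" using DERIV_unique DERIV_const by blast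
        then show False using Znz[of "g t"] gU[OF t] y[OF t] \<open>g t \<noteq> 0\<close> by blast
      qed
      then show "solution_arc (\<lambda>_. 0) {0} {a<..<b} g"
        using s z0 unfolding solution_arc_def by fastforce
    qed
    show ?thesis unfolding traj_arc_def 1 2 3 ..
  qed
  show ?thesis
  proof (cases "g ` I \<subseteq> U")
    case True
    have eq: "(\<forall>a b. {a<..<b} \<subseteq> I \<and> {a<..<b} \<inter> S = {} \<longrightarrow>
        solution_arc X (upper_part D) {a<..<b} g \<or> solution_arc Y (lower_part D) {a<..<b} g \<or>
        solution_arc ?Z (switching_line D) {a<..<b} g) \<longleftrightarrow>
      (\<forall>a b. {a<..<b} \<subseteq> I \<and> {a<..<b} \<inter> S = {} \<longrightarrow> traj_arc F G {a<..<b} g)" for S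
    proof (intro all_cong1 imp_cong refl)
      fix a b assume "{a<..<b} \<subseteq> I \<and> {a<..<b} \<inter> S = {}"
      then have "g ` {a<..<b} \<subseteq> U" using True by (meson image_mono subset_trans)
      then show "(solution_arc X (upper_part D) {a<..<b} g \<or> solution_arc Y (lower_part D) {a<..<b} g \<or>
        solution_arc ?Z (switching_line D) {a<..<b} g) \<longleftrightarrow> traj_arc F G {a<..<b} g" by (rule arcs)
    qed
    show ?thesis unfolding trajectory_in_def cross_traj_def fst_conv snd_conv eq ..
  next
    case False
    then show ?thesis unfolding trajectory_in_def cross_traj_def by simp
  qed
qed

lemma orbit_in_iff_max_traj:
  assumes "\<And>I g. trajectory_in D (X, Y) U I g \<longleftrightarrow> cross_traj F G U I g"
  shows "orbit_in D (X, Y) U I g \<longleftrightarrow> max_traj F G U I g"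
  unfolding orbit_in_def max_traj_def assms ..

text \<open>The ball \<open>U\<close> is taken so small that its image stays where \<open>F'\<close>
  and \<open>G'\<close> agree with \<open>X'\<close> and \<open>Y'\<close>; invariance of domain
  makes this image a neighbourhood of the origin.\<close>

lemma locally_Sigma_equivalentI:
  assumes D: "open D" "0 \<in> D" and H: "orbit_equiv F G F' G' H"
    and e: "e > 0" "ball 0 e \<subseteq> D" and e': "e' > 0" "ball 0 e' \<subseteq> D"
    and Z: "\<And>p. p \<in> ball 0 e \<Longrightarrow> F p = X p \<and> G p = Y p" "X 0 = 0" "Y 0 = 0"
      "\<And>p. p \<in> ball 0 e \<Longrightarrow> p $ 2 = 0 \<Longrightarrow> p \<noteq> 0 \<Longrightarrow> X p $ 2 * Y p $ 2 > 0"
    and Z': "\<And>p. p \<in> ball 0 e' \<Longrightarrow> F' p = X' p \<and> G' p = Y' p" "X' 0 = 0" "Y' 0 = 0"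
      "\<And>p. p \<in> ball 0 e' \<Longrightarrow> p $ 2 = 0 \<Longrightarrow> p \<noteq> 0 \<Longrightarrow> X' p $ 2 * Y' p $ 2 > 0"
  shows "locally_Sigma_equivalent D (X, Y) (X', Y')"
proof -
  note Hp = orbit_equivD[OF H]
  have "isCont H 0" using Hp(1) by (simp add: continuous_on_eq_continuous_at)
  then obtain d where d: "d > 0" "\<And>p. dist p 0 < d \<Longrightarrow> dist (H p) (H 0) < e'"
    unfolding continuous_at_eps_delta using e'(1) by blast
  define U where "U = ball (0 :: real^2) (min d e)"
  have U: "open U" "0 \<in> U" "U \<subseteq> ball 0 e" using d(1) e(1) by (auto simp: U_def)
  have V: "H ` U \<subseteq> ball 0 e'" using d(2) Hp(3) by (auto simp: U_def dist_commute)
  have inj: "inj_on H U" and cont: "continuous_on U H"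
    using Hp(1,2) by (auto intro: inj_on_subset continuous_on_subset)
  have "open (H ` U)" by (rule invariance_of_domain[OF cont U(1) inj])
  obtain H' where H': "homeomorphism U (H ` U) H H'"
    using invariance_of_domain_homeomorphism[OF U(1) cont _ inj] by auto
  have o1: "orbit_in D (X, Y) U I g \<longleftrightarrow> max_traj F G U I g" for I g
    by (intro orbit_in_iff_max_traj trajectory_in_iff_cross_traj) (use U(3) e Z D in auto)
  have o2: "orbit_in D (X', Y') (H ` U) J k \<longleftrightarrow> max_traj F' G' (H ` U) J k" for J k
    by (intro orbit_in_iff_max_traj trajectory_in_iff_cross_traj) (use V e' Z' D in auto)
  have UD: "U \<subseteq> D" "H ` U \<subseteq> D" using U(3) V e(2) e'(2) by blast+
  have H0: "0 \<in> H ` U" using Hp(3) U(2) by (metis imageI)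
  have line: "H ` (switching_line D \<inter> U) = switching_line D \<inter> H ` U"
    using Hp(4) UD unfolding switching_line_def by blast
  show ?thesis unfolding locally_Sigma_equivalent_def
  proof (rule exI[of _ U], rule exI[of _ "H ` U"], rule exI[of _ H], rule exI[of _ H'], intro conjI allI impI)
    show "\<exists>J k. orbit_in D (X', Y') (H ` U) J k \<and> carries_onto H I g J k" if "orbit_in D (X, Y) U I g" for I g
      using Hp(5) that unfolding o1 o2 by blast
    show "\<exists>I g. orbit_in D (X, Y) U I g \<and> carries_onto H I g J k" if "orbit_in D (X', Y') (H ` U) J k" for J k
      using Hp(6) that unfolding o1 o2 by blast
  qed (fact U(1,2) UD H0 \<open>open (H ` U)\<close> H' line)+
qed

text \<open>On the line the second component of the linear part is \<open>A $ 2 $ 1 * p $ 1\<close>,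
  and the error is smaller than its modulus.\<close>

lemma near_linear_axis_sign:
  assumes F: "near_linear \<delta> A F" and \<delta>: "\<delta> < \<bar>A $ 2 $ 1\<bar>" and p: "p $ 2 = 0" "p \<noteq> 0"
  shows "A $ 2 $ 1 * p $ 1 * F p $ 2 > 0"
proof -
  have x: "p $ 1 \<noteq> 0" using p by (auto simp: eq_real2)
  have n: "norm p = \<bar>p $ 1\<bar>" using p(1) by (metis eq_axis_pointI norm_axis_point)
  define y where "y = A $ 2 $ 1 * p $ 1"
  have y: "(A *v p) $ 2 = y" using p(1) by (simp add: matrix_vector_mult_def sum_2 y_def)
  have "\<bar>F p $ 2 - y\<bar> \<le> norm (F p - A *v p)" using component_le_norm_cart[of "F p - A *v p" 2] y by simp
  also have "\<dots> \<le> \<delta> * \<bar>p $ 1\<bar>" using F n unfolding near_linear_def by metis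
  also have "\<dots> < \<bar>A $ 2 $ 1\<bar> * \<bar>p $ 1\<bar>" using \<delta> x by (intro mult_strict_right_mono) auto
  finally have "\<bar>F p $ 2 - y\<bar> < \<bar>y\<bar>" by (simp add: y_def abs_mult)
  then have "y * F p $ 2 > 0" by (auto simp: abs_if zero_less_mult_iff split: if_splits)
  then show ?thesis by (simp add: y_def)
qed

theorem lemma3p3:
  fixes D :: "(real^2) set"
    and X Y :: "real^2 \<Rightarrow> real^2"
    and l1p l2p l1m l2m :: complex
    and \<beta> :: real
  assumes "open D" and "bounded D" and "0 \<in> D"
    and "(X, Y) \<in> Omega_fn D"
    and "eigenvalues_of (jacobian X (at 0)) l1p l2p"
    and "eigenvalues_of (jacobian Y (at 0)) l1m l2m"
    and "\<beta> = beta_fn l1p l2p l1m l2m"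
  shows "(X_fn, Y_fn \<beta>) \<in> Omega_fn D \<and>
         locally_Sigma_equivalent D (X, Y) (X_fn, Y_fn \<beta>)"
proof -
  let ?A = "jacobian X (at 0)" and ?B = "jacobian Y (at 0)"
  have Om1: "(X, Y) \<in> Omega1 D" using assms(4) unfolding Omega_fn_def by blast
  then have Om0: "(X, Y) \<in> Omega0 D" unfolding Omega1_def by blast
  have C1: "X \<in> C1_fields D" "Y \<in> C1_fields D" and zero: "X 0 = 0" "Y 0 = 0"
    and cc: "?A $ 2 $ 1 * ?B $ 2 $ 1 > 0"
    using Om0 unfolding Omega0_def Omega_def by auto
  have gaps: "det_gap ?A \<noteq> 0" "det_gap ?B \<noteq> 0"
    using Om1 real_eigenvalues_iff(3) unfolding Omega1_def by blast+
  obtain m1 m2 n1 n2 where ev: "eigenvalues_of ?A m1 m2" "eigenvalues_of ?B n1 n2"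
    and type: "m1 \<notin> \<real> \<and> m2 \<notin> \<real> \<and> n1 \<in> \<real> \<and> n2 \<in> \<real> \<and> Re (n1 * n2) > 0 \<or>
      n1 \<notin> \<real> \<and> n2 \<notin> \<real> \<and> m1 \<in> \<real> \<and> m2 \<in> \<real> \<and> Re (m1 * m2) > 0"
    using assms(4) unfolding Omega_fn_def by blast
  \<comment> \<open>The eigenvalues witnessing membership in \<open>Omega_fn\<close> and those of
    the statement may be labelled differently; they are compared only through trace, determinant and
    discriminant.\<close>
  have ne: "m1 \<noteq> m2" "n1 \<noteq> n2" "l1p \<noteq> l2p" "l1m \<noteq> l2m"
    using gaps eigenvalues_gap[OF ev(1)] eigenvalues_gap[OF ev(2)] eigenvalues_gap[OF assms(5)]
      eigenvalues_gap[OF assms(6)] by auto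
  have dets: "Re (m1 * m2) = det ?A" "Re (n1 * n2) = det ?B"
    using ev unfolding eigenvalues_of_iff by simp_all
  have cases: "det_gap ?A < 0 \<and> det_gap ?B > 0 \<and> det ?B > 0 \<or> det_gap ?B < 0 \<and> det_gap ?A > 0 \<and> det ?A > 0"
    using type unfolding dets
    using real_eigenvalues_iff[OF ev(1) ne(1)] real_eigenvalues_iff[OF ev(2) ne(2)] by blast
  have sums: "Re (l1p + l2p) = ?A $ 1 $ 1 + ?A $ 2 $ 2" "Re (l1m + l2m) = ?B $ 1 $ 1 + ?B $ 2 $ 2"
    using assms(5,6) unfolding eigenvalues_of_iff by simp_all
  have "\<exists>\<delta>>0. \<forall>F G. near_linear \<delta> ?A F \<and> near_linear \<delta> ?B G \<longrightarrow> (\<exists>H. orbit_equiv F G X_fn (Y_fn \<beta>) H)"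
    and \<beta>: "\<beta> = 1 \<or> \<beta> = -1"
  proof -
    have trace: "M $ 1 $ 1 + M $ 2 $ 2 \<noteq> 0" if "det_gap M > 0" "det M > 0" for M :: "real^2^2"
      using that by (auto simp: det_gap_def)
    have "(\<exists>\<delta>>0. \<forall>F G. near_linear \<delta> ?A F \<and> near_linear \<delta> ?B G \<longrightarrow> (\<exists>H. orbit_equiv F G X_fn (Y_fn \<beta>) H)) \<and>
      (\<beta> = 1 \<or> \<beta> = -1)"
      using cases
    proof
      assume c: "det_gap ?A < 0 \<and> det_gap ?B > 0 \<and> det ?B > 0"
      then have "l1m \<in> \<real> \<and> l2m \<in> \<real>" using real_eigenvalues_iff(1)[OF assms(6) ne(4)] by blast
      then have b: "\<beta> = sgn (?B $ 1 $ 1 + ?B $ 2 $ 2)" using assms(7) sums by (simp add: beta_fn_def)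
      show ?thesis using orbit_equiv_focus_node[OF cc _ _ _ b] c trace[of ?B] sgn_cases(1) b by blast
    next
      assume c: "det_gap ?B < 0 \<and> det_gap ?A > 0 \<and> det ?A > 0"
      then have "\<not> (l1m \<in> \<real> \<and> l2m \<in> \<real>)" using real_eigenvalues_iff(2)[OF assms(6) ne(4)] by blast
      then have b: "\<beta> = sgn (?A $ 1 $ 1 + ?A $ 2 $ 2)"
        using assms(7) unfolding beta_fn_def sums by (simp only: if_False)
      show ?thesis using orbit_equiv_node_focus[OF cc _ _ _ b] c trace[of ?A] sgn_cases(1) b by blast
    qed
    then show "\<exists>\<delta>>0. \<forall>F G. near_linear \<delta> ?A F \<and> near_linear \<delta> ?B G \<longrightarrow> (\<exists>H. orbit_equiv F G X_fn (Y_fn \<beta>) H)"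
      "\<beta> = 1 \<or> \<beta> = -1" by blast+
  qed
  then obtain \<delta> where \<delta>: "\<delta> > 0"
    "\<And>F G. near_linear \<delta> ?A F \<Longrightarrow> near_linear \<delta> ?B G \<Longrightarrow> \<exists>H. orbit_equiv F G X_fn (Y_fn \<beta>) H" by blast
  have c0: "\<bar>?A $ 2 $ 1\<bar> > 0" "\<bar>?B $ 2 $ 1\<bar> > 0" using cc by auto
  \<comment> \<open>The last two bounds make the extended fields cross the line in the same
    direction as their linear parts.\<close>
  define \<epsilon> where "\<epsilon> = min \<delta> (min (\<bar>?A $ 2 $ 1\<bar> / 2) (\<bar>?B $ 2 $ 1\<bar> / 2))"
  have \<epsilon>: "\<epsilon> > 0" "\<epsilon> \<le> \<delta>" "\<epsilon> < \<bar>?A $ 2 $ 1\<bar>" "\<epsilon> < \<bar>?B $ 2 $ 1\<bar>"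
    using \<delta>(1) c0 by (auto simp: \<epsilon>_def min_def)
  obtain F e1 where F: "e1 > 0" "ball 0 e1 \<subseteq> D" "\<And>p. p \<in> ball 0 e1 \<Longrightarrow> F p = X p" "near_linear \<epsilon> ?A F"
    using C1_extension[OF C1(1) assms(1,3) zero(1) \<epsilon>(1)] by metis
  obtain G e2 where G: "e2 > 0" "ball 0 e2 \<subseteq> D" "\<And>p. p \<in> ball 0 e2 \<Longrightarrow> G p = Y p" "near_linear \<epsilon> ?B G"
    using C1_extension[OF C1(2) assms(1,3) zero(2) \<epsilon>(1)] by metis
  obtain H where H: "orbit_equiv F G X_fn (Y_fn \<beta>) H"
    using \<delta>(2)[OF near_linear_mono[OF F(4) \<epsilon>(2)] near_linear_mono[OF G(4) \<epsilon>(2)]] by blast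
  have "locally_Sigma_equivalent D (X, Y) (X_fn, Y_fn \<beta>)"
  \<comment> \<open>For the model, whose fields are not modified, any radius with its ball inside
    \<open>D\<close> will do; \<open>e1\<close> is one.\<close>
  proof (rule locally_Sigma_equivalentI[OF assms(1,3) H, of "min e1 e2" e1])
    fix p :: "real^2" assume p: "p \<in> ball 0 (min e1 e2)" "p $ 2 = 0" "p \<noteq> 0"
    have f: "F p = X p" "G p = Y p" using F(3) G(3) p(1) by auto
    \<comment> \<open>Each factor is positive by the crossing direction of its linear part; the
      product of the two lower left entries is positive as well and can be cancelled.\<close>
    have "(?A $ 2 $ 1 * p $ 1 * X p $ 2) * (?B $ 2 $ 1 * p $ 1 * Y p $ 2) > 0"
      unfolding f[symmetric]
      by (intro mult_pos_pos near_linear_axis_sign[OF F(4) \<epsilon>(3) p(2,3)] near_linear_axis_sign[OF G(4) \<epsilon>(4) p(2,3)])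
    also have "(?A $ 2 $ 1 * p $ 1 * X p $ 2) * (?B $ 2 $ 1 * p $ 1 * Y p $ 2)
        = ((?A $ 2 $ 1 * ?B $ 2 $ 1) * (p $ 1)\<^sup>2) * (X p $ 2 * Y p $ 2)"
      by (simp add: power2_eq_square mult_ac)
    finally show "X p $ 2 * Y p $ 2 > 0"
      using cc by (metis mult_nonneg_nonneg zero_le_power2 less_imp_le zero_less_mult_pos not_le mult_nonneg_nonpos)
  next
    fix p :: "real^2" assume "p $ 2 = 0" "p \<noteq> 0"
    then show "X_fn p $ 2 * Y_fn \<beta> p $ 2 > 0" by (auto simp: eq_real2 zero_less_mult_iff)
  qed (use F G zero in \<open>auto simp: eq_real2\<close>)
  with model_in_Omega_fn[OF \<beta>] show ?thesis by blast
qed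

end
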